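(* Let $\alpha$ be an endomorphism of a unital $C^*$-algebra $A$, and let $L$ be a transfer operator for $(A,\alpha)$ which is almost faithful on $K_\alpha$. Suppose $B$ is a $C^*$-algebra and $(\rho,V)$ is a covariant representation of $(A,\alpha,L)$ in $B$ satisfying: (1') $\rho$ is faithful; (2') for $a\in J(M_L)$, $\rho(a)=(\psi_V,\rho)^{(1)}(\phi(a))$ implies $j_A(a)=(\psi_T,j_A)^{(1)}(\phi(a))$; (3) there exists a strongly continuous action $\beta:\mathbb{T}\to\operatorname{Aut}\big(\tau_{\rho,V}(A\rtimes_{\alpha,L}\mathbb{N})\big)$ such that $\beta_z\circ\tau_{\rho,V}=\tau_{\rho,V}\circ\delta_z$ for all $z\in\mathbb{T}$. Then the corresponding representation $\tau_{\rho,V}:A\rtimes_{\alpha,L}\mathbb{N}\to B$ is faithful.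
   Context: Endomorphisms are $*$-homomorphisms $\alpha:A\to A$, not assumed unital or injective. A transfer operator for $(A,\alpha)$ is a continuous linear map $L:A\to A$ that is positive ($a\ge 0\Rightarrow L(a)\ge 0$) and satisfies $L(\alpha(a)b)=aL(b)$ for all $a,b\in A$. $L$ is almost faithful on an ideal $I$ of $A$ if: whenever $a\in I$ and $L((ab)^*ab)=0$ for all $b\in A$, then $a=0$. A Toeplitz-covariant representation $(\rho,V)$ of $(A,\alpha,L)$ in a $C^*$-algebra $B$ is a unital homomorphism $\rho:A\to B$ and an element $V\in B$ with $V\rho(a)=\rho(\alpha(a))V$ and $V^*\rho(a)V=\rho(L(a))$ for all $a\in A$. $\mathcal{T}(A,\alpha,L)$ is the universal unital $C^*$-algebra generated by a Toeplitz-covariant representation $(i_A,S)$; $i_A$ is injective. The bimodule $M_L$: let $A_L$ be a copy of the vector space $A$ with right action $m\cdot a=m\alpha(a)$ and $A$-valued form $\langle m,n\rangle_L=L(m^*n)$; let $N=\{a\in A_L:\langle a,a\rangle_L=0\}$, let $q:A_L\to A_L/N$ be the quotient map, and let $M_L$ be the right Hilbert $A$-module obtained by completing $A_L/N$, with left action $\phi:A\to\mathcal{L}(M_L)$, $\phi(a)q(b)=q(ab)$. Let $\Theta_{x,y}(z)=x\cdot\langle y,z\rangle_L$, let $\mathcal{K}(M_L)$ be the closed span of the $\Theta_{x,y}$, let $J(M_L):=\phi^{-1}(\mathcal{K}(M_L))$, and let $K_\alpha:=\overline{A\alpha(A)A}\cap J(M_L)$, where $\overline{A\alpha(A)A}$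 is the closed linear span of the products $a\alpha(b)c$. A Toeplitz representation $(\psi,\pi)$ of $M_L$ in $B$ is a linear map $\psi:M_L\to B$ and a homomorphism $\pi:A\to B$ with $\psi(x\cdot a)=\psi(x)\pi(a)$, $\psi(x)^*\psi(y)=\pi(\langle x,y\rangle_L)$, $\psi(\phi(a)x)=\pi(a)\psi(x)$; it induces a homomorphism $(\psi,\pi)^{(1)}:\mathcal{K}(M_L)\to B$ with $(\psi,\pi)^{(1)}(\Theta_{x,y})=\psi(x)\psi(y)^*$. Every Toeplitz-covariant representation $(\rho,V)$ gives a Toeplitz representation $(\psi_V,\rho)$ of $M_L$, where $\psi_V$ is the bounded linear map with $\psi_V(q(a))=\rho(a)V$. A covariant representation of $(A,\alpha,L)$ is a Toeplitz-covariant representation $(\rho,V)$ which in addition satisfies $\rho(a)=(\psi_V,\rho)^{(1)}(\phi(a))$ for all $a\in K_\alpha$. Crossed product: a redundancy is a pair $(i_A(a),k)$ with $a\in A$, $k\in\overline{i_A(A)SS^*i_A(A)}$ (closed linear span) and $i_A(a)i_A(b)S=k\,i_A(b)S$ for all $b\in A$. Exel's crossed product $A\rtimes_{\alpha,L}\mathbb{N}$ is the quotient of $\mathcal{T}(A,\alpha,L)$ by the closed two-sided ideal generated by $\{i_A(a)-k: (i_A(a),k)\text{ is a redundancy with } a\in\overline{A\alpha(A)A}\}$; $Q$ is the quotient map, $j_A:=Q\circ i_A$ and $T:=Q(S)$. The pair $(j_A,T)$ is itself a covariant representation (so $\psi_T:M_L\to A\rtimes_{\alpha,L}\mathbb{N}$,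 $\psi_T(q(a))=j_A(a)T$, is defined) and is universal: for each covariant representation $(\rho,V)$ in $B$, $\tau_{\rho,V}:A\rtimes_{\alpha,L}\mathbb{N}\to B$ denotes the homomorphism with $\tau_{\rho,V}\circ j_A=\rho$ and $\tau_{\rho,V}(T)=V$. The gauge action $\delta:\mathbb{T}\to\operatorname{Aut}(A\rtimes_{\alpha,L}\mathbb{N})$ is the strongly continuous action with $\delta_z(j_A(a))=j_A(a)$ and $\delta_z(T)=zT$. *)

theory Defs
  imports "HOL-Analysis.Analysis"
begin

section \<open>Complex Banach spaces and unital \<open>C\<^sup>*\<close>-algebras\<close>

class complex_banach = banach +
  fixes scaleC :: "complex \<Rightarrow> 'a \<Rightarrow> 'a"  (infixr "*\<^sub>C" 75)
  assumes scaleC_add_right: "c *\<^sub>C (x + y) = c *\<^sub>C x + c *\<^sub>C y"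
    and scaleC_add_left: "(c + d) *\<^sub>C x = c *\<^sub>C x + d *\<^sub>C x"
    and scaleC_scaleC: "c *\<^sub>C (d *\<^sub>C x) = (c * d) *\<^sub>C x"
    and scaleR_scaleC: "r *\<^sub>R x = complex_of_real r *\<^sub>C x"
    and norm_scaleC: "norm (c *\<^sub>C x) = cmod c * norm x"

lemma scaleC_one: "1 *\<^sub>C x = (x :: 'a::complex_banach)"
  using scaleR_scaleC[of 1 x] by simp

global_interpretation complex_vector: vector_space "scaleC :: complex \<Rightarrow> 'a \<Rightarrow> 'a::complex_banach"
  defines csubspace = complex_vector.subspace
    and cspan = complex_vector.span
  by standard (simp_all add: scaleC_add_right scaleC_add_left scaleC_scaleC scaleC_one)

abbreviation clinear :: "('a::complex_banach \<Rightarrow> 'b::complex_banach) \<Rightarrow> bool" where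
  "clinear \<equiv> Vector_Spaces.linear scaleC scaleC"

text \<open>Complex multiples of bounded operators, so that \<open>'a \<Rightarrow>\<^sub>L 'b\<close> with the operator norm is a
  complex Banach space (its elements are the real-linear bounded operators).\<close>

instantiation blinfun :: (real_normed_vector, complex_banach) complex_banach
begin

definition scaleC_blinfun :: "complex \<Rightarrow> 'a \<Rightarrow>\<^sub>L 'b \<Rightarrow> 'a \<Rightarrow>\<^sub>L 'b" where
  "c *\<^sub>C f = Blinfun (\<lambda>x. c *\<^sub>C blinfun_apply f x)"

lemma bounded_linear_scaleC: "bounded_linear (\<lambda>x. c *\<^sub>C (x :: 'b))"
proof (rule bounded_linear_intro[where K = "cmod c"])
  show "c *\<^sub>C (r *\<^sub>R x) = r *\<^sub>R (c *\<^sub>C x)" for r and x :: 'b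
    by (simp add: scaleR_scaleC scaleC_scaleC mult.commute)
qed (simp_all add: scaleC_add_right norm_scaleC mult.commute)

lemma blinfun_apply_scaleC: "blinfun_apply (c *\<^sub>C f) x = c *\<^sub>C blinfun_apply f x"
  for f :: "'a \<Rightarrow>\<^sub>L 'b"
  unfolding scaleC_blinfun_def
  by (subst bounded_linear_Blinfun_apply)
    (rule bounded_linear_compose[OF bounded_linear_scaleC blinfun.bounded_linear_right], rule refl)

lemma norm_scaleC_blinfun_le: "norm (c *\<^sub>C f) \<le> cmod c * norm f" for f :: "'a \<Rightarrow>\<^sub>L 'b"
proof (rule norm_blinfun_bound)
  fix x
  have "cmod c * norm (blinfun_apply f x) \<le> cmod c * (norm f * norm x)"
    by (intro mult_left_mono norm_blinfun) simp
  then show "norm (blinfun_apply (c *\<^sub>C f) x) \<le> cmod c * norm f * norm x"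
    by (simp add: blinfun_apply_scaleC norm_scaleC mult.assoc)
qed simp

instance
proof
  fix c d :: complex and r :: real and f g :: "'a \<Rightarrow>\<^sub>L 'b"
  show "c *\<^sub>C (f + g) = c *\<^sub>C f + c *\<^sub>C g"
    by (rule blinfun_eqI) (simp add: blinfun_apply_scaleC blinfun.add_left scaleC_add_right)
  show "(c + d) *\<^sub>C f = c *\<^sub>C f + d *\<^sub>C f"
    by (rule blinfun_eqI) (simp add: blinfun_apply_scaleC blinfun.add_left scaleC_add_left)
  show sc: "c *\<^sub>C (d *\<^sub>C f) = (c * d) *\<^sub>C f" for c d
    by (rule blinfun_eqI) (simp add: blinfun_apply_scaleC scaleC_scaleC)
  show "r *\<^sub>R f = complex_of_real r *\<^sub>C f"
    by (rule blinfun_eqI) (simp add: blinfun_apply_scaleC blinfun.scaleR_left scaleR_scaleC)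
  show "norm (c *\<^sub>C f) = cmod c * norm f"
  proof (cases "c = 0")
    case True
    then show ?thesis
      using norm_scaleC_blinfun_le[of 0 f] by simp
  next
    case False
    have "1 *\<^sub>C f = f"
      by (rule blinfun_eqI) (simp add: blinfun_apply_scaleC scaleC_one)
    then have "norm f = norm (inverse c *\<^sub>C (c *\<^sub>C f))"
      using False by (simp add: sc)
    also have "\<dots> \<le> cmod (inverse c) * norm (c *\<^sub>C f)"
      by (rule norm_scaleC_blinfun_le)
    finally have "cmod c * norm f \<le> norm (c *\<^sub>C f)"
      using False by (simp add: norm_inverse norm_divide field_simps)
    then show ?thesis
      using norm_scaleC_blinfun_le[of c f] by simp
  qed
qed

end

text \<open>The zero algebra is allowed (\<^class>\<open>monoid_mult\<close> instead of \<^class>\<open>ring_1\<close>): Exel's crossed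
  product of a nonzero algebra may vanish.\<close>

class cstar_algebra = complex_banach + real_normed_algebra + monoid_mult +
  fixes star :: "'a \<Rightarrow> 'a"
  assumes mult_scaleC_left: "(c *\<^sub>C x) * y = c *\<^sub>C (x * y)"
    and mult_scaleC_right: "x * (c *\<^sub>C y) = c *\<^sub>C (x * y)"
    and star_add: "star (x + y) = star x + star y"
    and star_scaleC: "star (c *\<^sub>C x) = cnj c *\<^sub>C star x"
    and star_star: "star (star x) = x"
    and star_mult: "star (x * y) = star y * star x"
    and cstar_identity: "norm (star x * x) = (norm x)\<^sup>2"

definition positive :: "'a::cstar_algebra \<Rightarrow> bool" where
  "positive a \<longleftrightarrow> (\<exists>b. a = star b * b)"

definition star_hom :: "('a::cstar_algebra \<Rightarrow> 'b::cstar_algebra) \<Rightarrow> bool" where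
  "star_hom f \<longleftrightarrow> clinear f \<and> (\<forall>x y. f (x * y) = f x * f y) \<and> (\<forall>x. f (star x) = star (f x))"

definition closed_ideal :: "'a::cstar_algebra set \<Rightarrow> bool" where
  "closed_ideal I \<longleftrightarrow> closed I \<and> csubspace I \<and> (\<forall>x\<in>I. \<forall>y. y * x \<in> I \<and> x * y \<in> I)"

definition closed_star_subalgebra :: "'a::cstar_algebra set \<Rightarrow> bool" where
  "closed_star_subalgebra C \<longleftrightarrow>
     closed C \<and> csubspace C \<and> (\<forall>x\<in>C. \<forall>y\<in>C. x * y \<in> C) \<and> (\<forall>x\<in>C. star x \<in> C)"

text \<open>A strongly continuous action of the circle by \<open>*\<close>-automorphisms of the \<open>C\<^sup>*\<close>-algebra \<open>R\<close>,
  given as a subset of a type.\<close>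

definition circle_action ::
    "'a::cstar_algebra set \<Rightarrow> (complex \<Rightarrow> 'a \<Rightarrow> 'a) \<Rightarrow> bool" where
  "circle_action R \<beta> \<longleftrightarrow>
     (\<forall>z\<in>sphere 0 1.
        bij_betw (\<beta> z) R R \<and>
        (\<forall>x\<in>R. \<forall>y\<in>R. \<beta> z (x + y) = \<beta> z x + \<beta> z y) \<and>
        (\<forall>c. \<forall>x\<in>R. \<beta> z (c *\<^sub>C x) = c *\<^sub>C \<beta> z x) \<and>
        (\<forall>x\<in>R. \<forall>y\<in>R. \<beta> z (x * y) = \<beta> z x * \<beta> z y) \<and>
        (\<forall>x\<in>R. \<beta> z (star x) = star (\<beta> z x))) \<and>
     (\<forall>x\<in>R. \<beta> 1 x = x) \<and>
     (\<forall>z\<in>sphere 0 1. \<forall>w\<in>sphere 0 1. \<forall>x\<in>R. \<beta> (z * w) x = \<beta> z (\<beta> w x)) \<and>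
     (\<forall>x\<in>R. continuous_on (sphere 0 1) (\<lambda>z. \<beta> z x))"

section \<open>Transfer operators and Toeplitz-covariant representations\<close>

definition transfer_operator ::
    "('a::cstar_algebra \<Rightarrow> 'a) \<Rightarrow> ('a \<Rightarrow> 'a) \<Rightarrow> bool" where
  "transfer_operator \<alpha> L \<longleftrightarrow>
     clinear L \<and> continuous_on UNIV L \<and> (\<forall>a. positive a \<longrightarrow> positive (L a)) \<and>
     (\<forall>a b. L (\<alpha> a * b) = a * L b)"

definition almost_faithful_on :: "('a::cstar_algebra \<Rightarrow> 'a) \<Rightarrow> 'a set \<Rightarrow> bool" where
  "almost_faithful_on L I \<longleftrightarrow>
     (\<forall>a\<in>I. (\<forall>b. L (star (a * b) * (a * b)) = 0) \<longrightarrow> a = 0)"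

definition toeplitz_covariant ::
    "('a::cstar_algebra \<Rightarrow> 'a) \<Rightarrow> ('a \<Rightarrow> 'a) \<Rightarrow> ('a \<Rightarrow> 'b::cstar_algebra) \<Rightarrow> 'b \<Rightarrow> bool" where
  "toeplitz_covariant \<alpha> L \<rho> V \<longleftrightarrow>
     star_hom \<rho> \<and> \<rho> 1 = 1 \<and>
     (\<forall>a. V * \<rho> a = \<rho> (\<alpha> a) * V) \<and> (\<forall>a. star V * \<rho> a * V = \<rho> (L a))"

section \<open>The Toeplitz algebra\<close>

text \<open>The universal property of the Toeplitz algebra quantifies over all unital \<open>C\<^sup>*\<close>-algebras.
  To express this inside a formula, the target algebras are given by explicit carriers and
  operations, instead of by type class instances.\<close>

record 'u cstar_structure =
  carr :: "'u set"
  cadd :: "'u \<Rightarrow> 'u \<Rightarrow> 'u"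
  czero :: 'u
  cscale :: "complex \<Rightarrow> 'u \<Rightarrow> 'u"
  cmult :: "'u \<Rightarrow> 'u \<Rightarrow> 'u"
  cone :: 'u
  cstar :: "'u \<Rightarrow> 'u"
  cnorm :: "'u \<Rightarrow> real"

definition cdist :: "'u cstar_structure \<Rightarrow> 'u \<Rightarrow> 'u \<Rightarrow> real" where
  "cdist B x y = cnorm B (cadd B x (cscale B (-1) y))"

locale unital_cstar_algebra =
  fixes B :: "'u cstar_structure"
  assumes add_closed: "\<lbrakk>x \<in> carr B; y \<in> carr B\<rbrakk> \<Longrightarrow> cadd B x y \<in> carr B"
    and zero_closed: "czero B \<in> carr B"
    and scale_closed: "x \<in> carr B \<Longrightarrow> cscale B c x \<in> carr B"
    and mult_closed: "\<lbrakk>x \<in> carr B; y \<in> carr B\<rbrakk> \<Longrightarrow> cmult B x y \<in> carr B"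
    and one_closed: "cone B \<in> carr B"
    and star_closed: "x \<in> carr B \<Longrightarrow> cstar B x \<in> carr B"
    and add_assoc: "\<lbrakk>x \<in> carr B; y \<in> carr B; z \<in> carr B\<rbrakk>
          \<Longrightarrow> cadd B (cadd B x y) z = cadd B x (cadd B y z)"
    and add_commute: "\<lbrakk>x \<in> carr B; y \<in> carr B\<rbrakk> \<Longrightarrow> cadd B x y = cadd B y x"
    and add_zero: "x \<in> carr B \<Longrightarrow> cadd B x (czero B) = x"
    and add_inverse: "x \<in> carr B \<Longrightarrow> cadd B x (cscale B (-1) x) = czero B"
    and scale_add_right: "\<lbrakk>x \<in> carr B; y \<in> carr B\<rbrakk>
          \<Longrightarrow> cscale B c (cadd B x y) = cadd B (cscale B c x) (cscale B c y)"
    and scale_add_left: "x \<in> carr B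
          \<Longrightarrow> cscale B (c + d) x = cadd B (cscale B c x) (cscale B d x)"
    and scale_scale: "x \<in> carr B \<Longrightarrow> cscale B c (cscale B d x) = cscale B (c * d) x"
    and scale_one: "x \<in> carr B \<Longrightarrow> cscale B 1 x = x"
    and mult_assoc: "\<lbrakk>x \<in> carr B; y \<in> carr B; z \<in> carr B\<rbrakk>
          \<Longrightarrow> cmult B (cmult B x y) z = cmult B x (cmult B y z)"
    and mult_add_left: "\<lbrakk>x \<in> carr B; y \<in> carr B; z \<in> carr B\<rbrakk>
          \<Longrightarrow> cmult B (cadd B x y) z = cadd B (cmult B x z) (cmult B y z)"
    and mult_add_right: "\<lbrakk>x \<in> carr B; y \<in> carr B; z \<in> carr B\<rbrakk>
          \<Longrightarrow> cmult B x (cadd B y z) = cadd B (cmult B x y) (cmult B x z)"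
    and mult_scale_left: "\<lbrakk>x \<in> carr B; y \<in> carr B\<rbrakk>
          \<Longrightarrow> cmult B (cscale B c x) y = cscale B c (cmult B x y)"
    and mult_scale_right: "\<lbrakk>x \<in> carr B; y \<in> carr B\<rbrakk>
          \<Longrightarrow> cmult B x (cscale B c y) = cscale B c (cmult B x y)"
    and one_mult: "x \<in> carr B \<Longrightarrow> cmult B (cone B) x = x"
    and mult_one: "x \<in> carr B \<Longrightarrow> cmult B x (cone B) = x"
    and star_add: "\<lbrakk>x \<in> carr B; y \<in> carr B\<rbrakk>
          \<Longrightarrow> cstar B (cadd B x y) = cadd B (cstar B x) (cstar B y)"
    and star_scale: "x \<in> carr B \<Longrightarrow> cstar B (cscale B c x) = cscale B (cnj c) (cstar B x)"
    and star_star: "x \<in> carr B \<Longrightarrow> cstar B (cstar B x) = x"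
    and star_mult: "\<lbrakk>x \<in> carr B; y \<in> carr B\<rbrakk>
          \<Longrightarrow> cstar B (cmult B x y) = cmult B (cstar B y) (cstar B x)"
    and norm_nonneg: "x \<in> carr B \<Longrightarrow> 0 \<le> cnorm B x"
    and norm_eq_zero: "x \<in> carr B \<Longrightarrow> cnorm B x = 0 \<longleftrightarrow> x = czero B"
    and norm_triangle: "\<lbrakk>x \<in> carr B; y \<in> carr B\<rbrakk>
          \<Longrightarrow> cnorm B (cadd B x y) \<le> cnorm B x + cnorm B y"
    and norm_scale: "x \<in> carr B \<Longrightarrow> cnorm B (cscale B c x) = cmod c * cnorm B x"
    and norm_mult: "\<lbrakk>x \<in> carr B; y \<in> carr B\<rbrakk>
          \<Longrightarrow> cnorm B (cmult B x y) \<le> cnorm B x * cnorm B y"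
    and cstar_id: "x \<in> carr B \<Longrightarrow> cnorm B (cmult B (cstar B x) x) = (cnorm B x)\<^sup>2"
    and complete: "\<lbrakk>\<And>n::nat. s n \<in> carr B;
          \<And>e. e > 0 \<Longrightarrow> \<exists>N. \<forall>m\<ge>N. \<forall>n\<ge>N. cdist B (s m) (s n) < e\<rbrakk>
          \<Longrightarrow> \<exists>x\<in>carr B. (\<lambda>n. cdist B (s n) x) \<longlonglongrightarrow> 0"

definition star_hom_into ::
    "'u cstar_structure \<Rightarrow> ('a::cstar_algebra \<Rightarrow> 'u) \<Rightarrow> bool" where
  "star_hom_into B f \<longleftrightarrow>
     (\<forall>x. f x \<in> carr B) \<and>
     (\<forall>x y. f (x + y) = cadd B (f x) (f y)) \<and>
     (\<forall>c x. f (c *\<^sub>C x) = cscale B c (f x)) \<and>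
     (\<forall>x y. f (x * y) = cmult B (f x) (f y)) \<and>
     (\<forall>x. f (star x) = cstar B (f x))"

definition toeplitz_covariant_into ::
    "('a::cstar_algebra \<Rightarrow> 'a) \<Rightarrow> ('a \<Rightarrow> 'a) \<Rightarrow> 'u cstar_structure \<Rightarrow> ('a \<Rightarrow> 'u) \<Rightarrow> 'u \<Rightarrow> bool" where
  "toeplitz_covariant_into \<alpha> L B \<rho> V \<longleftrightarrow>
     star_hom_into B \<rho> \<and> \<rho> 1 = cone B \<and> V \<in> carr B \<and>
     (\<forall>a. cmult B V (\<rho> a) = cmult B (\<rho> (\<alpha> a)) V) \<and>
     (\<forall>a. cmult B (cmult B (cstar B V) (\<rho> a)) V = \<rho> (L a))"

definition type_cstar_structure :: "'a::cstar_algebra cstar_structure" where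
  "type_cstar_structure =
     \<lparr>carr = UNIV, cadd = (+), czero = 0, cscale = scaleC, cmult = (*), cone = 1,
      cstar = star, cnorm = norm\<rparr>"

lemma scaleC_minus_one: "(-1) *\<^sub>C x = - (x :: 'a::complex_banach)"
  using complex_vector.scale_minus_left[of 1 x] by (simp add: scaleC_one)

lemma unital_cstar_algebra_type:
  "unital_cstar_algebra (type_cstar_structure :: 'a::cstar_algebra cstar_structure)"
proof
  fix s :: "nat \<Rightarrow> 'a"
  assume *: "\<And>e. e > 0 \<Longrightarrow>
    \<exists>N. \<forall>m\<ge>N. \<forall>n\<ge>N. cdist type_cstar_structure (s m) (s n) < e"
  have "Cauchy s"
    using * by (auto simp: Cauchy_def cdist_def type_cstar_structure_def scaleC_minus_one dist_norm)
  then obtain x where "s \<longlonglongrightarrow> x"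
    by (auto simp: Cauchy_convergent_iff convergent_def)
  then have "(\<lambda>n. cdist type_cstar_structure (s n) x) \<longlonglongrightarrow> 0"
    by (simp add: cdist_def type_cstar_structure_def scaleC_minus_one
        tendsto_norm_zero_iff LIM_zero_iff)
  then show "\<exists>x\<in>carr type_cstar_structure. (\<lambda>n. cdist type_cstar_structure (s n) x) \<longlonglongrightarrow> 0"
    by (auto simp: type_cstar_structure_def)
qed (simp_all add: type_cstar_structure_def scaleC_minus_one scaleC_add_right scaleC_add_left
      scaleC_scaleC scaleC_one algebra_simps mult_scaleC_left mult_scaleC_right star_add star_scaleC
      star_star star_mult norm_triangle_ineq norm_scaleC norm_mult_ineq cstar_identity)

lemma star_hom_into_type: "star_hom_into type_cstar_structure f \<longleftrightarrow> star_hom f"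
proof -
  have "clinear f \<longleftrightarrow> (\<forall>x y. f (x + y) = f x + f y) \<and> (\<forall>c x. f (c *\<^sub>C x) = c *\<^sub>C f x)"
    by (auto simp: Vector_Spaces.linear_iff complex_vector.vector_space_axioms)
  then show ?thesis
    by (auto simp: star_hom_into_def star_hom_def type_cstar_structure_def)
qed

lemma toeplitz_covariant_into_type:
  "toeplitz_covariant_into \<alpha> L type_cstar_structure \<rho> V \<longleftrightarrow> toeplitz_covariant \<alpha> L \<rho> V"
  unfolding toeplitz_covariant_into_def toeplitz_covariant_def star_hom_into_type
  by (simp add: type_cstar_structure_def)

text \<open>\<open>(i, S)\<close> generates its \<open>C\<^sup>*\<close>-algebra \<open>'t\<close> and is universal among the Toeplitz-covariant
  representations. Target algebras carried by subsets of \<open>nat \<Rightarrow> 'a\<close> suffice: the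
  \<open>C\<^sup>*\<close>-algebra generated by a Toeplitz-covariant representation is the closure of a set of
  cardinality at most that of \<open>'a\<close> (the \<open>*\<close>-polynomials in \<open>\<rho>(a)\<close> and \<open>V\<close>), and each of its points
  is the limit of a sequence from that set, so it has an isomorphic copy of this form.\<close>

definition toeplitz_algebra ::
    "('a::cstar_algebra \<Rightarrow> 'a) \<Rightarrow> ('a \<Rightarrow> 'a) \<Rightarrow> ('a \<Rightarrow> 't::cstar_algebra) \<Rightarrow> 't \<Rightarrow> bool" where
  "toeplitz_algebra \<alpha> L i S \<longleftrightarrow>
     toeplitz_covariant \<alpha> L i S \<and>
     closed_star_subalgebra hull (insert S (range i)) = UNIV \<and>
     (\<forall>(B :: (nat \<Rightarrow> 'a) cstar_structure) \<rho> V.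
        unital_cstar_algebra B \<and> toeplitz_covariant_into \<alpha> L B \<rho> V \<longrightarrow>
        (\<exists>h. star_hom_into B h \<and> h 1 = cone B \<and> (\<forall>a. h (i a) = \<rho> a) \<and> h S = V))"

section \<open>Exel's crossed product\<close>

definition ideal_range :: "('a::cstar_algebra \<Rightarrow> 'a) \<Rightarrow> 'a set" where
  "ideal_range \<alpha> = closure (cspan {a * \<alpha> b * c | a b c. True})"

definition redundancy ::
    "('a::cstar_algebra \<Rightarrow> 't::cstar_algebra) \<Rightarrow> 't \<Rightarrow> 'a \<Rightarrow> 't \<Rightarrow> bool" where
  "redundancy i S a k \<longleftrightarrow>
     k \<in> closure (cspan {i b * S * star S * i c | b c. True}) \<and>
     (\<forall>b. i a * i b * S = k * (i b * S))"

text \<open>A quotient of \<open>'t\<close> is given by a surjective \<open>*\<close>-homomorphism with the prescribed kernel.\<close>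

definition exel_quotient ::
    "('a::cstar_algebra \<Rightarrow> 'a) \<Rightarrow> ('a \<Rightarrow> 't::cstar_algebra) \<Rightarrow> 't \<Rightarrow> ('t \<Rightarrow> 'c::cstar_algebra) \<Rightarrow> bool"
  where
  "exel_quotient \<alpha> i S Q \<longleftrightarrow>
     star_hom Q \<and> surj Q \<and>
     {x. Q x = 0} = closed_ideal hull {i a - k | a k. redundancy i S a k \<and> a \<in> ideal_range \<alpha>}"

section \<open>The Hilbert bimodule \<open>M_L\<close>\<close>

text \<open>Right Hilbert modules, with right action \<open>ract\<close> and inner product \<open>ip\<close> (conjugate-linear in
  the first variable). Completeness is part of the class \<^class>\<open>complex_banach\<close>.\<close>

locale hilbert_module =
  fixes ract :: "'m::complex_banach \<Rightarrow> 'a::cstar_algebra \<Rightarrow> 'm"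
    and ip :: "'m \<Rightarrow> 'm \<Rightarrow> 'a"
  assumes ract_add_left: "ract (x + y) a = ract x a + ract y a"
    and ract_add_right: "ract x (a + b) = ract x a + ract x b"
    and ract_scaleC_left: "ract (c *\<^sub>C x) a = c *\<^sub>C ract x a"
    and ract_scaleC_right: "ract x (c *\<^sub>C a) = c *\<^sub>C ract x a"
    and ract_mult: "ract x (a * b) = ract (ract x a) b"
    and ip_add_right: "ip x (y + z) = ip x y + ip x z"
    and ip_scaleC_right: "ip x (c *\<^sub>C y) = c *\<^sub>C ip x y"
    and ip_ract: "ip x (ract y a) = ip x y * a"
    and star_ip: "star (ip x y) = ip y x"
    and ip_positive: "positive (ip x x)"
    and norm_ip: "(norm x)\<^sup>2 = norm (ip x x)"

definition is_adjoint ::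
    "('m::complex_banach \<Rightarrow> 'm \<Rightarrow> 'a) \<Rightarrow> ('m \<Rightarrow>\<^sub>L 'm) \<Rightarrow> ('m \<Rightarrow>\<^sub>L 'm) \<Rightarrow> bool" where
  "is_adjoint ip k l \<longleftrightarrow> (\<forall>x y. ip (blinfun_apply k x) y = ip x (blinfun_apply l y))"

text \<open>\<open>'m\<close> is the Hausdorff completion of \<open>A_L\<close>, with canonical map \<open>q\<close>: the kernel of \<open>q\<close> is forced
  to be \<open>N\<close> by \<open>norm_ip\<close> and the formula for \<open>ip (q m) (q n)\<close>.\<close>

definition exel_bimodule ::
    "('a::cstar_algebra \<Rightarrow> 'a) \<Rightarrow> ('a \<Rightarrow> 'a) \<Rightarrow> ('m::complex_banach \<Rightarrow> 'a \<Rightarrow> 'm) \<Rightarrow>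
     ('m \<Rightarrow> 'm \<Rightarrow> 'a) \<Rightarrow> ('a \<Rightarrow> 'm) \<Rightarrow> ('a \<Rightarrow> 'm \<Rightarrow>\<^sub>L 'm) \<Rightarrow> bool" where
  "exel_bimodule \<alpha> L ract ip q \<phi> \<longleftrightarrow>
     hilbert_module ract ip \<and>
     clinear q \<and> closure (range q) = UNIV \<and>
     (\<forall>m a. ract (q m) a = q (m * \<alpha> a)) \<and>
     (\<forall>m n. ip (q m) (q n) = L (star m * n)) \<and>
     (\<forall>a. \<exists>l. is_adjoint ip (\<phi> a) l) \<and>
     (\<forall>a b. blinfun_apply (\<phi> a) (q b) = q (a * b))"

definition rank_one ::
    "('m::complex_banach \<Rightarrow> 'a::cstar_algebra \<Rightarrow> 'm) \<Rightarrow> ('m \<Rightarrow> 'm \<Rightarrow> 'a) \<Rightarrow> 'm \<Rightarrow> 'm \<Rightarrow> ('m \<Rightarrow>\<^sub>L 'm)"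
  where
  "rank_one ract ip x y = Blinfun (\<lambda>z. ract x (ip y z))"

definition compacts ::
    "('m::complex_banach \<Rightarrow> 'a::cstar_algebra \<Rightarrow> 'm) \<Rightarrow> ('m \<Rightarrow> 'm \<Rightarrow> 'a) \<Rightarrow> ('m \<Rightarrow>\<^sub>L 'm) set" where
  "compacts ract ip = closure (cspan {rank_one ract ip x y | x y. True})"

definition ideal_J ::
    "('m::complex_banach \<Rightarrow> 'a::cstar_algebra \<Rightarrow> 'm) \<Rightarrow> ('m \<Rightarrow> 'm \<Rightarrow> 'a) \<Rightarrow> ('a \<Rightarrow> 'm \<Rightarrow>\<^sub>L 'm) \<Rightarrow> 'a set"
  where
  "ideal_J ract ip \<phi> = {a. \<phi> a \<in> compacts ract ip}"

definition ideal_K ::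
    "('a::cstar_algebra \<Rightarrow> 'a) \<Rightarrow> ('m::complex_banach \<Rightarrow> 'a \<Rightarrow> 'm) \<Rightarrow> ('m \<Rightarrow> 'm \<Rightarrow> 'a) \<Rightarrow>
     ('a \<Rightarrow> 'm \<Rightarrow>\<^sub>L 'm) \<Rightarrow> 'a set" where
  "ideal_K \<alpha> ract ip \<phi> = ideal_range \<alpha> \<inter> ideal_J ract ip \<phi>"

section \<open>Covariant representations\<close>

definition psi :: "('a::cstar_algebra \<Rightarrow> 'm::complex_banach) \<Rightarrow> ('a \<Rightarrow> 'b::cstar_algebra) \<Rightarrow> 'b \<Rightarrow> 'm \<Rightarrow> 'b"
  where
  "psi q \<rho> V = (THE f. clinear f \<and> bounded_linear f \<and> (\<forall>a. f (q a) = \<rho> a * V))"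

text \<open>\<open>*\<close>-homomorphisms on the algebra of compact operators; they are total functions of which only
  the values on \<^const>\<open>compacts\<close> matter.\<close>

definition compacts_hom ::
    "('m::complex_banach \<Rightarrow> 'a::cstar_algebra \<Rightarrow> 'm) \<Rightarrow> ('m \<Rightarrow> 'm \<Rightarrow> 'a) \<Rightarrow>
     (('m \<Rightarrow>\<^sub>L 'm) \<Rightarrow> 'b::cstar_algebra) \<Rightarrow> bool" where
  "compacts_hom ract ip h \<longleftrightarrow>
     (\<forall>k\<in>compacts ract ip. \<forall>l\<in>compacts ract ip. h (k + l) = h k + h l) \<and>
     (\<forall>c. \<forall>k\<in>compacts ract ip. h (c *\<^sub>C k) = c *\<^sub>C h k) \<and>
     (\<forall>k\<in>compacts ract ip. \<forall>l\<in>compacts ract ip. h (k o\<^sub>L l) = h k * h l) \<and>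
     (\<forall>k\<in>compacts ract ip. \<forall>l\<in>compacts ract ip. is_adjoint ip k l \<longrightarrow> h l = star (h k))"

text \<open>The homomorphism \<open>(\<psi>, \<pi>)\<^sup>(\<^sup>1\<^sup>)\<close>; its defining property does not involve \<open>\<pi>\<close>, and determines its
  values on \<^const>\<open>compacts\<close>.\<close>

definition induced_hom ::
    "('m::complex_banach \<Rightarrow> 'a::cstar_algebra \<Rightarrow> 'm) \<Rightarrow> ('m \<Rightarrow> 'm \<Rightarrow> 'a) \<Rightarrow>
     ('m \<Rightarrow> 'b::cstar_algebra) \<Rightarrow> ('m \<Rightarrow>\<^sub>L 'm) \<Rightarrow> 'b" where
  "induced_hom ract ip \<psi> =
     (SOME h. compacts_hom ract ip h \<and> (\<forall>x y. h (rank_one ract ip x y) = \<psi> x * star (\<psi> y)))"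

definition covariant ::
    "('a::cstar_algebra \<Rightarrow> 'a) \<Rightarrow> ('a \<Rightarrow> 'a) \<Rightarrow> ('m::complex_banach \<Rightarrow> 'a \<Rightarrow> 'm) \<Rightarrow>
     ('m \<Rightarrow> 'm \<Rightarrow> 'a) \<Rightarrow> ('a \<Rightarrow> 'm) \<Rightarrow> ('a \<Rightarrow> 'm \<Rightarrow>\<^sub>L 'm) \<Rightarrow> ('a \<Rightarrow> 'b::cstar_algebra) \<Rightarrow> 'b \<Rightarrow> bool" where
  "covariant \<alpha> L ract ip q \<phi> \<rho> V \<longleftrightarrow>
     toeplitz_covariant \<alpha> L \<rho> V \<and>
     (\<forall>a\<in>ideal_K \<alpha> ract ip \<phi>. \<rho> a = induced_hom ract ip (psi q \<rho> V) (\<phi> a))"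

end

theory Submission
  imports Defs "HOL-Computational_Algebra.Fundamental_Theorem_Algebra"
begin

text \<open>The hypotheses give more than injectivity of \<open>j\<^sub>A\<close>: if \<open>\<rho>(a)\<close> lies in the closed span
  \<open>B\<^sub>1'\<close> of \<open>\<rho>(A) V V\<^sup>* \<rho>(A)\<close>, then \<open>\<phi>(a)\<close> is compact and, by condition (2'), \<open>j\<^sub>A(a)\<close> lies in
  the closed span \<open>B\<^sub>1\<close> of \<open>j\<^sub>A(A) T T\<^sup>* j\<^sub>A(A)\<close>. Let \<open>D\<^sub>n\<close> be the closed span of
  \<open>j\<^sub>A(A) T\<^sup>k T\<^sup>*\<^sup>k j\<^sub>A(A)\<close>, \<open>k \<le> n\<close>. That \<open>\<tau>\<close> is injective on \<open>D\<^sub>n\<close> follows by induction: a kernel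
  element \<open>x\<close> satisfies \<open>(j\<^sub>A(a)T)\<^sup>* x j\<^sub>A(b)T = 0\<close> by the induction hypothesis, hence annihilates
  \<open>B\<^sub>1\<close>; an approximate unit of \<open>B\<^sub>1\<close> shows that \<open>x\<close> is a limit of elements \<open>j\<^sub>A(a) + k\<close> with
  \<open>k \<in> B\<^sub>1\<close>, and since \<open>\<rho>(a) + \<tau>(k)\<close> is then small, \<open>a\<close> can be cut off to an element whose
  image is in \<open>B\<^sub>1'\<close>. So \<open>x \<in> B\<^sub>1\<close>, and \<open>x = 0\<close>. Finally, averaging the gauge action over roots
  of unity bounds each homogeneous component of a polynomial \<open>p\<close> of degree at most \<open>K\<close> by
  \<open>\<parallel>\<tau>(p)\<parallel>\<close>, so that \<open>\<parallel>p\<parallel> \<le> (2K + 1) \<parallel>\<tau>(p)\<parallel>\<close>; the \<open>C\<^sup>*\<close>-identity, applied to powers, removes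
  the factor, and \<open>\<tau>\<close> is isometric.\<close>

section \<open>Spectra of self-adjoint elements\<close>

text \<open>The subalgebra B_1 alone serves every level n, although a product such as
  \<open>mon a 2 2 b * mon c 1 1 d\<close> has level 2 and B_1 need not be an ideal of D_n. Each
  \<open>mon a k k b\<close> with k at least 1 has the left factor \<open>\<pi> a * T\<close>, so an
  approximate unit of B_1, acting from the left, nearly fixes all terms of positive level at once.
  Only the level-zero term is left over, and multiplying it by 1 - u costs an element of B_1.
  Compactness of \<phi>(a) has its origin in the bimodule: a faithful \<rho> makes \<psi>_V
  isometric, which turns B_1' into a copy of the compact operators on M_L. The compact operator that
  corresponds to \<rho>(a) acts on M_L as \<phi>(a) does. Self-adjoint elements are handled through
  real polynomials that are bounded on an interval around the spectrum. Homomorphisms and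
  subalgebras need not be unital, which explains the polynomials without constant term and the
  quasi-inverses of \<open>neumann\<close>.\<close>

lemma norm_star [simp]: "norm (star x) = norm (x::'a::cstar_algebra)"
proof -
  have le: "norm y \<le> norm (star y)" for y :: 'a
  proof (cases "y = 0")
    case False
    have "norm y * norm y \<le> norm (star y) * norm y"
      using norm_mult_ineq[of "star y" y] by (simp add: cstar_identity power2_eq_square)
    then show ?thesis
      using False by simp
  qed simp
  from le[of x] le[of "star x"] show ?thesis
    by (simp add: star_star)
qed

lemma norm_mult_star: "norm (x * star x) = (norm (x::'a::cstar_algebra))\<^sup>2"
  using cstar_identity[of "star x"] by (simp add: star_star)

lemma star_one [simp]: "star 1 = (1::'a::cstar_algebra)"
  by (metis mult.right_neutral star_mult star_star)

lemma norm_one_le: "norm (1::'a::cstar_algebra) \<le> 1"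
proof (cases "norm (1::'a) = 0")
  case False
  have "(norm (1::'a))\<^sup>2 = norm (1::'a)"
    using cstar_identity[of "1::'a"] by simp
  then show ?thesis
    using False by (simp add: power2_eq_square)
qed simp

lemma star_scaleR: "star (r *\<^sub>R x) = r *\<^sub>R star (x::'a::cstar_algebra)"
  by (simp add: scaleR_scaleC star_scaleC)

lemma bounded_linear_star: "bounded_linear (star :: 'a::cstar_algebra \<Rightarrow> 'a)"
  by (rule bounded_linear_intro[where K = 1]) (simp_all add: star_add star_scaleR)

lemmas star_zero [simp] = linear_0[OF bounded_linear.linear[OF bounded_linear_star]]
lemmas star_diff = linear_diff[OF bounded_linear.linear[OF bounded_linear_star]]
lemmas star_sum = linear_sum[OF bounded_linear.linear[OF bounded_linear_star]]
lemmas tendsto_star [tendsto_intros] = bounded_linear.tendsto[OF bounded_linear_star]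
lemmas continuous_on_star [continuous_intros] =
  bounded_linear.continuous_on[OF bounded_linear_star]
lemmas tendsto_scaleC [tendsto_intros] = bounded_linear.tendsto[OF bounded_linear_scaleC]

lemma star_power: "star (x ^ n) = star (x::'a::cstar_algebra) ^ n"
  by (induction n) (simp_all add: star_mult power_commutes)

text \<open>Each squaring is an instance of the C*-identity. Along the exponents
  \<open>2 ^ n\<close> this takes the place of a spectral radius formula.\<close>

lemma norm_selfadjoint_power:
  fixes b :: "'a::cstar_algebra"
  assumes "star b = b"
  shows "norm (b ^ 2 ^ n) = norm b ^ 2 ^ n"
proof (induction n)
  case (Suc n)
  have "norm (b ^ 2 ^ Suc n) = norm (star (b ^ 2 ^ n) * b ^ 2 ^ n)"
    by (simp add: star_power assms mult_2 power_add)
  also have "\<dots> = norm b ^ 2 ^ Suc n"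
    by (simp only: cstar_identity Suc) (simp add: power_mult[symmetric] mult.commute)
  finally show ?case .
qed simp

lemma power_scaleC: "(c *\<^sub>C x) ^ n = c ^ n *\<^sub>C (x::'a::cstar_algebra) ^ n"
  by (induction n) (simp_all add: scaleC_one mult_scaleC_left mult_scaleC_right scaleC_scaleC
      mult.commute)

definition inv_elt :: "'a::monoid_mult \<Rightarrow> bool" where
  "inv_elt x \<longleftrightarrow> (\<exists>y. x * y = 1 \<and> y * x = 1)"

lemma inv_elt_leftright: "x * y = 1 \<Longrightarrow> z * x = 1 \<Longrightarrow> inv_elt (x::'a::monoid_mult)"
  unfolding inv_elt_def by (metis mult.assoc mult.left_neutral mult.right_neutral)

lemma inv_elt_mult: "inv_elt x \<Longrightarrow> inv_elt y \<Longrightarrow> inv_elt (x * y :: 'a::monoid_mult)"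
  unfolding inv_elt_def
  by (metis mult.assoc mult.left_neutral)

lemma inv_elt_scaleC:
  assumes "c \<noteq> 0" "inv_elt (x::'a::cstar_algebra)"
  shows "inv_elt (c *\<^sub>C x)"
proof -
  from assms(2) obtain y where "x * y = 1" "y * x = 1"
    by (auto simp: inv_elt_def)
  then have "(c *\<^sub>C x) * (inverse c *\<^sub>C y) = 1" "(inverse c *\<^sub>C y) * (c *\<^sub>C x) = 1"
    using assms(1) by (simp_all add: mult_scaleC_left mult_scaleC_right scaleC_scaleC scaleC_one)
  then show ?thesis
    by (rule inv_elt_leftright)
qed

text \<open>A fixed point of the contraction that sends y to x + x y is a quasi-inverse: 1 + y
  inverts 1 - x. The equations do not mention 1, so a *-homomorphism that is not known to be unital
  carries them over.\<close>

lemma neumann: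
  fixes x :: "'a::cstar_algebra"
  assumes "norm x < 1"
  obtains y where "y = x + x * y" "y = x + y * x"
proof -
  have "\<exists>!y\<in>UNIV. x + x * y = y"
  proof (rule Banach_fix[where c = "norm x"])
    show "dist (x + x * y) (x + x * z) \<le> norm x * dist y z" for y z
      using norm_mult_ineq[of x "y - z"] by (simp add: dist_norm algebra_simps)
  qed (use assms in \<open>auto simp: complete_UNIV\<close>)
  then obtain y where y: "y = x + x * y"
    by metis
  have "\<exists>!z\<in>UNIV. x + z * x = z"
  proof (rule Banach_fix[where c = "norm x"])
    show "dist (x + y * x) (x + z * x) \<le> norm x * dist y z" for y z
      using norm_mult_ineq[of "y - z" x] by (simp add: dist_norm algebra_simps)
  qed (use assms in \<open>auto simp: complete_UNIV\<close>)
  then obtain z where z: "z = x + z * x"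
    by metis
  \<comment> \<open>Expanding z y through the equation of y and through that of z identifies the
    left and the right solution.\<close>
  have "z * y = z * x + z * (x * y)"
    by (subst y) (simp add: algebra_simps)
  moreover have "z * y = x * y + z * (x * y)"
    by (subst z) (simp add: algebra_simps)
  ultimately have "z * x = x * y"
    by simp
  then have "y = z"
    using y z by metis
  then show ?thesis
    using that y z by blast
qed

lemma inv_elt_one_minus:
  assumes "norm (x::'a::cstar_algebra) < 1"
  shows "inv_elt (1 - x)"
proof -
  obtain y where "y = x + x * y" "y = x + y * x"
    using neumann[OF assms] .
  then have "(1 - x) * (1 + y) = 1" "(1 + y) * (1 - x) = 1"
    by (simp_all add: algebra_simps)
  then show ?thesis
    by (rule inv_elt_leftright)
qed

lemma sum_roots_of_unity:
  assumes "k \<noteq> 0" "\<bar>k\<bar> < int N"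
  shows "(\<Sum>j<N. cis (2 * pi * real j / real N) powi k) = 0"
proof -
  define c where "c = cis (2 * pi * real_of_int k / real N)"
  have N: "real N > 0"
    using assms by linarith
  have c: "cis (2 * pi * real j / real N) powi k = c ^ j" for j
    by (simp add: c_def Complex.DeMoivre cis_power_int mult_ac)
  have "c ^ N = cis (2 * pi * real_of_int k)"
    using N by (simp add: c_def Complex.DeMoivre)
  also have "\<dots> = 1"
    by (simp add: cis_multiple_2pi)
  finally have cN: "c ^ N = 1" .
  have "c \<noteq> 1"
  proof
    assume "c = 1"
    then have "Re c = 1"
      by simp
    then obtain n :: int where "2 * pi * real_of_int k / real N = real_of_int n * 2 * pi"
      unfolding c_def cis.sel cos_one_2pi_int by auto
    then have "real_of_int k = real_of_int n * real N"
      using N by (simp add: field_simps)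
    then have k: "k = n * int N"
      by (metis of_int_eq_iff of_int_mult of_int_of_nat_eq)
    then have "n \<noteq> 0"
      using assms by auto
    then have "1 * int N \<le> \<bar>n\<bar> * int N"
      by (intro mult_right_mono) auto
    then show False
      using k assms(2) by (simp add: abs_mult)
  qed
  moreover have "(1 - c) * (\<Sum>j<N. c ^ j) = 0"
    using cN by (simp add: one_diff_power_eq[symmetric])
  ultimately show ?thesis
    by (simp add: c)
qed

lemma one_minus_power_factor:
  fixes z :: "'a::cstar_algebra"
  shows "(1 - z) * (\<Sum>k<n. z ^ k) = 1 - z ^ n"
proof (induction n)
  case (Suc n)
  have "(1 - z) * (\<Sum>k<Suc n. z ^ k) = (1 - z) * (\<Sum>k<n. z ^ k) + (1 - z) * z ^ n"
    by (simp add: distrib_left)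
  then show ?case
    by (simp only: Suc) (simp add: left_diff_distrib)
qed simp

text \<open>Each \<open>1 - (w j * l) *\<^sub>C b\<close> divides
  \<open>1 - l ^ N *\<^sub>C b ^ N\<close>, with a geometric sum as cofactor, because
  \<open>w j ^ N = 1\<close>. Multiplication by \<open>R j\<close> leaves this cofactor, and
  summation over j removes all its terms except the constant one.\<close>

lemma average_resolvent:
  fixes b :: "'a::cstar_algebra"
  assumes N: "N > 0"
    and R: "\<And>j. j < N \<Longrightarrow> R j * (1 - (cis (2 * pi * real j / real N) * l) *\<^sub>C b) = 1"
  shows "(\<Sum>j<N. R j) * (1 - l ^ N *\<^sub>C b ^ N) = of_nat N *\<^sub>C 1"
proof -
  define w where "w j = cis (2 * pi * real j / real N)" for j
  have wN: "w j ^ N = 1" for j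
    using N cis_multiple_2pi[of "real j"] by (simp add: w_def Complex.DeMoivre)
  have sw: "(\<Sum>j<N. w j ^ k) = (if k = 0 then of_nat N else 0)" if "k < N" for k
    using sum_roots_of_unity[of "int k" N] that by (auto simp: w_def)
  have "R j * (1 - l ^ N *\<^sub>C b ^ N) = (\<Sum>k<N. (w j ^ k * l ^ k) *\<^sub>C b ^ k)" if "j < N" for j
  proof -
    have "1 - l ^ N *\<^sub>C b ^ N = (1 - (w j * l) *\<^sub>C b) * (\<Sum>k<N. (w j ^ k * l ^ k) *\<^sub>C b ^ k)"
      using one_minus_power_factor[of "(w j * l) *\<^sub>C b" N]
      by (simp add: power_scaleC wN power_mult_distrib)
    then show ?thesis
      using R[OF that] by (simp add: w_def mult.assoc[symmetric])
  qed
  then have "(\<Sum>j<N. R j) * (1 - l ^ N *\<^sub>C b ^ N) = (\<Sum>j<N. \<Sum>k<N. (w j ^ k * l ^ k) *\<^sub>C b ^ k)"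
    by (simp add: sum_distrib_right)
  also have "\<dots> = (\<Sum>k<N. \<Sum>j<N. (w j ^ k * l ^ k) *\<^sub>C b ^ k)"
    by (rule sum.swap)
  also have "\<dots> = (\<Sum>k<N. ((\<Sum>j<N. w j ^ k) * l ^ k) *\<^sub>C b ^ k)"
    by (simp add: complex_vector.scale_sum_left sum_distrib_right)
  also have "\<dots> = (\<Sum>k<N. if k = 0 then of_nat N *\<^sub>C 1 else 0)"
    by (rule sum.cong) (auto simp: sw)
  also have "\<dots> = of_nat N *\<^sub>C 1"
    using N by simp
  finally show ?thesis .
qed

text \<open>Rickart's elementary route to the spectral radius formula: averages of the resolvent over
  roots of unity are resolvents of powers, and powers \<open>b ^ 2 ^ n\<close> have norm \<open>1\<close>.\<close>

lemma unit_norm_singular: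
  fixes b :: "'a::cstar_algebra"
  assumes sa: "star b = b" and nb: "norm b = 1"
  obtains l where "cmod l \<le> 1" "\<not> inv_elt (1 - l *\<^sub>C b)"
proof (rule ccontr)
  assume "\<not> thesis"
  then have "\<forall>l. \<exists>y. cmod l \<le> 1 \<longrightarrow> (1 - l *\<^sub>C b) * y = 1 \<and> y * (1 - l *\<^sub>C b) = 1"
    using that unfolding inv_elt_def by blast
  then obtain R where R: "\<And>l. cmod l \<le> 1 \<Longrightarrow> (1 - l *\<^sub>C b) * R l = 1"
      "\<And>l. cmod l \<le> 1 \<Longrightarrow> R l * (1 - l *\<^sub>C b) = 1"
    by metis
  \<comment> \<open>The resolvent identity: R m - R l = (m - l) R m b R l.\<close>
  have res: "norm (R m - R l) \<le> cmod (m - l) * (norm (R m) * norm (R l))"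
    if "cmod m \<le> 1" "cmod l \<le> 1" for m l
  proof -
    have "R m - R l = R m * ((1 - l *\<^sub>C b) * R l) - R m * (1 - m *\<^sub>C b) * R l"
      using R that by simp
    also have "\<dots> = (m - l) *\<^sub>C (R m * b * R l)"
      by (simp add: algebra_simps mult_scaleC_left mult_scaleC_right
          complex_vector.scale_left_diff_distrib)
    finally have "norm (R m - R l) = cmod (m - l) * norm (R m * b * R l)"
      by (simp add: norm_scaleC)
    also have "norm (R m * b * R l) \<le> norm (R m) * norm b * norm (R l)"
      by (meson norm_mult_ineq order_trans mult_right_mono norm_ge_zero)
    finally show ?thesis
      using nb by (simp add: mult_left_mono)
  qed
  have "continuous_on (cball 0 1) R"
    unfolding continuous_on_iff
  proof (intro ballI allI impI)
    fix l :: complex and e :: real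
    assume l: "l \<in> cball 0 1" and e: "e > 0"
    \<comment> \<open>Near l the norm of R m is at most 2 K: the radius 1 / (2 K) makes the
      difference R m - R l at most half of \<open>norm (R m)\<close>. The radius e / (2 K^2) then
      yields e.\<close>
    define K where "K = norm (R l) + 1"
    have K: "K > 0" "norm (R l) \<le> K"
      by (auto simp: K_def add_nonneg_pos)
    show "\<exists>d>0. \<forall>m\<in>cball 0 1. dist m l < d \<longrightarrow> dist (R m) (R l) < e"
    proof (intro exI[of _ "min (1 / (2 * K)) (e / (2 * K\<^sup>2))"] conjI ballI impI)
      show "0 < min (1 / (2 * K)) (e / (2 * K\<^sup>2))"
        using K e by simp
      fix m
      assume m: "m \<in> cball 0 1" and "dist m l < min (1 / (2 * K)) (e / (2 * K\<^sup>2))"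
      then have d: "cmod (m - l) < 1 / (2 * K)" "cmod (m - l) < e / (2 * K\<^sup>2)"
        by (auto simp: dist_norm)
      have d': "cmod (m - l) * K \<le> 1 / 2" "cmod (m - l) * (2 * K\<^sup>2) < e"
        using d K by (simp_all add: field_simps)
      have r: "norm (R m - R l) \<le> cmod (m - l) * (norm (R m) * norm (R l))"
        using res m l by simp
      also have "\<dots> \<le> cmod (m - l) * (norm (R m) * K)"
        by (intro mult_left_mono K) auto
      finally have r1: "norm (R m - R l) \<le> cmod (m - l) * K * norm (R m)"
        by (simp add: mult_ac)
      also have "\<dots> \<le> 1 / 2 * norm (R m)"
        by (intro mult_right_mono d') simp
      finally have "norm (R m) \<le> 2 * K"
        using norm_triangle_ineq2[of "R m" "R l"] K by linarith
      then have "norm (R m - R l) \<le> cmod (m - l) * K * (2 * K)"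
        using r1 K by (meson order_trans mult_left_mono mult_nonneg_nonneg norm_ge_zero less_imp_le)
      then show "dist (R m) (R l) < e"
        using d' by (simp add: dist_norm power2_eq_square mult_ac)
    qed
  qed
  then have "uniformly_continuous_on (cball 0 1) R"
    by (intro compact_uniformly_continuous compact_cball)
  then obtain d where d: "d > 0"
    "\<And>x y. x \<in> cball 0 1 \<Longrightarrow> y \<in> cball 0 1 \<Longrightarrow> dist y x < d \<Longrightarrow> dist (R y) (R x) < 1 / 8"
    unfolding uniformly_continuous_on_def by (metis zero_less_divide_1_iff zero_less_numeral)
  \<comment> \<open>Averages over the circles of radius 1 and r are compared: the circles are closer
    than d, so the averages differ by at most 1/8, while r ^ N < 1/8 keeps the average at r near
    1.\<close>
  define r where "r = max (1 - d / 2) (1 / 2)"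
  have r: "0 < r" "r < 1" "1 - r < d"
    using d by (auto simp: r_def)
  obtain n where n: "r ^ n < 1 / 8"
    using real_arch_pow_inv[of "1/8" r] r by auto
  define N where "N = (2::nat) ^ n"
  have N: "N > 0" "norm (b ^ N) = 1"
    using norm_selfadjoint_power[OF sa] nb by (auto simp: N_def)
  have "r ^ N \<le> r ^ n"
    unfolding N_def using r by (intro power_decreasing) (auto simp: less_imp_le[OF less_exp])
  then have rN: "r ^ N < 1 / 8"
    using n by linarith
  define w where "w j = cis (2 * pi * real j / real N)" for j
  define A where "A l = (1 / of_nat N :: complex) *\<^sub>C (\<Sum>j<N. R (w j * l))" for l
  have A: "A l * (1 - l ^ N *\<^sub>C b ^ N) = 1" if "cmod l \<le> 1" for l
    using average_resolvent[of N "\<lambda>j. R (w j * l)" l b] R(2)[of "w _ * l"] that N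
    by (simp add: w_def A_def norm_mult mult_scaleC_left scaleC_scaleC scaleC_one)
  have "norm (A 1 - A (of_real r)) = 1 / real N * norm (\<Sum>j<N. R (w j * 1) - R (w j * of_real r))"
    by (simp add: A_def complex_vector.scale_right_diff_distrib[symmetric] norm_scaleC
        norm_divide sum_subtractf)
  also have "norm (\<Sum>j<N. R (w j * 1) - R (w j * of_real r)) \<le> (\<Sum>j<N. 1 / 8)"
  proof (rule sum_norm_le)
    fix j
    have "cmod (w j - w j * of_real r) = cmod (w j * of_real (1 - r))"
      by (simp add: algebra_simps)
    also have "\<dots> < d"
      using r by (simp only: norm_mult norm_of_real) (simp add: w_def)
    finally have "dist (R (w j * 1)) (R (w j * of_real r)) < 1 / 8"
      using r by (intro d(2)) (auto simp: norm_mult w_def dist_norm)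
    then show "norm (R (w j * 1) - R (w j * of_real r)) \<le> 1 / 8"
      by (simp add: dist_norm)
  qed
  finally have A1: "norm (A 1 - A (of_real r)) \<le> 1 / 8"
    using N by (simp add: field_simps)
  have "A (of_real r) - 1 = A (of_real r) * (r ^ N *\<^sub>R b ^ N)"
    using A[of "of_real r"] r by (simp add: algebra_simps scaleR_scaleC)
  then have "norm (A (of_real r) - 1) \<le> norm (A (of_real r)) * (r ^ N * 1)"
    using norm_mult_ineq[of "A (of_real r)" "r ^ N *\<^sub>R b ^ N"] N r by simp
  also have "\<dots> \<le> norm (A (of_real r)) * (1 / 8)"
    using rN by (intro mult_left_mono) auto
  finally have A2: "norm (A (of_real r) - 1) \<le> norm (A (of_real r)) / 8"
    by simp
  moreover have "norm (A (of_real r)) \<le> 1 + norm (A (of_real r) - 1)"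
    using norm_triangle_ineq[of 1 "A (of_real r) - 1"] norm_one_le[where 'a = 'a] by simp
  ultimately have A3: "norm (A (of_real r) - 1) \<le> 1 / 7"
    by linarith
  have A4: "norm (A 1 - 1) \<le> 1 / 8 + 1 / 7"
    using norm_triangle_ineq[of "A 1 - A (of_real r)" "A (of_real r) - 1"] A1 A3 by simp
  \<comment> \<open>As 1/8 + 1/7 < 1/2, this identity forces \<open>norm (b ^ N) < 1\<close>,
    against \<open>norm (b ^ N) = 1\<close>.\<close>
  have "b ^ N = (A 1 - 1) - (A 1 - 1) * b ^ N"
    using A[of 1] by (simp add: algebra_simps scaleC_one)
  then have "norm (b ^ N) \<le> norm (A 1 - 1) + norm ((A 1 - 1) * b ^ N)"
    using norm_triangle_ineq4[of "A 1 - 1" "(A 1 - 1) * b ^ N"] by simp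
  also have "\<dots> \<le> norm (A 1 - 1) + norm (A 1 - 1) * norm (b ^ N)"
    by (intro add_left_mono norm_mult_ineq)
  finally have "norm (b ^ N) \<le> norm (A 1 - 1) + norm (A 1 - 1) * norm (b ^ N)" .
  then show False
    using N A4 by simp
qed

section \<open>Complex-linear maps, *-homomorphisms and complex subspaces\<close>

lemma clinear_iff:
  "clinear f \<longleftrightarrow>
    (\<forall>x y. f (x + y) = f x + f y) \<and> (\<forall>c x. f (c *\<^sub>C x) = c *\<^sub>C f x)"
  by (auto simp: Vector_Spaces.linear_iff complex_vector.vector_space_axioms)

lemma clinear_imp_linear: "clinear f \<Longrightarrow> linear f"
  by (auto simp: clinear_iff linear_iff scaleR_scaleC)

lemma clinear_0: "clinear f \<Longrightarrow> f 0 = 0"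
  and clinear_diff: "clinear f \<Longrightarrow> f (x - y) = f x - f y"
  and clinear_sum: "clinear f \<Longrightarrow> f (sum g I) = (\<Sum>i\<in>I. f (g i))"
  and clinear_scaleR: "clinear f \<Longrightarrow> f (r *\<^sub>R x) = r *\<^sub>R f x"
  by (simp_all add: linear_0 linear_diff linear_sum linear_scale clinear_imp_linear)

lemma clinear_add: "clinear f \<Longrightarrow> f (x + y) = f x + f y"
  and clinear_scaleC: "clinear f \<Longrightarrow> f (c *\<^sub>C x) = c *\<^sub>C f x"
  by (auto simp: clinear_iff)

lemma star_homD:
  assumes "star_hom f"
  shows "clinear f" "f (x * y) = f x * f y" "f (star x) = star (f x)"
  using assms by (auto simp: star_hom_def)

lemma csubspaceD:
  assumes "csubspace U"
  shows "0 \<in> U" "x \<in> U \<Longrightarrow> y \<in> U \<Longrightarrow> x + y \<in> U" "x \<in> U \<Longrightarrow> c *\<^sub>C x \<in> U"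
    "x \<in> U \<Longrightarrow> y \<in> U \<Longrightarrow> x - y \<in> U" "x \<in> U \<Longrightarrow> r *\<^sub>R x \<in> U" "x \<in> U \<Longrightarrow> - x \<in> U"
  using assms by (auto simp: complex_vector.subspace_0 complex_vector.subspace_add
      complex_vector.subspace_scale complex_vector.subspace_diff complex_vector.subspace_neg
      scaleR_scaleC)

lemma csubspaceI:
  assumes "0 \<in> U" "\<And>x y. x \<in> U \<Longrightarrow> y \<in> U \<Longrightarrow> x + y \<in> U" "\<And>c x. x \<in> U \<Longrightarrow> c *\<^sub>C x \<in> U"
  shows "csubspace U"
  using assms by (auto simp: complex_vector.subspace_def)

section \<open>Polynomial functional calculus\<close>

definition peval :: "complex poly \<Rightarrow> 'a::cstar_algebra \<Rightarrow> 'a" where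
  "peval p b = fold_coeffs (\<lambda>c y. c *\<^sub>C 1 + b * y) p 0"

lemma peval_0 [simp]: "peval 0 b = 0"
  by (simp add: peval_def)

lemma peval_pCons [simp]: "peval (pCons c p) b = c *\<^sub>C 1 + b * peval p b"
  by (cases "p = 0 \<and> c = 0") (auto simp: peval_def)

lemma peval_add: "peval (p + q) b = peval p b + peval q b"
  by (induction p q rule: poly_induct2) (simp_all add: algebra_simps scaleC_add_left)

lemma peval_smult: "peval (smult c p) b = c *\<^sub>C peval p b"
  by (induction p) (simp_all add: scaleC_add_right scaleC_scaleC mult_scaleC_right)

lemma peval_diff: "peval (p - q) b = peval p b - peval q b"
proof -
  have "peval (p - q) b = peval (p + smult (-1) q) b"
    by simp
  then show ?thesis
    by (simp only: peval_add peval_smult) (simp add: scaleC_minus_one)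
qed

lemma peval_mult: "peval (p * q) b = peval p b * peval q b"
  by (induction p) (simp_all add: peval_add peval_smult mult_scaleC_left algebra_simps)

lemma peval_1 [simp]: "peval 1 b = 1"
  by (simp add: one_pCons scaleC_one)

lemma peval_power: "peval (p ^ n) b = peval p b ^ n"
  by (induction n) (simp_all add: peval_mult)

lemma peval_commute: "b * peval p b = peval p b * b"
proof (induction p)
  case (pCons c p)
  have "b * peval (pCons c p) b = c *\<^sub>C b + b * (b * peval p b)"
    by (simp add: distrib_left mult_scaleC_right)
  also have "\<dots> = c *\<^sub>C b + b * (peval p b * b)"
    by (simp only: pCons)
  also have "\<dots> = peval (pCons c p) b * b"
    by (simp add: distrib_right mult_scaleC_left mult.assoc)
  finally show ?case .
qed simp

definition real_coeffs :: "complex poly \<Rightarrow> bool" where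
  "real_coeffs p \<longleftrightarrow> (\<forall>i. coeff p i \<in> \<real>)"

lemma real_coeffs_pCons [simp]: "real_coeffs (pCons c p) \<longleftrightarrow> c \<in> \<real> \<and> real_coeffs p"
  by (auto simp: real_coeffs_def coeff_pCons split: nat.splits)

lemma real_coeffs_0 [simp]: "real_coeffs 0"
  by (simp add: real_coeffs_def)

lemma real_coeffs_diff: "real_coeffs p \<Longrightarrow> real_coeffs q \<Longrightarrow> real_coeffs (p - q)"
  by (simp add: real_coeffs_def)

lemma real_coeffs_mult: "real_coeffs p \<Longrightarrow> real_coeffs q \<Longrightarrow> real_coeffs (p * q)"
  by (auto simp: real_coeffs_def coeff_mult intro!: sum_in_Reals)

lemma real_coeffs_power: "real_coeffs p \<Longrightarrow> real_coeffs (p ^ n)"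
  by (induction n) (auto intro: real_coeffs_mult simp: one_pCons)

lemma star_peval:
  assumes "real_coeffs p" "star b = b"
  shows "star (peval p b) = peval p b"
  using assms(1)
proof (induction p)
  case (pCons c p)
  then show ?case
    by (simp add: star_add star_scaleC star_mult assms(2) peval_commute Reals_cnj_iff)
qed simp

text \<open>The factor b removes the constant term, since D need not contain 1.\<close>

lemma peval_closed:
  assumes D: "csubspace D" "\<And>x y. x \<in> D \<Longrightarrow> y \<in> D \<Longrightarrow> x * y \<in> D" and b: "b \<in> D"
  shows "b * peval p b \<in> D"
proof (induction p)
  case 0
  then show ?case
    using csubspaceD(1)[OF D(1)] by simp
next
  case (pCons c p)
  have "b * peval (pCons c p) b = c *\<^sub>C b + b * (b * peval p b)"
    by (simp add: distrib_left mult_scaleC_right)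
  then show ?case
    using pCons b D csubspaceD[OF D(1)] by simp
qed

text \<open>As h need not preserve 1, only polynomials without constant term pass through
  it.\<close>

lemma star_hom_peval:
  assumes h: "star_hom h"
  shows "h (b * peval p b) = h b * peval p (h b)"
proof (induction p)
  case 0
  then show ?case
    using clinear_0[OF star_homD(1)[OF h]] by simp
next
  case (pCons c p)
  have "h (b * peval (pCons c p) b) = h (c *\<^sub>C b + b * (b * peval p b))"
    by (simp add: distrib_left mult_scaleC_right)
  also have "\<dots> = c *\<^sub>C h b + h b * h (b * peval p b)"
    using star_homD[OF h] by (simp only: clinear_add clinear_scaleC)
  finally show ?case
    by (simp add: pCons distrib_left mult_scaleC_right)
qed

text \<open>If \<open>norm (h x)\<close> exceeded \<open>norm x\<close> for a self-adjoint x,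
  \<open>unit_norm_singular\<close> would give c with 1 - c h(x) singular and c x of norm below 1;
  but h maps the quasi-inverse of c x to one of c h(x). The C*-identity reduces the general case to
  this one.\<close>

lemma star_hom_contractive:
  assumes h: "star_hom h"
  shows "norm (h x) \<le> norm x"
proof -
  note lin = star_homD(1)[OF h]
  have sa: "norm (h x) \<le> norm x" if x: "star x = x" for x
  proof (rule ccontr)
    assume "\<not> norm (h x) \<le> norm x"
    then have lt: "norm x < norm (h x)"
      by simp
    define s where "s = norm (h x)"
    have s: "s > 0"
      using lt norm_ge_zero[of x] unfolding s_def by linarith
    have "star ((1 / s) *\<^sub>R h x) = (1 / s) *\<^sub>R h x"
      by (metis star_scaleR star_homD(3)[OF h] x)
    moreover have "norm ((1 / s) *\<^sub>R h x) = 1"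
      using s by (simp add: s_def)
    ultimately obtain l where l: "cmod l \<le> 1" "\<not> inv_elt (1 - l *\<^sub>C ((1 / s) *\<^sub>R h x))"
      by (rule unit_norm_singular)
    define c where "c = l * of_real (1 / s)"
    have "norm (c *\<^sub>C x) = cmod l * (norm x / s)"
      using s by (simp add: c_def norm_scaleC norm_mult norm_divide)
    also have "\<dots> \<le> 1 * (norm x / s)"
      using l s by (intro mult_right_mono) auto
    also have "\<dots> < 1"
      using lt s by (simp add: s_def)
    finally obtain y where y: "y = c *\<^sub>C x + c *\<^sub>C x * y" "y = c *\<^sub>C x + y * c *\<^sub>C x"
      using neumann by blast
    have "h y = c *\<^sub>C h x + c *\<^sub>C h x * h y"
      using arg_cong[OF y(1), of h] by (simp add: clinear_add[OF lin] clinear_scaleC[OF lin] star_homD(2)[OF h])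
    moreover have "h y = c *\<^sub>C h x + h y * c *\<^sub>C h x"
      using arg_cong[OF y(2), of h] by (simp add: clinear_add[OF lin] clinear_scaleC[OF lin] star_homD(2)[OF h])
    ultimately have "(1 - c *\<^sub>C h x) * (1 + h y) = 1" "(1 + h y) * (1 - c *\<^sub>C h x) = 1"
      by (simp_all add: algebra_simps)
    then have "inv_elt (1 - c *\<^sub>C h x)"
      by (rule inv_elt_leftright)
    then show False
      using l by (simp add: c_def scaleR_scaleC scaleC_scaleC)
  qed
  have "(norm (h x))\<^sup>2 = norm (h (star x * x))"
    by (simp add: star_homD[OF h] cstar_identity)
  also have "\<dots> \<le> norm (star x * x)"
    by (rule sa) (simp add: star_mult star_star)
  also have "\<dots> = (norm x)\<^sup>2"
    by (rule cstar_identity)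
  finally show ?thesis
    by (rule power2_le_imp_le) simp
qed

lemma star_hom_bounded_linear: "star_hom h \<Longrightarrow> bounded_linear h"
  using star_hom_contractive[of h] star_homD(1)[of h]
  by (intro bounded_linear_intro[where K = 1]) (auto simp: clinear_add clinear_scaleR)

lemma norm_singular_ge:
  fixes x :: "'a::cstar_algebra"
  assumes "\<not> inv_elt (x - w *\<^sub>C 1)"
  shows "cmod w \<le> norm x"
proof (rule ccontr)
  assume "\<not> cmod w \<le> norm x"
  then have w: "norm x < cmod w" "w \<noteq> 0"
    by auto
  have "norm ((1 / w) *\<^sub>C x) < 1"
    using w by (simp add: norm_scaleC norm_divide)
  then have "inv_elt (- w *\<^sub>C (1 - (1 / w) *\<^sub>C x))"
    by (rule inv_elt_scaleC[OF _ inv_elt_one_minus, rotated]) (use w in simp)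
  moreover have "- w *\<^sub>C (1 - (1 / w) *\<^sub>C x) = x - w *\<^sub>C 1"
    using w by (simp add: complex_vector.scale_right_diff_distrib scaleC_scaleC scaleC_one)
  ultimately show False
    using assms by simp
qed

text \<open>Arens' trick: b + i t has a spectral point with imaginary part Im z + t, while the
  square of its norm is at most that of b plus t^2. The terms t^2 cancel and leave one bound on 2 t
  Im z for all real t.\<close>

lemma selfadjoint_singular_real:
  fixes b :: "'a::cstar_algebra"
  assumes b: "star b = b" and z: "\<not> inv_elt (b - z *\<^sub>C 1)"
  shows "Im z = 0"
proof -
  have bound: "(Im z + t)\<^sup>2 \<le> (norm b)\<^sup>2 + t\<^sup>2" for t :: real
  proof -
    define c where "c = \<i> * complex_of_real t"
    define x where "x = b + c *\<^sub>C 1"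
    have "x - (z + c) *\<^sub>C 1 = b - z *\<^sub>C 1"
      by (simp add: x_def scaleC_add_left)
    then have "cmod (z + c) \<le> norm x"
      using norm_singular_ge[of x "z + c"] z by simp
    moreover have "\<bar>Im z + t\<bar> \<le> cmod (z + c)"
      using abs_Im_le_cmod[of "z + c"] by (simp add: c_def)
    ultimately have "\<bar>Im z + t\<bar> \<le> \<bar>norm x\<bar>"
      by simp
    then have "(Im z + t)\<^sup>2 \<le> (norm x)\<^sup>2"
      by (simp only: abs_le_square_iff)
    also have "(norm x)\<^sup>2 = norm (star x * x)"
      by (simp add: cstar_identity)
    also have "star x * x = b * b + (t\<^sup>2) *\<^sub>R 1"
    proof -
      have "cnj c = - c"
        by (simp add: c_def)
      then have "star x = b - c *\<^sub>C 1"
        by (simp add: x_def star_add star_scaleC b)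
      then have "star x * x = (b - c *\<^sub>C 1) * (b + c *\<^sub>C 1)"
        by (simp add: x_def)
      also have "\<dots> = b * b - (c * c) *\<^sub>C 1"
        by (simp add: algebra_simps mult_scaleC_left mult_scaleC_right scaleC_scaleC)
      also have "c * c = - complex_of_real (t\<^sup>2)"
        by (simp add: c_def power_mult_distrib flip: power2_eq_square)
      finally show ?thesis
        by (simp add: scaleR_scaleC)
    qed
    also have "norm (b * b + (t\<^sup>2) *\<^sub>R 1) \<le> norm b * norm b + t\<^sup>2 * 1"
      using norm_mult_ineq[of b b] norm_one_le[where 'a = 'a]
      by (intro norm_triangle_le add_mono) (auto intro: mult_left_le)
    finally show ?thesis
      by (simp add: power2_eq_square)
  qed
  have t0: "2 * t * Im z \<le> (norm b)\<^sup>2" for t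
  proof -
    have "(Im z)\<^sup>2 + 2 * t * Im z \<le> (norm b)\<^sup>2"
      using bound[of t] by (simp add: power2_sum mult_ac)
    then show ?thesis
      using zero_le_power2[of "Im z"] by linarith
  qed
  show ?thesis
  proof (rule ccontr)
    assume "Im z \<noteq> 0"
    then show False
      using t0[of "((norm b)\<^sup>2 + 1) / (2 * Im z)"] by simp
  qed
qed

text \<open>Half of the spectral mapping theorem: a root z of p splits off the factor b - z, and
  products of invertible elements are invertible, so some factor must be singular.\<close>

lemma peval_singular_root:
  fixes b :: "'a::cstar_algebra"
  assumes "\<not> inv_elt (peval p b)" "p \<noteq> 0"
  shows "\<exists>z. poly p z = 0 \<and> \<not> inv_elt (b - z *\<^sub>C 1)"
  using assms
proof (induction "degree p" arbitrary: p)
  case 0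
  then obtain c where c: "p = [:c:]" "c \<noteq> 0"
    by (metis pCons_0_0 degree_eq_zeroE)
  have "inv_elt (1::'a)"
    by (auto simp: inv_elt_def)
  then show ?case
    using inv_elt_scaleC[of c "1::'a"] c 0 by simp
next
  case (Suc n)
  have "\<not> constant (poly p)"
    using Suc(2) by (simp add: constant_degree)
  then obtain z where z: "poly p z = 0"
    using fundamental_theorem_of_algebra by blast
  then obtain q where q: "p = [:- z, 1:] * q"
    by (meson poly_eq_0_iff_dvd dvdE)
  have q0: "q \<noteq> 0"
    using Suc(4) q by auto
  have dq: "n = degree q"
    using Suc(2) q q0 degree_mult_eq[of "[:- z, 1:]" q] by simp
  have "peval p b = (b - z *\<^sub>C 1) * peval q b"
    unfolding q peval_mult by (simp add: scaleC_one)
  then have "\<not> inv_elt (b - z *\<^sub>C 1) \<or> \<not> inv_elt (peval q b)"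
    using Suc(3) inv_elt_mult[of "b - z *\<^sub>C 1" "peval q b"] by auto
  then show ?case
  proof
    assume "\<not> inv_elt (b - z *\<^sub>C 1)"
    then show ?case
      using z by blast
  next
    assume "\<not> inv_elt (peval q b)"
    then obtain w where "poly q w = 0" "\<not> inv_elt (b - w *\<^sub>C 1)"
      using Suc(1)[OF dq _ q0] by blast
    then show ?case
      using q by (intro exI[of _ w]) simp
  qed
qed

text \<open>If the norm m of p(b) exceeded s, some 1 - c p(b) with |c| at most 1/m would be
  singular, so 1 - c p would vanish at a spectral point of b. That point is real and lies in
  [-R, R], where |c p| < 1. An R larger than \<open>norm b\<close> is allowed, so that one
  polynomial can be used for several elements.\<close>

lemma norm_peval_le:
  fixes b :: "'a::cstar_algebra"
  assumes b: "star b = b" "norm b \<le> R" and p: "real_coeffs p"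
    and bound: "\<And>t. \<bar>t\<bar> \<le> R \<Longrightarrow> cmod (poly p (of_real t)) \<le> s"
  shows "norm (peval p b) \<le> s"
proof (rule ccontr)
  assume "\<not> norm (peval p b) \<le> s"
  then have n: "norm (peval p b) > s"
    by simp
  have "R \<ge> 0"
    using b(2) norm_ge_zero[of b] by linarith
  then have s: "s \<ge> 0"
    using bound[of 0] norm_ge_zero[of "poly p (of_real 0)"] by linarith
  define m where "m = norm (peval p b)"
  have m: "m > s" "m > 0"
    using n s by (auto simp: m_def)
  have "star ((1 / m) *\<^sub>R peval p b) = (1 / m) *\<^sub>R peval p b"
    by (simp add: star_scaleR star_peval p b)
  moreover have "norm ((1 / m) *\<^sub>R peval p b) = 1"
    using m by (simp add: m_def)
  ultimately obtain l where l: "cmod l \<le> 1" "\<not> inv_elt (1 - l *\<^sub>C ((1 / m) *\<^sub>R peval p b))"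
    by (rule unit_norm_singular)
  define c where "c = l * of_real (1 / m)"
  have c: "cmod c \<le> 1 / m"
    using l m by (simp add: c_def norm_mult norm_divide divide_right_mono)
  define g where "g = 1 - smult c p"
  have pg: "peval g b = 1 - l *\<^sub>C ((1 / m) *\<^sub>R peval p b)"
    by (simp add: g_def peval_diff peval_smult c_def scaleR_scaleC scaleC_scaleC)
  have pt: "cmod (c * poly p (of_real t)) < 1" if "\<bar>t\<bar> \<le> R" for t
  proof -
    have "cmod (c * poly p (of_real t)) \<le> 1 / m * s"
      unfolding norm_mult using c bound[OF that] m by (intro mult_mono) auto
    also have "\<dots> < 1"
      using m by simp
    finally show ?thesis .
  qed
  have "g \<noteq> 0"
  proof
    assume "g = 0"
    then have "poly g 0 = 0"
      by simp
    then have "c * poly p (of_real 0) = 1"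
      by (simp add: g_def)
    then show False
      using pt[of 0] \<open>R \<ge> 0\<close> by simp
  qed
  then obtain z where z: "poly g z = 0" "\<not> inv_elt (b - z *\<^sub>C 1)"
    using peval_singular_root[of g b] l(2) pg by metis
  have im: "Im z = 0"
    using selfadjoint_singular_real[OF b(1) z(2)] .
  have "\<bar>Re z\<bar> \<le> R"
    using norm_singular_ge[OF z(2)] abs_Re_le_cmod[of z] b(2) by linarith
  then have "cmod (c * poly p (of_real (Re z))) < 1"
    by (rule pt)
  also have "complex_of_real (Re z) = z"
    using im by (simp add: complex_eq_iff)
  finally show False
    using z(1) by (simp add: g_def)
qed

section \<open>Cutting off self-adjoint elements at a norm level\<close>

definition clip :: "real \<Rightarrow> real \<Rightarrow> real" where
  "clip r t = max (- r) (min r t)"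

text \<open>A Weierstrass approximation of \<open>clip r\<close> misses the value 0 at 0 by less
  than e/2, so dropping its constant term costs at most another e/2 and permits the division by
  t.\<close>

lemma clip_polynomial:
  assumes "0 \<le> r" "0 < e"
  obtains p where "real_coeffs p"
    "\<And>t. \<bar>t\<bar> \<le> R \<Longrightarrow> cmod (of_real t * poly p (of_real t) - of_real (clip r t)) < e"
proof -
  have "continuous_on {-R..R} (clip r)"
    unfolding clip_def by (intro continuous_intros)
  then obtain g where g: "real_polynomial_function g"
    "\<And>x. x \<in> {-R..R} \<Longrightarrow> \<bar>clip r x - g x\<bar> < e / 2"
    using Stone_Weierstrass_real_polynomial_function[of "{-R..R}" "clip r" "e/2"] assms
    by auto
  then obtain a n where an: "g = (\<lambda>x. \<Sum>i\<le>n. a i * x ^ i)"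
    using real_polynomial_function_iff_sum by auto
  define p where "p = (\<Sum>i<n. monom (complex_of_real (a (Suc i))) i)"
  have rc: "real_coeffs p"
    by (auto simp: p_def real_coeffs_def coeff_sum intro!: sum_in_Reals)
  have pt: "of_real t * poly p (of_real t) = complex_of_real (g t - a 0)" for t
  proof -
    have "g t = a 0 + (\<Sum>i<n. a (Suc i) * t ^ Suc i)"
      unfolding an lessThan_Suc_atMost[symmetric] sum.lessThan_Suc_shift by simp
    then show ?thesis
      by (simp add: p_def poly_sum poly_monom sum_distrib_left mult_ac)
  qed
  show ?thesis
  proof (rule that[OF rc])
    fix t :: real
    assume t: "\<bar>t\<bar> \<le> R"
    have "g 0 = a 0"
      unfolding an by (simp add: sum.atMost_shift)
    moreover have "clip r 0 = 0"
      using assms by (simp add: clip_def)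
    ultimately have "\<bar>a 0\<bar> < e / 2"
      using g(2)[of 0] t by simp
    moreover have "\<bar>clip r t - g t\<bar> < e / 2"
      using g(2)[of t] t by (simp only: abs_le_iff atLeastAtMost_iff) simp
    ultimately have "\<bar>g t - a 0 - clip r t\<bar> < e"
      by linarith
    then show "cmod (of_real t * poly p (of_real t) - of_real (clip r t)) < e"
      unfolding pt by (metis of_real_diff norm_of_real real_norm_def)
  qed
qed

lemma clip_sequence:
  assumes "0 \<le> r"
  obtains P where "\<And>n. real_coeffs (P n)"
    "\<And>n t. \<bar>t\<bar> \<le> R \<Longrightarrow>
      cmod (of_real t * poly (P n) (of_real t) - of_real (clip r t)) < 1 / real (Suc n)"
proof -
  have "\<exists>p. real_coeffs p \<and> (\<forall>t. \<bar>t\<bar> \<le> R \<longrightarrow>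
      cmod (of_real t * poly p (of_real t) - of_real (clip r t)) < 1 / real (Suc n))" for n
    using clip_polynomial[OF assms, of "1 / real (Suc n)" R]
    by (metis of_nat_0_less_iff zero_less_Suc zero_less_divide_1_iff)
  then show ?thesis
    using that by metis
qed

text \<open>The limit y is \<open>clip r\<close> applied to x. The polynomials are given beforehand,
  so that the same sequence can be applied to an element and to its image under a
  homomorphism.\<close>

lemma clip_limit:
  fixes x :: "'a::cstar_algebra"
  assumes x: "star x = x" "norm x \<le> R" and r: "0 \<le> r"
    and P: "\<And>n. real_coeffs (P n)"
      "\<And>n t. \<bar>t\<bar> \<le> R \<Longrightarrow>
        cmod (of_real t * poly (P n) (of_real t) - of_real (clip r t)) < 1 / real (Suc n)"
  obtains y where "(\<lambda>n. x * peval (P n) x) \<longlonglongrightarrow> y" "star y = y" "norm y \<le> r"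
    "norm x \<le> r \<Longrightarrow> y = x"
proof -
  define f where "f n = x * peval (P n) x" for n
  define Q where "Q n = pCons 0 (P n)" for n
  have f: "f n = peval (Q n) x" for n
    by (simp add: f_def Q_def)
  have rc: "real_coeffs (Q n)" for n
    using P by (simp add: Q_def)
  have pp: "cmod (poly (Q n) (of_real t) - of_real (clip r t)) < 1 / real (Suc n)"
    if "\<bar>t\<bar> \<le> R" for n t
    using P(2)[OF that] by (simp add: Q_def)
  have "norm (f m - f n) \<le> 1 / real (Suc m) + 1 / real (Suc n)" for m n
    unfolding f peval_diff[symmetric]
  proof (rule norm_peval_le[OF x])
    fix t assume t: "\<bar>t\<bar> \<le> R"
    have "cmod (u - v) \<le> cmod (u - w) + cmod (v - w)" for u v w
      using norm_triangle_ineq4[of "u - w" "v - w"] by simp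
    from this[of "poly (Q m) (of_real t)" "poly (Q n) (of_real t)" "of_real (clip r t)"]
    show "cmod (poly (Q m - Q n) (of_real t)) \<le> 1 / real (Suc m) + 1 / real (Suc n)"
      unfolding poly_diff using pp[OF t, of m] pp[OF t, of n] by linarith
  qed (intro real_coeffs_diff rc)
  then have d: "dist (f m) (f n) \<le> 1 / real (Suc m) + 1 / real (Suc n)" for m n
    by (simp add: dist_norm)
  have "Cauchy f"
  proof (rule metric_CauchyI)
    fix e :: real
    assume "e > 0"
    then obtain N where N: "1 / real (Suc N) < e / 2"
      using nat_approx_posE[of "e/2"] by auto
    show "\<exists>M. \<forall>m\<ge>M. \<forall>n\<ge>M. dist (f m) (f n) < e"
    proof (intro exI allI impI)
      fix m n
      assume "N \<le> m" "N \<le> n"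
      then have "1 / real (Suc m) \<le> 1 / real (Suc N)" "1 / real (Suc n) \<le> 1 / real (Suc N)"
        by (auto intro!: divide_left_mono)
      then show "dist (f m) (f n) < e"
        using d[of m n] N by linarith
    qed
  qed
  then obtain y where y: "f \<longlonglongrightarrow> y"
    by (auto simp: Cauchy_convergent_iff convergent_def)
  have lim: "(\<lambda>n. s + 1 / real (Suc n)) \<longlonglongrightarrow> s" for s :: real
    using tendsto_add[OF tendsto_const LIMSEQ_inverse_real_of_nat, of s]
    by (simp add: inverse_eq_divide)
  have "norm (f n) \<le> r + 1 / real (Suc n)" for n
    unfolding f
  proof (rule norm_peval_le[OF x rc])
    fix t assume t: "\<bar>t\<bar> \<le> R"
    have "cmod (of_real (clip r t)) \<le> r"
      using r by (auto simp: clip_def)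
    then show "cmod (poly (Q n) (of_real t)) \<le> r + 1 / real (Suc n)"
      using pp[OF t, of n] norm_triangle_sub[of "poly (Q n) (of_real t)" "of_real (clip r t)"]
      by linarith
  qed
  then have ny: "norm y \<le> r"
    by (intro LIMSEQ_le[OF tendsto_norm[OF y] lim]) auto
  have yx: "y = x" if xr: "norm x \<le> r"
  proof -
    have "norm (f n - x) \<le> 0 + 1 / real (Suc n)" for n
    proof -
      have "x = peval [:0, 1:] x"
        by (simp add: scaleC_one)
      then have "f n - x = peval (Q n - [:0, 1:]) x"
        unfolding f peval_diff by metis
      moreover have "norm (peval (Q n - [:0, 1:]) x) \<le> 1 / real (Suc n)"
      proof (rule norm_peval_le[OF x(1) order_refl])
        fix t assume t: "\<bar>t\<bar> \<le> norm x"
        then have "clip r t = t"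
          using xr by (auto simp: clip_def)
        then show "cmod (poly (Q n - [:0, 1:]) (of_real t)) \<le> 1 / real (Suc n)"
          using pp[of t n] t x(2) by simp
      qed (intro real_coeffs_diff rc, simp)
      ultimately show ?thesis
        by simp
    qed
    then have "norm (y - x) \<le> 0"
      by (intro LIMSEQ_le[OF tendsto_norm[OF tendsto_diff[OF y tendsto_const]] lim]) auto
    then show ?thesis
      by simp
  qed
  have "star (f n) = f n" for n
    unfolding f by (intro star_peval rc x)
  then have "star y = y"
    using LIMSEQ_unique[OF tendsto_star[OF y]] y by simp
  then show ?thesis
    using that y ny yx unfolding f_def by blast
qed

text \<open>The lift is the cut-off of x at level \<open>norm (h x)\<close>. Applied to h x, the
  same polynomials converge to h x itself, so the cut-off is invisible to h.\<close>

lemma star_hom_lift: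
  fixes h :: "'a::cstar_algebra \<Rightarrow> 'b::cstar_algebra"
  assumes h: "star_hom h" and D: "closed D" "csubspace D" "\<And>x y. x \<in> D \<Longrightarrow> y \<in> D \<Longrightarrow> x * y \<in> D"
    and x: "x \<in> D" "star x = x"
  obtains y where "y \<in> D" "star y = y" "h y = h x" "norm y \<le> norm (h x)"
proof -
  obtain P where P: "\<And>n. real_coeffs (P n)"
    "\<And>n t. \<bar>t\<bar> \<le> norm x \<Longrightarrow>
      cmod (of_real t * poly (P n) (of_real t) - of_real (clip (norm (h x)) t)) < 1 / real (Suc n)"
    using clip_sequence[of "norm (h x)" "norm x"] by (metis norm_ge_zero)
  obtain y where y: "(\<lambda>n. x * peval (P n) x) \<longlonglongrightarrow> y" "star y = y" "norm y \<le> norm (h x)"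
    using clip_limit[OF x(2) order_refl norm_ge_zero P] by blast
  have "star (h x) = h x"
    using star_homD(3)[OF h] x(2) by metis
  then have lim: "(\<lambda>n. h x * peval (P n) (h x)) \<longlonglongrightarrow> h x"
    by (rule clip_limit[OF _ star_hom_contractive[OF h] norm_ge_zero P]) auto
  have "(\<lambda>n. h (x * peval (P n) x)) \<longlonglongrightarrow> h y"
    by (rule bounded_linear.tendsto[OF star_hom_bounded_linear[OF h] y(1)])
  then have "h y = h x"
    using lim unfolding star_hom_peval[OF h] by (rule LIMSEQ_unique)
  moreover have "y \<in> D"
    using closed_sequentially[OF D(1) _ y(1)] peval_closed[OF D(2,3) x(1)] by blast
  ultimately show ?thesis
    using that y by blast
qed

text \<open>By injectivity the norm-controlled lift of h(x* x) is x* x itself, which gives the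
  inequality opposite to contractivity.\<close>

lemma star_hom_isometric:
  assumes h: "star_hom h" and D: "closed_star_subalgebra D"
    and inj: "\<And>x. x \<in> D \<Longrightarrow> h x = 0 \<Longrightarrow> x = 0" and x: "x \<in> D"
  shows "norm (h x) = norm x"
proof -
  have D': "closed D" "csubspace D" "\<And>x y. x \<in> D \<Longrightarrow> y \<in> D \<Longrightarrow> x * y \<in> D" "\<And>x. x \<in> D \<Longrightarrow> star x \<in> D"
    using D by (auto simp: closed_star_subalgebra_def)
  have xx: "star x * x \<in> D" "star (star x * x) = star x * x"
    using x D' by (auto simp: star_mult star_star)
  obtain y where y: "y \<in> D" "h y = h (star x * x)" "norm y \<le> norm (h (star x * x))"
    using star_hom_lift[OF h D'(1-3) xx] by blast
  have "h (y - star x * x) = 0"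
    using y(2) clinear_diff[OF star_homD(1)[OF h]] by simp
  moreover have "y - star x * x \<in> D"
    using y(1) xx csubspaceD(4)[OF D'(2)] by simp
  ultimately have "y - star x * x = 0"
    by (rule inj[rotated])
  then have "norm (star x * x) \<le> norm (h (star x * x))"
    using y by simp
  then have "(norm x)\<^sup>2 \<le> (norm (h x))\<^sup>2"
    by (simp add: star_homD[OF h] cstar_identity)
  then have "norm x \<le> norm (h x)"
    by (rule power2_le_imp_le) simp
  then show ?thesis
    using star_hom_contractive[OF h, of x] by simp
qed

text \<open>Exponential growth beats the factor in front. There are two uses: a constant factor (c =
  0) for finite-rank operators, and a factor linear in \<open>2 ^ n\<close> for graded
  polynomials.\<close>

lemma le_of_power_growth:
  fixes x r c d :: real
  assumes nn: "0 \<le> x" "0 < r"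
    and le: "\<And>n. x ^ 2 ^ n \<le> (c * 2 ^ n + d) * r ^ 2 ^ n"
  shows "x \<le> r"
proof (rule ccontr)
  assume "\<not> x \<le> r"
  \<comment> \<open>Thanks to the square root, Bernoulli's linear bound becomes quadratic in m = 2 ^
    n after squaring and so outgrows c m + d.\<close>
  define s where "s = sqrt (x / r)"
  have s: "s > 1" "s\<^sup>2 = x / r"
    using nn \<open>\<not> x \<le> r\<close> by (auto simp: s_def)
  define e where "e = (s - 1)\<^sup>2"
  have e: "e > 0"
    using s by (simp add: e_def)
  have key: "2 ^ n * e \<le> c + \<bar>d\<bar>" for n
  proof -
    define m where "m = (2::nat) ^ n"
    have m: "real m = 2 ^ n" "real m \<ge> 1"
      by (simp_all add: m_def)
    have "real m * (s - 1) \<le> s ^ m"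
      using Bernoulli_inequality[of "s - 1" m] s by simp
    then have "(real m * (s - 1))\<^sup>2 \<le> (s ^ m)\<^sup>2"
      using s m by (intro power_mono) auto
    also have "(s ^ m)\<^sup>2 = (x / r) ^ m"
      using s(2) by (metis power_commuting_commutes power_mult mult.commute)
    also have "\<dots> \<le> c * real m + d"
      using le[of n] nn by (simp add: power_divide m(1) m_def divide_le_eq)
    also have "\<dots> \<le> c * real m + \<bar>d\<bar> * real m"
      using m(2) by (intro add_left_mono) (meson abs_ge_self abs_ge_zero mult_left_mono
          mult.right_neutral order_trans mult_le_cancel_left1 linorder_not_less)
    finally have "real m * (real m * e) \<le> real m * (c + \<bar>d\<bar>)"
      by (simp add: e_def power_mult_distrib power2_eq_square algebra_simps)
    then show ?thesis
      using m by simp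
  qed
  obtain n where "(c + \<bar>d\<bar>) / e < 2 ^ n"
    using real_arch_pow[of 2 "(c + \<bar>d\<bar>) / e"] by auto
  then have "c + \<bar>d\<bar> < 2 ^ n * e"
    using e by (simp add: divide_less_eq)
  then show False
    using key[of n] by linarith
qed

section \<open>Closed spans and closed graphs\<close>

definition closed_csubspace :: "'a::complex_banach set \<Rightarrow> bool" where
  "closed_csubspace U \<longleftrightarrow> closed U \<and> csubspace U"

lemma csubspace_closure:
  assumes U: "csubspace (U :: 'a::complex_banach set)"
  shows "csubspace (closure U)"
proof (rule csubspaceI)
  show "0 \<in> closure U"
    using csubspaceD(1)[OF U] closure_subset by blast
next
  fix x y
  assume "x \<in> closure U" "y \<in> closure U"
  then obtain s t where "\<And>n. s n \<in> U" "s \<longlonglongrightarrow> x" "\<And>n. t n \<in> U" "t \<longlonglongrightarrow> y"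
    unfolding closure_sequential by blast
  then have "\<And>n. s n + t n \<in> U" "(\<lambda>n. s n + t n) \<longlonglongrightarrow> x + y"
    by (auto intro: csubspaceD(2)[OF U] tendsto_add)
  then show "x + y \<in> closure U"
    unfolding closure_sequential by (intro exI[of _ "\<lambda>n. s n + t n"]) auto
next
  fix c x
  assume "x \<in> closure U"
  then obtain s where "\<And>n. s n \<in> U" "s \<longlonglongrightarrow> x"
    unfolding closure_sequential by blast
  then have "\<And>n. c *\<^sub>C s n \<in> U" "(\<lambda>n. c *\<^sub>C s n) \<longlonglongrightarrow> c *\<^sub>C x"
    by (auto intro: csubspaceD(3)[OF U] tendsto_scaleC)
  then show "c *\<^sub>C x \<in> closure U"
    unfolding closure_sequential by (intro exI[of _ "\<lambda>n. c *\<^sub>C s n"]) auto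
qed

lemma closed_csubspace_closure_cspan: "closed_csubspace (closure (cspan S))"
  by (simp add: closed_csubspace_def csubspace_closure complex_vector.subspace_span)

lemma closure_cspan_base: "x \<in> S \<Longrightarrow> x \<in> closure (cspan S)"
  using closure_subset[of "cspan S"] complex_vector.span_base by blast

lemma closure_cspan_minimal:
  assumes "closed_csubspace U" "S \<subseteq> U"
  shows "closure (cspan S) \<subseteq> U"
  using assms unfolding closed_csubspace_def
  by (intro closure_minimal complex_vector.span_minimal) auto

lemma closed_csubspace_vimage:
  assumes "closed_csubspace U" "clinear f" "bounded_linear f"
  shows "closed_csubspace {x. f x \<in> U}"
proof -
  have U: "closed U" "csubspace U"
    using assms by (auto simp: closed_csubspace_def)
  have "closed (f -` U)"
    using U(1) bounded_linear.continuous_on[OF assms(3) continuous_on_id] by (rule closed_vimage)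
  moreover have "csubspace {x. f x \<in> U}"
    using csubspaceD[OF U(2)] assms(2)
    by (intro csubspaceI) (auto simp: clinear_0 clinear_add clinear_scaleC)
  ultimately show ?thesis
    by (simp add: closed_csubspace_def vimage_def)
qed

lemma closure_cspan_map:
  assumes "x \<in> closure (cspan S)" "closed_csubspace U" "clinear f" "bounded_linear f"
    and "\<And>s. s \<in> S \<Longrightarrow> f s \<in> U"
  shows "f x \<in> U"
  using closure_cspan_minimal[OF closed_csubspace_vimage[OF assms(2-4)], of S] assms(1,5) by auto

lemma closed_csubspace_star:
  assumes "closed_csubspace (U :: 'a::cstar_algebra set)"
  shows "closed_csubspace {x. star x \<in> U}"
proof -
  have U: "closed U" "csubspace U"
    using assms by (auto simp: closed_csubspace_def)
  have "closed (star -` U)"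
    using U(1) continuous_on_star[OF continuous_on_id] by (rule closed_vimage)
  moreover have "csubspace {x. star x \<in> U}"
    using csubspaceD[OF U(2)] by (intro csubspaceI) (auto simp: star_add star_scaleC)
  ultimately show ?thesis
    by (simp add: closed_csubspace_def vimage_def)
qed

lemma closure_cspan_star:
  fixes U :: "'a::cstar_algebra set"
  assumes "x \<in> closure (cspan S)" "closed_csubspace U" "\<And>s. s \<in> S \<Longrightarrow> star s \<in> U"
  shows "star x \<in> U"
  using closure_cspan_minimal[OF closed_csubspace_star[OF assms(2)], of S] assms(1,3) by auto

lemma clinear_mult:
  fixes a b :: "'a::cstar_algebra"
  shows "clinear (\<lambda>x. a * x)" "clinear (\<lambda>x. x * a)" "clinear (\<lambda>x. a * x * b)"
    "bounded_linear (\<lambda>x. a * x)" "bounded_linear (\<lambda>x. x * a)" "bounded_linear (\<lambda>x. a * x * b)"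
  by (auto simp: clinear_iff distrib_left distrib_right mult_scaleC_left mult_scaleC_right
      intro: bounded_linear_mult_right bounded_linear_mult_left
      bounded_linear_compose[OF bounded_linear_mult_left bounded_linear_mult_right, unfolded o_def])

lemma closure_cspan_mult:
  fixes U :: "'a::cstar_algebra set"
  assumes "x \<in> closure (cspan S)" "y \<in> closure (cspan S')" "closed_csubspace U"
    and m: "\<And>s s'. s \<in> S \<Longrightarrow> s' \<in> S' \<Longrightarrow> s * s' \<in> U"
  shows "x * y \<in> U"
proof (rule closure_cspan_map[OF assms(1,3) clinear_mult(2,5)])
  fix s assume "s \<in> S"
  then show "s * y \<in> U"
    by (intro closure_cspan_map[OF assms(2,3) clinear_mult(1,4)] m)
qed

text \<open>A densely defined operator is handled through its graph \<open>G\<close>.\<close>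

lemma closure_graph_bound:
  fixes G :: "('a::real_normed_vector \<times> 'b::real_normed_vector) set"
  assumes "\<And>x u. (x, u) \<in> G \<Longrightarrow> norm u \<le> C * norm x" and "(x, u) \<in> closure G"
  shows "norm u \<le> C * norm x"
proof -
  obtain s where s: "\<And>n. s n \<in> G" "s \<longlonglongrightarrow> (x, u)"
    using assms(2) unfolding closure_sequential by blast
  have "(\<lambda>n. fst (s n)) \<longlonglongrightarrow> x" "(\<lambda>n. snd (s n)) \<longlonglongrightarrow> u"
    using tendsto_fst[OF s(2)] tendsto_snd[OF s(2)] by auto
  then have "(\<lambda>n. C * norm (fst (s n))) \<longlonglongrightarrow> C * norm x" "(\<lambda>n. norm (snd (s n))) \<longlonglongrightarrow> norm u"
    by (auto intro!: tendsto_intros)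
  moreover have "norm (snd (s n)) \<le> C * norm (fst (s n))" for n
    using assms(1)[of "fst (s n)" "snd (s n)"] s(1) by simp
  ultimately show ?thesis
    by (intro LIMSEQ_le) auto
qed

lemma closure_pairI:
  fixes G :: "('a::real_normed_vector \<times> 'b::real_normed_vector) set"
  assumes "\<And>n. (s n, t n) \<in> G" "s \<longlonglongrightarrow> x" "t \<longlonglongrightarrow> u"
  shows "(x, u) \<in> closure G"
  unfolding closure_sequential
  by (rule exI[of _ "\<lambda>n. (s n, t n)"]) (use assms in \<open>auto intro: tendsto_Pair\<close>)

lemma closure_pairE:
  fixes G :: "('a::real_normed_vector \<times> 'b::real_normed_vector) set"
  assumes "(x, u) \<in> closure G"
  obtains s t where "\<And>n. (s n, t n) \<in> G" "s \<longlonglongrightarrow> x" "t \<longlonglongrightarrow> u"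
proof -
  obtain s where s: "\<And>n. s n \<in> G" "s \<longlonglongrightarrow> (x, u)"
    using assms(1) unfolding closure_sequential by blast
  then show ?thesis
    using that[of "\<lambda>n. fst (s n)" "\<lambda>n. snd (s n)"] tendsto_fst[OF s(2)] tendsto_snd[OF s(2)] by auto
qed

lemma Cauchy_of_bound:
  fixes s :: "nat \<Rightarrow> 'a::real_normed_vector" and t :: "nat \<Rightarrow> 'b::real_normed_vector"
  assumes "Cauchy s" "\<And>m n. norm (t m - t n) \<le> C * norm (s m - s n)"
  shows "Cauchy t"
proof (rule metric_CauchyI)
  fix e :: real
  assume "e > 0"
  then obtain M where M: "\<And>m n. m \<ge> M \<Longrightarrow> n \<ge> M \<Longrightarrow> dist (s m) (s n) < e / (\<bar>C\<bar> + 1)"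
    using metric_CauchyD[OF assms(1), of "e / (\<bar>C\<bar> + 1)"] by (auto simp: add_nonneg_pos)
  show "\<exists>M. \<forall>m\<ge>M. \<forall>n\<ge>M. dist (t m) (t n) < e"
  proof (intro exI allI impI)
    fix m n assume mn: "m \<ge> M" "n \<ge> M"
    have "dist (t m) (t n) \<le> C * norm (s m - s n)"
      using assms(2) by (simp add: dist_norm)
    also have "\<dots> \<le> (\<bar>C\<bar> + 1) * norm (s m - s n)"
      by (intro mult_right_mono) auto
    also have "\<dots> < e"
      using M[OF mn] by (simp add: dist_norm pos_less_divide_eq add_nonneg_pos mult.commute)
    finally show "dist (t m) (t n) < e" .
  qed
qed

text \<open>The values along a convergent sequence of arguments form a Cauchy sequence, so a bounded
  operator extends to the closure of its domain.\<close>

lemma closure_graph_total: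
  fixes G :: "('a::real_normed_vector \<times> 'b::banach) set"
  assumes G: "\<And>x u. (x, u) \<in> G \<Longrightarrow> norm u \<le> C * norm x"
    and diff: "\<And>x u y v. (x, u) \<in> G \<Longrightarrow> (y, v) \<in> G \<Longrightarrow> (x - y, u - v) \<in> G"
    and x: "x \<in> closure (fst ` G)"
  obtains u where "(x, u) \<in> closure G"
proof -
  obtain s where s: "\<And>n. s n \<in> fst ` G" "s \<longlonglongrightarrow> x"
    using x unfolding closure_sequential by blast
  then have "\<forall>n. \<exists>u. (s n, u) \<in> G"
    by force
  then obtain t where t: "\<And>n. (s n, t n) \<in> G"
    by metis
  have "Cauchy t"
    using LIMSEQ_imp_Cauchy[OF s(2)] G[OF diff[OF t t]] by (rule Cauchy_of_bound)
  then obtain u where "t \<longlonglongrightarrow> u"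
    by (auto simp: Cauchy_convergent_iff convergent_def)
  then show ?thesis
    using that closure_pairI t s(2) by blast
qed

lemma closure_graph_add:
  fixes G :: "('a::complex_banach \<times> 'b::complex_banach) set"
  assumes "\<And>x u y v. (x, u) \<in> G \<Longrightarrow> (y, v) \<in> G \<Longrightarrow> (x + y, u + v) \<in> G"
    and "(x, u) \<in> closure G" "(y, v) \<in> closure G"
  shows "(x + y, u + v) \<in> closure G"
proof -
  obtain s t where s: "\<And>n. (s n, t n) \<in> G" "s \<longlonglongrightarrow> x" "t \<longlonglongrightarrow> u"
    using assms(2) by (rule closure_pairE) metis
  obtain s' t' where s': "\<And>n. (s' n, t' n) \<in> G" "s' \<longlonglongrightarrow> y" "t' \<longlonglongrightarrow> v"
    using assms(3) by (rule closure_pairE) metis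
  show ?thesis
  proof (rule closure_pairI[of "\<lambda>n. s n + s' n" "\<lambda>n. t n + t' n"])
    show "(s n + s' n, t n + t' n) \<in> G" for n
      by (rule assms(1)[OF s(1) s'(1)])
  qed (intro tendsto_add s s')+
qed

lemma closure_graph_scaleC:
  fixes G :: "('a::complex_banach \<times> 'b::complex_banach) set"
  assumes "\<And>x u. (x, u) \<in> G \<Longrightarrow> (c *\<^sub>C x, c *\<^sub>C u) \<in> G"
    and "(x, u) \<in> closure G"
  shows "(c *\<^sub>C x, c *\<^sub>C u) \<in> closure G"
proof -
  obtain s t where s: "\<And>n. (s n, t n) \<in> G" "s \<longlonglongrightarrow> x" "t \<longlonglongrightarrow> u"
    using assms(2) by (rule closure_pairE) metis
  show ?thesis
  proof (rule closure_pairI[of "\<lambda>n. c *\<^sub>C s n" "\<lambda>n. c *\<^sub>C t n"])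
    show "(c *\<^sub>C s n, c *\<^sub>C t n) \<in> G" for n
      by (rule assms(1)[OF s(1)])
  qed (intro tendsto_scaleC s)+
qed

section \<open>Hilbert modules\<close>

context hilbert_module
begin

lemma ip_add_left: "ip (x + y) z = ip x z + ip y z"
  by (metis star_ip star_add ip_add_right)

lemma ip_scaleC_left: "ip (c *\<^sub>C x) y = cnj c *\<^sub>C ip x y"
  by (metis star_ip star_scaleC ip_scaleC_right)

lemma ip_scaleR: "ip (r *\<^sub>R x) y = r *\<^sub>R ip x y" "ip x (r *\<^sub>R y) = r *\<^sub>R ip x y"
  by (simp_all add: scaleR_scaleC ip_scaleC_left ip_scaleC_right)

lemma ip_zero: "ip 0 y = 0" "ip x 0 = 0"
  using ip_scaleR(1)[of 0 0 y] ip_scaleR(2)[of x 0 0] by simp_all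

lemma ip_diff: "ip (x - y) z = ip x z - ip y z" "ip z (x - y) = ip z x - ip z y"
  using ip_add_left[of "x - y" y z] ip_add_right[of z "x - y" y] by simp_all

lemma ip_ract_left: "ip (ract x a) y = star a * ip x y"
  by (metis star_ip star_mult ip_ract)

text \<open>Polarization stands in for the Cauchy-Schwarz inequality and makes no use of the order
  of A. On unit vectors the bound (1 + 1)^2 is 4, and scaling carries it over to all
  vectors.\<close>

lemma norm_ip_le: "norm (ip x y) \<le> 4 * norm x * norm y"
proof -
  have pol: "norm (ip x y) \<le> (norm x + norm y)\<^sup>2" for x y
  proof -
    define f where "f c = ip (x + c *\<^sub>C y) (x + c *\<^sub>C y)" for c
    have f: "f c = ip x x + c *\<^sub>C ip x y + cnj c *\<^sub>C ip y x + (c * cnj c) *\<^sub>C ip y y" for c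
      by (simp add: f_def ip_add_left ip_add_right ip_scaleC_left ip_scaleC_right scaleC_add_right
          scaleC_scaleC mult.commute)
    have nf: "norm (f c) \<le> (norm x + norm y)\<^sup>2" if "cmod c = 1" for c
      unfolding f_def norm_ip[symmetric]
      by (intro power_mono order_trans[OF norm_triangle_ineq]) (simp_all add: norm_scaleC that)
    have eq: "4 *\<^sub>R ip x y = f 1 - f (-1) - \<i> *\<^sub>C f \<i> + \<i> *\<^sub>C f (- \<i>)"
    proof -
      have "f 1 = ip x x + ip x y + ip y x + ip y y" "f (-1) = ip x x - ip x y - ip y x + ip y y"
        by (simp_all add: f scaleC_one scaleC_minus_one)
      moreover have "\<i> *\<^sub>C f \<i> = \<i> *\<^sub>C ip x x - ip x y + ip y x + \<i> *\<^sub>C ip y y"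
        "\<i> *\<^sub>C f (- \<i>) = \<i> *\<^sub>C ip x x + ip x y - ip y x + \<i> *\<^sub>C ip y y"
        by (simp_all add: f scaleC_add_right complex_vector.scale_right_diff_distrib scaleC_scaleC
            scaleC_one)
      moreover have "4 *\<^sub>R ip x y = ip x y + ip x y + ip x y + ip x y"
        using scaleR_add_left[of 2 2 "ip x y"] by (simp add: scaleR_2)
      ultimately show ?thesis
        by simp
    qed
    have "norm (4 *\<^sub>R ip x y) \<le> norm (f 1) + norm (f (-1)) + norm (\<i> *\<^sub>C f \<i>) + norm (\<i> *\<^sub>C f (- \<i>))"
      unfolding eq using norm_triangle_ineq[of "f 1 - f (-1) - \<i> *\<^sub>C f \<i>" "\<i> *\<^sub>C f (- \<i>)"]
        norm_triangle_ineq4[of "f 1 - f (-1)" "\<i> *\<^sub>C f \<i>"] norm_triangle_ineq4[of "f 1" "f (-1)"]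
      by linarith
    then show ?thesis
      using nf[of 1] nf[of "-1"] nf[of \<i>] nf[of "-\<i>"] by (simp add: norm_scaleC)
  qed
  show ?thesis
  proof (cases "x = 0 \<or> y = 0")
    case False
    have "norm (ip ((1 / norm x) *\<^sub>R x) ((1 / norm y) *\<^sub>R y)) \<le> (1 + 1)\<^sup>2"
      using pol[of "(1 / norm x) *\<^sub>R x" "(1 / norm y) *\<^sub>R y"] False by simp
    then show ?thesis
      using False by (simp add: ip_scaleR divide_simps mult_ac)
  qed (auto simp: ip_zero)
qed

lemma bounded_linear_ip: "bounded_linear (\<lambda>x. ip x y)" "bounded_linear (\<lambda>y. ip x y)"
proof -
  show "bounded_linear (\<lambda>x. ip x y)"
    using norm_ip_le by (intro bounded_linear_intro[where K = "4 * norm y"])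
      (auto simp: ip_add_left ip_scaleR mult_ac)
  show "bounded_linear (\<lambda>y. ip x y)"
  proof (rule bounded_linear_intro[where K = "4 * norm x"])
    show "norm (ip x y) \<le> norm y * (4 * norm x)" for y
      using norm_ip_le[of x y] by (simp add: mult_ac)
  qed (auto simp: ip_add_right ip_scaleR)
qed

lemma norm_ract_le: "norm (ract x a) \<le> norm x * norm a"
proof -
  have "(norm (ract x a))\<^sup>2 = norm (star a * ip x x * a)"
    by (simp add: norm_ip ip_ract ip_ract_left)
  also have "\<dots> \<le> norm (star a) * norm (ip x x) * norm a"
    by (meson norm_mult_ineq order_trans mult_right_mono norm_ge_zero)
  also have "\<dots> = (norm x * norm a)\<^sup>2"
    by (simp add: norm_ip[symmetric] power2_eq_square)
  finally show ?thesis
    by (rule power2_le_imp_le) simp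
qed

lemma ract_scaleR: "ract (r *\<^sub>R x) a = r *\<^sub>R ract x a" "ract x (r *\<^sub>R a) = r *\<^sub>R ract x a"
  by (simp_all add: scaleR_scaleC ract_scaleC_left ract_scaleC_right)

lemma bounded_linear_ract: "bounded_linear (\<lambda>x. ract x a)" "bounded_linear (\<lambda>a. ract x a)"
proof -
  show "bounded_linear (\<lambda>x. ract x a)"
    using norm_ract_le by (intro bounded_linear_intro[where K = "norm a"])
      (auto simp: ract_add_left ract_scaleR)
  show "bounded_linear (\<lambda>a. ract x a)"
    using norm_ract_le by (intro bounded_linear_intro[where K = "norm x"])
      (auto simp: ract_add_right ract_scaleR mult_ac)
qed

lemma rank_one_apply [simp]: "blinfun_apply (rank_one ract ip x y) z = ract x (ip y z)"
  unfolding rank_one_def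
  by (subst bounded_linear_Blinfun_apply)
    (rule bounded_linear_compose[OF bounded_linear_ract(2) bounded_linear_ip(2)], rule refl)

lemma ip_eqI: "(\<And>z. ip z x = ip z y) \<Longrightarrow> x = y"
  using norm_ip[of "x - y"] by (simp add: ip_diff)

lemma is_adjoint_sym: "is_adjoint ip k l \<Longrightarrow> is_adjoint ip l k"
  unfolding is_adjoint_def by (metis star_ip)

lemma is_adjoint_unique: "is_adjoint ip k l \<Longrightarrow> is_adjoint ip k l' \<Longrightarrow> l = l'"
  unfolding is_adjoint_def by (metis blinfun_eqI ip_eqI)

lemma is_adjoint_compose:
  "is_adjoint ip k l \<Longrightarrow> is_adjoint ip k' l' \<Longrightarrow> is_adjoint ip (k o\<^sub>L k') (l' o\<^sub>L l)"
  unfolding is_adjoint_def by simp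

lemma is_adjoint_diff:
  "is_adjoint ip k l \<Longrightarrow> is_adjoint ip k' l' \<Longrightarrow> is_adjoint ip (k - k') (l - l')"
  unfolding is_adjoint_def by (simp add: blinfun.diff_left ip_diff)

lemma is_adjoint_rank_one: "is_adjoint ip (rank_one ract ip x y) (rank_one ract ip y x)"
  unfolding is_adjoint_def by (simp add: ip_ract_left ip_ract star_ip)

text \<open>The factor 4 is that of \<open>norm_ip_le\<close>, applied to \<open>ip (k z) y\<close>
  with z = l y.\<close>

lemma norm_adjoint_le:
  assumes "is_adjoint ip k l"
  shows "norm l \<le> 4 * norm k"
proof (rule norm_blinfun_bound)
  fix y
  define z where "z = blinfun_apply l y"
  show "norm (blinfun_apply l y) \<le> 4 * norm k * norm y"
  proof (cases "z = 0")
    case False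
    have "norm z * norm z = norm (ip z z)"
      using norm_ip[of z] by (simp add: power2_eq_square)
    also have "ip z z = ip (blinfun_apply k z) y"
      using assms by (simp add: is_adjoint_def z_def)
    also have "norm \<dots> \<le> 4 * norm (blinfun_apply k z) * norm y"
      by (rule norm_ip_le)
    also have "\<dots> \<le> 4 * (norm k * norm z) * norm y"
      by (intro mult_right_mono mult_left_mono norm_blinfun) auto
    finally have "norm z * norm z \<le> (4 * norm k * norm y) * norm z"
      by (simp add: mult_ac)
    then show ?thesis
      using False by (simp add: z_def)
  qed (simp add: z_def)
qed simp

lemma is_adjoint_limit:
  assumes "\<And>n. is_adjoint ip (s n) (t n)" "s \<longlonglongrightarrow> k" "t \<longlonglongrightarrow> l"
  shows "is_adjoint ip k l"
  unfolding is_adjoint_def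
proof (intro allI)
  fix x y
  have "(\<lambda>n. ip (blinfun_apply (s n) x) y) \<longlonglongrightarrow> ip (blinfun_apply k x) y"
    by (intro bounded_linear.tendsto[OF bounded_linear_ip(1)] tendsto_intros assms)
  moreover have "(\<lambda>n. ip x (blinfun_apply (t n) y)) \<longlonglongrightarrow> ip x (blinfun_apply l y)"
    by (intro bounded_linear.tendsto[OF bounded_linear_ip(2)] tendsto_intros assms)
  ultimately show "ip (blinfun_apply k x) y = ip x (blinfun_apply l y)"
    using assms(1) LIMSEQ_unique by (simp add: is_adjoint_def)
qed

lemma scaleC_rank_one: "c *\<^sub>C rank_one ract ip x y = rank_one ract ip (c *\<^sub>C x) y"
  by (rule blinfun_eqI) (simp add: blinfun_apply_scaleC ract_scaleC_left)

end

text \<open>The image of the compact operators under \<open>(\<psi>\<^sub>V, \<rho>)\<^sup>(\<^sup>1\<^sup>)\<close>.\<close>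

definition B1 :: "('a::cstar_algebra \<Rightarrow> 'b::cstar_algebra) \<Rightarrow> 'b \<Rightarrow> 'b set" where
  "B1 \<rho> V = closure (cspan {\<rho> a * V * star V * \<rho> b | a b. True})"

section \<open>The homomorphism induced on the compact operators\<close>

locale exel_module =
  fixes \<alpha> L :: "'a::cstar_algebra \<Rightarrow> 'a"
    and ract :: "'m::complex_banach \<Rightarrow> 'a \<Rightarrow> 'm"
    and ip :: "'m \<Rightarrow> 'm \<Rightarrow> 'a"
    and q :: "'a \<Rightarrow> 'm"
    and \<phi> :: "'a \<Rightarrow> 'm \<Rightarrow>\<^sub>L 'm"
  assumes bimodule: "exel_bimodule \<alpha> L ract ip q \<phi>"

sublocale exel_module \<subseteq> hilbert_module ract ip
  using bimodule by (simp add: exel_bimodule_def)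

locale exel_representation = exel_module \<alpha> L ract ip q \<phi>
  for \<alpha> L :: "'a::cstar_algebra \<Rightarrow> 'a"
    and ract :: "'m::complex_banach \<Rightarrow> 'a \<Rightarrow> 'm"
    and ip :: "'m \<Rightarrow> 'm \<Rightarrow> 'a"
    and q :: "'a \<Rightarrow> 'm"
    and \<phi> :: "'a \<Rightarrow> 'm \<Rightarrow>\<^sub>L 'm" +
  fixes \<rho> :: "'a \<Rightarrow> 'b::cstar_algebra" and V :: 'b
  assumes toeplitz_cov: "toeplitz_covariant \<alpha> L \<rho> V"
begin

lemma q_facts:
  "clinear q" "closure (range q) = UNIV" "ract (q m) a = q (m * \<alpha> a)"
  "ip (q m) (q n) = L (star m * n)" "blinfun_apply (\<phi> a) (q b) = q (a * b)"
  using bimodule by (auto simp: exel_bimodule_def)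

lemma rho_facts:
  "star_hom \<rho>" "\<rho> 1 = 1" "V * \<rho> a = \<rho> (\<alpha> a) * V" "star V * \<rho> a * V = \<rho> (L a)"
  using toeplitz_cov by (auto simp: toeplitz_covariant_def)

lemmas rho_hom = star_homD[OF rho_facts(1)]
lemmas rho_bounded_linear = star_hom_bounded_linear[OF rho_facts(1)]
lemmas norm_rho_le = star_hom_contractive[OF rho_facts(1)]

lemma dense_range_eq:
  fixes f g :: "'m \<Rightarrow> 'z::t2_space"
  assumes "continuous_on UNIV f" "continuous_on UNIV g" "\<And>a. f (q a) = g (q a)"
  shows "f x = g x"
proof -
  have "closure (range q) \<subseteq> {x. f x = g x}"
    using assms by (intro closure_minimal closed_Collect_eq) auto
  then show ?thesis
    using q_facts(2) by auto
qed

abbreviation "\<psi> \<equiv> psi q \<rho> V"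

text \<open>By covariance the square of the norm of \<rho>(a) V is that of \<rho>(L(a* a)), hence at
  most the norm of L(a* a), which is the square of the norm of q(a). So the graph on the range of q
  is bounded, and its closure is the graph of the only candidate in \<open>psi_def\<close>.\<close>

lemma psi_facts: "clinear \<psi>" "bounded_linear \<psi>" "\<psi> (q a) = \<rho> a * V"
proof -
  define G where "G = range (\<lambda>a. (q a, \<rho> a * V))"
  have G1: "norm u \<le> 1 * norm x" if "(x, u) \<in> G" for x u
  proof -
    obtain a where a: "x = q a" "u = \<rho> a * V"
      using \<open>(x, u) \<in> G\<close> by (auto simp: G_def)
    have "(norm u)\<^sup>2 = norm (star V * \<rho> (star a * a) * V)"
      unfolding cstar_identity[symmetric] a by (simp add: star_mult rho_hom mult.assoc)
    also have "\<dots> \<le> norm (L (star a * a))"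
      using norm_rho_le by (simp add: rho_facts)
    also have "\<dots> = (norm x)\<^sup>2"
      by (simp add: norm_ip a q_facts)
    finally have "norm u \<le> norm x"
      by (rule power2_le_imp_le) simp
    then show ?thesis
      by simp
  qed
  have Gadd: "(x + y, u + v) \<in> G" if "(x, u) \<in> G" "(y, v) \<in> G" for x u y v
  proof -
    obtain a b where ab: "x = q a" "u = \<rho> a * V" "y = q b" "v = \<rho> b * V"
      using \<open>(x, u) \<in> G\<close> \<open>(y, v) \<in> G\<close> by (auto simp: G_def)
    have "(x + y, u + v) = (q (a + b), \<rho> (a + b) * V)"
      by (simp add: ab clinear_add[OF rho_hom(1)] clinear_add[OF q_facts(1)] distrib_right)
    then show ?thesis
      unfolding G_def by blast
  qed
  have Gsc: "(c *\<^sub>C x, c *\<^sub>C u) \<in> G" if "(x, u) \<in> G" for x u c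
  proof -
    obtain a where a: "x = q a" "u = \<rho> a * V"
      using \<open>(x, u) \<in> G\<close> by (auto simp: G_def)
    have "(c *\<^sub>C x, c *\<^sub>C u) = (q (c *\<^sub>C a), \<rho> (c *\<^sub>C a) * V)"
      by (simp add: a clinear_scaleC[OF rho_hom(1)] clinear_scaleC[OF q_facts(1)] mult_scaleC_left)
    then show ?thesis
      unfolding G_def by blast
  qed
  have Gdiff: "(x - y, u - v) \<in> G" if "(x, u) \<in> G" "(y, v) \<in> G" for x u y v
    using Gadd[OF that(1) Gsc[OF that(2), of "-1"]] by (simp add: scaleC_minus_one)
  have cb: "norm u \<le> 1 * norm x" if "(x, u) \<in> closure G" for x u
    using G1 that by (rule closure_graph_bound)
  have "fst ` G = range q"
    by (auto simp: G_def image_image)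
  then have "\<exists>u. (x, u) \<in> closure G" for x
    using closure_graph_total[of G 1 x, OF G1 Gdiff] q_facts(2) by (metis UNIV_I)
  then obtain f where f: "\<And>x. (x, f x) \<in> closure G"
    by metis
  have uniq: "u = v" if "(x, u) \<in> closure G" "(x, v) \<in> closure G" for x u v
  proof -
    have "(x + (-1) *\<^sub>C x, u + (-1) *\<^sub>C v) \<in> closure G"
      by (intro closure_graph_add[OF Gadd] closure_graph_scaleC[OF Gsc] that)
    then show ?thesis
      using cb[of 0 "u - v"] by (simp add: scaleC_minus_one)
  qed
  have fq: "f (q a) = \<rho> a * V" for a
  proof (rule uniq[OF f])
    have "(q a, \<rho> a * V) \<in> G"
      by (simp add: G_def)
    then show "(q a, \<rho> a * V) \<in> closure G"
      using closure_subset by blast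
  qed
  have fl: "clinear f"
    unfolding clinear_iff
    using uniq[OF f closure_graph_add[OF Gadd f f]] uniq[OF f closure_graph_scaleC[OF Gsc f]] by auto
  have fb: "bounded_linear f"
    using cb[OF f] fl
    by (intro bounded_linear_intro[where K = 1]) (auto simp: clinear_add clinear_scaleR)
  have "\<psi> = f"
    unfolding psi_def
  proof (rule the_equality)
    show "clinear f \<and> bounded_linear f \<and> (\<forall>a. f (q a) = \<rho> a * V)"
      using fl fb fq by blast
    fix g :: "'m \<Rightarrow> 'b"
    assume g: "clinear g \<and> bounded_linear g \<and> (\<forall>a. g (q a) = \<rho> a * V)"
    show "g = f"
    proof
      fix x
      show "g x = f x"
      proof (rule dense_range_eq[where f = g and g = f])
        show "continuous_on UNIV g" "continuous_on UNIV f"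
          using g fb bounded_linear.continuous_on[OF _ continuous_on_id] by blast+
      qed (simp add: g fq)
    qed
  qed
  then show "clinear \<psi>" "bounded_linear \<psi>" "\<psi> (q a) = \<rho> a * V"
    using fl fb fq by auto
qed

lemma continuous_psi: "continuous_on UNIV \<psi>"
  by (rule bounded_linear.continuous_on[OF psi_facts(2) continuous_on_id])

lemma psi_ip: "star (\<psi> x) * \<psi> y = \<rho> (ip x y)"
proof -
  have 1: "star (\<psi> (q a)) * \<psi> (q b) = \<rho> (ip (q a) (q b))" for a b
  proof -
    have "star (\<psi> (q a)) * \<psi> (q b) = star V * \<rho> (star a * b) * V"
      by (simp add: psi_facts star_mult rho_hom mult.assoc)
    then show ?thesis
      by (simp add: rho_facts q_facts)
  qed
  have 2: "star (\<psi> (q a)) * \<psi> y = \<rho> (ip (q a) y)" for a y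
  proof (rule dense_range_eq[where f = "\<lambda>y. star (\<psi> (q a)) * \<psi> y" and g = "\<lambda>y. \<rho> (ip (q a) y)"])
    show "continuous_on UNIV (\<lambda>y. star (\<psi> (q a)) * \<psi> y)"
      by (intro continuous_on_mult continuous_psi continuous_on_const)
    show "continuous_on UNIV (\<lambda>y. \<rho> (ip (q a) y))"
      by (intro linear_continuous_on bounded_linear_compose[OF rho_bounded_linear bounded_linear_ip(2)])
  qed (rule 1)
  show ?thesis
  proof (rule dense_range_eq[where f = "\<lambda>x. star (\<psi> x) * \<psi> y" and g = "\<lambda>x. \<rho> (ip x y)"])
    show "continuous_on UNIV (\<lambda>x. star (\<psi> x) * \<psi> y)"
      by (rule continuous_on_mult[OF continuous_on_star[OF continuous_psi] continuous_on_const])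
    show "continuous_on UNIV (\<lambda>x. \<rho> (ip x y))"
      by (intro linear_continuous_on bounded_linear_compose[OF rho_bounded_linear bounded_linear_ip(1)])
  qed (rule 2)
qed

lemma psi_ract: "\<psi> (ract x a) = \<psi> x * \<rho> a"
proof (rule dense_range_eq[where f = "\<lambda>x. \<psi> (ract x a)" and g = "\<lambda>x. \<psi> x * \<rho> a"])
  show "\<psi> (ract (q m) a) = \<psi> (q m) * \<rho> a" for m
    by (simp add: q_facts psi_facts rho_hom mult.assoc rho_facts)
  show "continuous_on UNIV (\<lambda>x. \<psi> (ract x a))"
    by (intro linear_continuous_on bounded_linear_compose[OF psi_facts(2) bounded_linear_ract(1)])
  show "continuous_on UNIV (\<lambda>x. \<psi> x * \<rho> a)"
    by (intro continuous_on_mult continuous_psi continuous_on_const)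
qed

lemma psi_phi: "\<psi> (blinfun_apply (\<phi> a) x) = \<rho> a * \<psi> x"
proof (rule dense_range_eq[where f = "\<lambda>x. \<psi> (blinfun_apply (\<phi> a) x)" and g = "\<lambda>x. \<rho> a * \<psi> x"])
  show "\<psi> (blinfun_apply (\<phi> a) (q m)) = \<rho> a * \<psi> (q m)" for m
    by (simp add: q_facts psi_facts rho_hom mult.assoc)
  show "continuous_on UNIV (\<lambda>x. \<psi> (blinfun_apply (\<phi> a) x))"
    by (intro linear_continuous_on bounded_linear_compose[OF psi_facts(2) blinfun.bounded_linear_right])
  show "continuous_on UNIV (\<lambda>x. \<rho> a * \<psi> x)"
    by (intro continuous_on_mult continuous_psi continuous_on_const)
qed

lemma norm_psi_le: "norm (\<psi> x) \<le> norm x"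
proof -
  have "(norm (\<psi> x))\<^sup>2 = norm (\<rho> (ip x x))"
    by (simp add: cstar_identity[symmetric] psi_ip)
  also have "\<dots> \<le> (norm x)\<^sup>2"
    using norm_rho_le by (simp add: norm_ip)
  finally show ?thesis
    by (rule power2_le_imp_le) simp
qed

lemma norm_psi_eq:
  assumes "\<And>a. norm (\<rho> a) = norm a"
  shows "norm (\<psi> x) = norm x"
proof -
  have "(norm (\<psi> x))\<^sup>2 = (norm x)\<^sup>2"
    by (simp add: cstar_identity[symmetric] psi_ip norm_ip assms)
  then show ?thesis
    by simp
qed

text \<open>A relation rather than a function: an operator is a sum of rank-one operators in many
  ways. That the second component depends only on the first follows from
  \<open>finite_rank_bound\<close>.\<close>

inductive_set finite_rank :: "(('m \<Rightarrow>\<^sub>L 'm) \<times> 'b) set" where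
  zero: "(0, 0) \<in> finite_rank"
| step: "(k, u) \<in> finite_rank \<Longrightarrow>
    (rank_one ract ip x y + k, \<psi> x * star (\<psi> y) + u) \<in> finite_rank"

lemma finite_rank_rank_one: "(rank_one ract ip x y, \<psi> x * star (\<psi> y)) \<in> finite_rank"
  using finite_rank.step[OF finite_rank.zero, of x y] by simp

lemma finite_rank_add:
  assumes "(k, u) \<in> finite_rank" "(l, v) \<in> finite_rank"
  shows "(k + l, u + v) \<in> finite_rank"
  using assms
proof induction
  case (step k u x y)
  then show ?case
    using finite_rank.step[of "k + l" "u + v" x y] by (simp add: add.assoc)
qed simp

lemma finite_rank_scaleC:
  assumes "(k, u) \<in> finite_rank"
  shows "(c *\<^sub>C k, c *\<^sub>C u) \<in> finite_rank"
  using assms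
proof induction
  case (step k u x y)
  have "c *\<^sub>C (rank_one ract ip x y + k) = rank_one ract ip (c *\<^sub>C x) y + c *\<^sub>C k"
    by (simp only: scaleC_rank_one scaleC_add_right)
  moreover have "c *\<^sub>C (\<psi> x * star (\<psi> y) + u) = \<psi> (c *\<^sub>C x) * star (\<psi> y) + c *\<^sub>C u"
    by (simp only: scaleC_add_right clinear_scaleC[OF psi_facts(1)] mult_scaleC_left)
  ultimately show ?case
    using finite_rank.step[OF step(2)] by metis
qed (simp add: finite_rank.zero)

lemma finite_rank_diff:
  assumes "(k, u) \<in> finite_rank" "(l, v) \<in> finite_rank"
  shows "(k - l, u - v) \<in> finite_rank"
  using finite_rank_add[OF assms(1) finite_rank_scaleC[OF assms(2), of "-1"]]
  by (simp add: scaleC_minus_one)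

text \<open>Left multiplication by u acts on the image of M_L as k acts on M_L. The norm comparisons
  between u and k rest on this relation.\<close>

lemma finite_rank_apply:
  assumes "(k, u) \<in> finite_rank"
  shows "u * \<psi> z = \<psi> (blinfun_apply k z)" "blinfun_apply k (ract z a) = ract (blinfun_apply k z) a"
  using assms
proof induction
  case (step k u x y)
  {
    case 1
    then show ?case
      using step by (simp add: distrib_right blinfun.add_left clinear_add[OF psi_facts(1)] psi_ract
          mult.assoc psi_ip)
  next
    case 2
    then show ?case
      using step by (simp add: blinfun.add_left ract_add_left ip_ract ract_mult)
  }
qed (simp_all add: clinear_0[OF psi_facts(1)] linear_0[OF bounded_linear.linear[OF bounded_linear_ract(1)]])

text \<open>Composition with the module map l sends the rank-one operator of (x, y) to that of (l x,
  y), and the product v u follows it by the intertwining relation.\<close>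

lemma finite_rank_mult:
  assumes "(k, u) \<in> finite_rank" "\<And>z. v * \<psi> z = \<psi> (blinfun_apply l z)"
    and "\<And>z a. blinfun_apply l (ract z a) = ract (blinfun_apply l z) a"
  shows "(l o\<^sub>L k, v * u) \<in> finite_rank"
  using assms(1)
proof induction
  case (step k u x y)
  have "l o\<^sub>L (rank_one ract ip x y + k) = rank_one ract ip (blinfun_apply l x) y + (l o\<^sub>L k)"
    by (rule blinfun_eqI) (simp add: blinfun.add_left blinfun.add_right assms(3))
  moreover have "v * (\<psi> x * star (\<psi> y) + u) = \<psi> (blinfun_apply l x) * star (\<psi> y) + v * u"
    by (simp add: distrib_left assms(2) flip: mult.assoc)
  ultimately show ?case
    using finite_rank.step[OF step(2), of "blinfun_apply l x" y] by simp
qed (simp add: finite_rank.zero blinfun_compose_zero)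

lemma finite_rank_adjoint:
  assumes "(k, u) \<in> finite_rank"
  shows "\<exists>l. is_adjoint ip k l \<and> (l, star u) \<in> finite_rank"
  using assms
proof induction
  case zero
  have "is_adjoint ip 0 0"
    by (simp add: is_adjoint_def ip_zero)
  then show ?case
    using finite_rank.zero by auto
next
  case (step k u x y)
  then obtain l where l: "is_adjoint ip k l" "(l, star u) \<in> finite_rank"
    by blast
  have "is_adjoint ip (rank_one ract ip x y + k) (rank_one ract ip y x + l)"
    using l(1) is_adjoint_rank_one[of x y]
    by (simp add: is_adjoint_def blinfun.add_left ip_add_left ip_add_right)
  moreover have "(rank_one ract ip y x + l, star (\<psi> x * star (\<psi> y) + u)) \<in> finite_rank"
    using finite_rank.step[OF l(2), of y x] by (simp add: star_add star_mult star_star)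
  ultimately show ?case
    by blast
qed

text \<open>The product v u involves v only through v \<psi>(x) = \<psi>(l x) for the finitely many
  x in a representation of u. Hence C serves all v at once, in particular all powers of u.\<close>

lemma finite_rank_mult_bound:
  assumes "(k, u) \<in> finite_rank"
  shows "\<exists>C. \<forall>v l. (\<forall>z. v * \<psi> z = \<psi> (blinfun_apply l z)) \<longrightarrow> norm (v * u) \<le> C * norm l"
  using assms
proof induction
  case zero
  show ?case
    by (intro exI[of _ 0]) simp
next
  case (step k u x y)
  then obtain C where C: "\<And>v l. (\<forall>z. v * \<psi> z = \<psi> (blinfun_apply l z)) \<Longrightarrow> norm (v * u) \<le> C * norm l"
    by blast
  show ?case
  proof (intro exI[of _ "norm x * norm y + C"] allI impI)
    fix v l
    assume v: "\<forall>z. v * \<psi> z = \<psi> (blinfun_apply l z)"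
    have "norm (v * (\<psi> x * star (\<psi> y))) \<le> norm (blinfun_apply l x) * norm y"
    proof -
      have "v * (\<psi> x * star (\<psi> y)) = \<psi> (blinfun_apply l x) * star (\<psi> y)"
        using v by (simp flip: mult.assoc)
      also have "norm \<dots> \<le> norm (\<psi> (blinfun_apply l x)) * norm (star (\<psi> y))"
        by (rule norm_mult_ineq)
      also have "\<dots> \<le> norm (blinfun_apply l x) * norm y"
        by (intro mult_mono) (simp_all add: norm_psi_le)
      finally show ?thesis .
    qed
    also have "\<dots> \<le> norm l * norm x * norm y"
      by (intro mult_right_mono norm_blinfun) simp
    finally show "norm (v * (\<psi> x * star (\<psi> y) + u)) \<le> (norm x * norm y + C) * norm l"
      using C[OF v] norm_triangle_ineq[of "v * (\<psi> x * star (\<psi> y))" "v * u"]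
      by (simp add: algebra_simps)
  qed
qed

text \<open>Only the intertwining relation is claimed: for n = 0 the operator l is the identity,
  which need not be of finite rank.\<close>

lemma finite_rank_power:
  assumes "(k, u) \<in> finite_rank"
  shows "\<exists>l. norm l \<le> norm k ^ n \<and> (\<forall>z. u ^ n * \<psi> z = \<psi> (blinfun_apply l z))"
proof (induction n)
  case 0
  have "norm (id_blinfun :: 'm \<Rightarrow>\<^sub>L 'm) \<le> 1"
    by (rule norm_blinfun_bound) auto
  then show ?case
    by (intro exI[of _ id_blinfun]) simp
next
  case (Suc n)
  then obtain l where l: "norm l \<le> norm k ^ n" "\<And>z. u ^ n * \<psi> z = \<psi> (blinfun_apply l z)"
    by blast
  have "norm (k o\<^sub>L l) \<le> norm k * norm l"
    by (rule norm_blinfun_compose)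
  also have "\<dots> \<le> norm k * norm k ^ n"
    by (intro mult_left_mono l) simp
  finally show ?case
    using l(2) finite_rank_apply(1)[OF assms]
    by (intro exI[of _ "k o\<^sub>L l"]) (simp add: mult.assoc)
qed

text \<open>The \<open>C\<^sup>*\<close>-identity turns the crude bound on \<open>u ^ 2 ^ n\<close> into the sharp bound on \<open>u\<close>.\<close>

lemma finite_rank_selfadjoint_bound:
  assumes ku: "(k, u) \<in> finite_rank" and u: "star u = u"
  shows "norm u \<le> norm k"
proof (rule field_le_epsilon)
  fix e :: real
  assume e: "e > 0"
  define r where "r = norm k + e"
  have r: "r > 0" "norm k \<le> r"
    using e by (auto simp: r_def add_nonneg_pos)
  obtain C where C: "\<And>v l. (\<forall>z. v * \<psi> z = \<psi> (blinfun_apply l z)) \<Longrightarrow> norm (v * u) \<le> C * norm l"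
    using finite_rank_mult_bound[OF ku] by blast
  have "norm u ^ 2 ^ n \<le> (0 * 2 ^ n + \<bar>C\<bar> / r) * r ^ 2 ^ n" for n
  proof -
    \<comment> \<open>One factor u is split off to supply the constant C; the remaining power is
      estimated through \<open>norm k ^ m\<close>.\<close>
    obtain m where m: "2 ^ n = Suc m"
      by (metis not0_implies_Suc power_not_zero zero_neq_numeral)
    obtain l where l: "norm l \<le> norm k ^ m" "\<forall>z. u ^ m * \<psi> z = \<psi> (blinfun_apply l z)"
      using finite_rank_power[OF ku] by blast
    have "norm u ^ 2 ^ n = norm (u ^ m * u)"
      using norm_selfadjoint_power[OF u, of n] unfolding m power_Suc2 by simp
    also have "\<dots> \<le> C * norm l"
      by (rule C[OF l(2)])
    also have "\<dots> \<le> \<bar>C\<bar> * r ^ m"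
      by (intro mult_mono order_trans[OF l(1)] power_mono r) auto
    also have "\<dots> = (0 * 2 ^ n + \<bar>C\<bar> / r) * r ^ 2 ^ n"
      using r by (simp add: m)
    finally show ?thesis .
  qed
  then show "norm u \<le> norm k + e"
    using le_of_power_growth[of "norm u" r 0 "\<bar>C\<bar> / r"] r unfolding r_def by simp
qed

text \<open>The self-adjoint bound, applied to u* u, meets the factor 4 of
  \<open>norm_adjoint_le\<close>; its square root is the 2 here.\<close>

lemma finite_rank_bound:
  assumes ku: "(k, u) \<in> finite_rank"
  shows "norm u \<le> 2 * norm k"
proof -
  obtain l where l: "is_adjoint ip k l" "(l, star u) \<in> finite_rank"
    using finite_rank_adjoint[OF ku] by blast
  have "(l o\<^sub>L k, star u * u) \<in> finite_rank"
    by (rule finite_rank_mult[OF ku finite_rank_apply[OF l(2)]])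
  then have "norm (star u * u) \<le> norm (l o\<^sub>L k)"
    by (rule finite_rank_selfadjoint_bound) (simp add: star_mult star_star)
  also have "\<dots> \<le> norm l * norm k"
    by (rule norm_blinfun_compose)
  also have "\<dots> \<le> 4 * norm k * norm k"
    by (intro mult_right_mono norm_adjoint_le l) simp
  finally have "(norm u)\<^sup>2 \<le> (2 * norm k)\<^sup>2"
    by (simp add: cstar_identity power2_eq_square)
  then show ?thesis
    by (rule power2_le_imp_le) simp
qed

text \<open>This is the graph of the homomorphism that the Toeplitz representation induces on the
  compact operators.\<close>

definition "compact_graph = closure finite_rank"

lemma finite_rank_subset: "finite_rank \<subseteq> compact_graph"
  by (simp add: compact_graph_def closure_subset)

lemma fst_finite_rank: "fst ` finite_rank = cspan {rank_one ract ip x y | x y. True}"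
proof
  show "fst ` finite_rank \<subseteq> cspan {rank_one ract ip x y | x y. True}"
  proof
    fix k
    assume "k \<in> fst ` finite_rank"
    then obtain u where "(k, u) \<in> finite_rank"
      by auto
    then show "k \<in> cspan {rank_one ract ip x y | x y. True}"
    proof induction
      case (step k u x y)
      then show ?case
        by (intro complex_vector.span_add[OF complex_vector.span_base]) auto
    qed (rule complex_vector.span_zero)
  qed
  have "csubspace (fst ` finite_rank)"
  proof (rule csubspaceI)
    show "0 \<in> fst ` finite_rank"
      using finite_rank.zero by force
    show "x + y \<in> fst ` finite_rank" if "x \<in> fst ` finite_rank" "y \<in> fst ` finite_rank" for x y
      using that finite_rank_add by force
    show "c *\<^sub>C x \<in> fst ` finite_rank" if "x \<in> fst ` finite_rank" for c x
      using that finite_rank_scaleC by force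
  qed
  then show "cspan {rank_one ract ip x y | x y. True} \<subseteq> fst ` finite_rank"
    using finite_rank_rank_one by (intro complex_vector.span_minimal) force+
qed

lemma compacts_eq: "compacts ract ip = closure (fst ` finite_rank)"
  by (simp add: compacts_def fst_finite_rank)

lemma compact_graph_add:
  "(k, u) \<in> compact_graph \<Longrightarrow> (l, v) \<in> compact_graph \<Longrightarrow> (k + l, u + v) \<in> compact_graph"
  unfolding compact_graph_def by (rule closure_graph_add[OF finite_rank_add])

lemma compact_graph_scaleC: "(k, u) \<in> compact_graph \<Longrightarrow> (c *\<^sub>C k, c *\<^sub>C u) \<in> compact_graph"
  unfolding compact_graph_def by (rule closure_graph_scaleC[OF finite_rank_scaleC])

lemma compact_graph_diff:
  assumes "(k, u) \<in> compact_graph" "(l, v) \<in> compact_graph"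
  shows "(k - l, u - v) \<in> compact_graph"
  using compact_graph_add[OF assms(1) compact_graph_scaleC[OF assms(2), of "-1"]]
  by (simp add: scaleC_minus_one)

lemma compact_graph_bound: "(k, u) \<in> compact_graph \<Longrightarrow> norm u \<le> 2 * norm k"
  unfolding compact_graph_def by (rule closure_graph_bound[OF finite_rank_bound])

lemma compact_graph_unique: "(k, u) \<in> compact_graph \<Longrightarrow> (k, v) \<in> compact_graph \<Longrightarrow> u = v"
  using compact_graph_bound[OF compact_graph_diff, of k u k v] by simp

lemma compact_graph_total: "k \<in> compacts ract ip \<Longrightarrow> \<exists>u. (k, u) \<in> compact_graph"
  unfolding compact_graph_def compacts_eq
  using closure_graph_total[OF finite_rank_bound finite_rank_diff] by blast

lemma compact_graph_fst: "(k, u) \<in> compact_graph \<Longrightarrow> k \<in> compacts ract ip"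
  unfolding compact_graph_def compacts_eq
proof (erule closure_pairE)
  fix s t
  assume "\<And>n::nat. (s n, t n) \<in> finite_rank" "s \<longlonglongrightarrow> k"
  then show "k \<in> closure (fst ` finite_rank)"
    unfolding closure_sequential by (intro exI[of _ s]) force
qed

lemma compact_graph_apply:
  assumes "(k, u) \<in> compact_graph"
  shows "u * \<psi> z = \<psi> (blinfun_apply k z)"
  using assms unfolding compact_graph_def
proof (rule closure_pairE)
  fix s t
  assume st: "\<And>n::nat. (s n, t n) \<in> finite_rank" "s \<longlonglongrightarrow> k" "t \<longlonglongrightarrow> u"
  have "(\<lambda>n. t n * \<psi> z) \<longlonglongrightarrow> u * \<psi> z"
    by (intro tendsto_intros st)
  moreover have "(\<lambda>n. \<psi> (blinfun_apply (s n) z)) \<longlonglongrightarrow> \<psi> (blinfun_apply k z)"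
    by (intro bounded_linear.tendsto[OF psi_facts(2)] tendsto_intros st)
  ultimately show ?thesis
    using finite_rank_apply(1)[OF st(1)] LIMSEQ_unique by simp
qed

lemma compact_graph_mult:
  assumes "(k, u) \<in> compact_graph" "(l, v) \<in> compact_graph"
  shows "(k o\<^sub>L l, u * v) \<in> compact_graph"
proof -
  obtain s t where s: "\<And>n. (s n, t n) \<in> finite_rank" "s \<longlonglongrightarrow> k" "t \<longlonglongrightarrow> u"
    using assms(1) unfolding compact_graph_def by (rule closure_pairE) metis
  obtain s' t' where s': "\<And>n. (s' n, t' n) \<in> finite_rank" "s' \<longlonglongrightarrow> l" "t' \<longlonglongrightarrow> v"
    using assms(2) unfolding compact_graph_def by (rule closure_pairE) metis
  show ?thesis
    unfolding compact_graph_def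
  proof (rule closure_pairI[of "\<lambda>n. s n o\<^sub>L s' n" "\<lambda>n. t n * t' n"])
    show "(s n o\<^sub>L s' n, t n * t' n) \<in> finite_rank" for n
      by (rule finite_rank_mult[OF s'(1) finite_rank_apply[OF s(1)]])
    show "(\<lambda>n. s n o\<^sub>L s' n) \<longlonglongrightarrow> (k o\<^sub>L l)"
      by (rule bounded_bilinear.tendsto[OF bounded_bilinear_blinfun_compose s(2) s'(2)])
    show "(\<lambda>n. t n * t' n) \<longlonglongrightarrow> u * v"
      by (intro tendsto_mult s s')
  qed
qed

lemma compact_graph_adjoint:
  assumes "(k, u) \<in> compact_graph"
  obtains l where "is_adjoint ip k l" "(l, star u) \<in> compact_graph"
proof -
  obtain s t where s: "\<And>n. (s n, t n) \<in> finite_rank" "s \<longlonglongrightarrow> k" "t \<longlonglongrightarrow> u"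
    using assms(1) unfolding compact_graph_def by (rule closure_pairE) metis
  obtain r where r: "\<And>n. is_adjoint ip (s n) (r n)" "\<And>n. (r n, star (t n)) \<in> finite_rank"
    using finite_rank_adjoint[OF s(1)] by metis
  have "Cauchy r"
    using LIMSEQ_imp_Cauchy[OF s(2)] norm_adjoint_le[OF is_adjoint_diff[OF r(1) r(1)]]
    by (rule Cauchy_of_bound)
  then obtain l where l: "r \<longlonglongrightarrow> l"
    by (auto simp: Cauchy_convergent_iff convergent_def)
  have "(l, star u) \<in> compact_graph"
    unfolding compact_graph_def by (rule closure_pairI[OF r(2) l tendsto_star[OF s(3)]])
  then show ?thesis
    using that is_adjoint_limit[OF r(1) s(2) l] by blast
qed

text \<open>It makes the choice in \<open>induced_hom\<close> meaningful: the function read off from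
  \<open>compact_graph\<close> qualifies.\<close>

lemma compacts_hom_exists:
  "\<exists>h. compacts_hom ract ip h \<and> (\<forall>x y. h (rank_one ract ip x y) = \<psi> x * star (\<psi> y))"
proof -
  define h where "h k = (THE u. (k, u) \<in> compact_graph)" for k
  have hI: "h k = u" if "(k, u) \<in> compact_graph" for k u
    unfolding h_def using that compact_graph_unique by blast
  have hG: "(k, h k) \<in> compact_graph" if "k \<in> compacts ract ip" for k
    using compact_graph_total[OF that] hI by blast
  have "h l = star (h k)" if "k \<in> compacts ract ip" "is_adjoint ip k l" for k l
    using compact_graph_adjoint[OF hG[OF that(1)]] is_adjoint_unique[OF that(2)] hI by metis
  moreover have "h (rank_one ract ip x y) = \<psi> x * star (\<psi> y)" for x y
    using finite_rank_rank_one finite_rank_subset hI by blast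
  ultimately show ?thesis
    unfolding compacts_hom_def
    using hI[OF compact_graph_add[OF hG hG]] hI[OF compact_graph_scaleC[OF hG]]
      hI[OF compact_graph_mult[OF hG hG]]
    by (intro exI[of _ h]) blast
qed

lemma compacts_ops:
  assumes "k \<in> compacts ract ip" "l \<in> compacts ract ip"
  shows "k + l \<in> compacts ract ip" "k - l \<in> compacts ract ip" "k o\<^sub>L l \<in> compacts ract ip"
    "c *\<^sub>C k \<in> compacts ract ip"
proof -
  obtain u v where uv: "(k, u) \<in> compact_graph" "(l, v) \<in> compact_graph"
    using compact_graph_total assms by blast
  show "k + l \<in> compacts ract ip" "k - l \<in> compacts ract ip" "k o\<^sub>L l \<in> compacts ract ip"
    "c *\<^sub>C k \<in> compacts ract ip"
    using compact_graph_fst[OF compact_graph_add[OF uv]] compact_graph_fst[OF compact_graph_diff[OF uv]]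
      compact_graph_fst[OF compact_graph_mult[OF uv]] compact_graph_fst[OF compact_graph_scaleC[OF uv(1)]]
    by simp_all
qed

text \<open>Continuity is not part of \<open>compacts_hom\<close> and has to be derived. The
  argument is that of \<open>star_hom_contractive\<close>, but h is controlled on compact operators
  only, so the quasi-inverses of K are found as fixed points inside this complete set.\<close>

lemma compacts_hom_selfadjoint_bound:
  fixes h :: "('m \<Rightarrow>\<^sub>L 'm) \<Rightarrow> 'b"
  assumes h: "compacts_hom ract ip h" and k: "k \<in> compacts ract ip" "is_adjoint ip k k"
  shows "norm (h k) \<le> norm k"
proof (rule ccontr)
  have hh: "h (x + y) = h x + h y" "h (x o\<^sub>L y) = h x * h y" "h (c *\<^sub>C x) = c *\<^sub>C h x"
    if "x \<in> compacts ract ip" "y \<in> compacts ract ip" for x y c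
    using h that by (simp_all add: compacts_hom_def)
  assume "\<not> norm (h k) \<le> norm k"
  then have lt: "norm k < norm (h k)"
    by simp
  define s where "s = norm (h k)"
  have s: "s > 0"
    using lt norm_ge_zero[of k] unfolding s_def by linarith
  have "star (h k) = h k"
    using h k unfolding compacts_hom_def by metis
  then have "star ((1 / s) *\<^sub>R h k) = (1 / s) *\<^sub>R h k"
    by (simp add: star_scaleR)
  moreover have "norm ((1 / s) *\<^sub>R h k) = 1"
    using s by (simp add: s_def)
  ultimately obtain l where l: "cmod l \<le> 1" "\<not> inv_elt (1 - l *\<^sub>C ((1 / s) *\<^sub>R h k))"
    by (rule unit_norm_singular)
  define c where "c = l * of_real (1 / s)"
  define K where "K = c *\<^sub>C k"
  have "norm K = cmod l * (norm k / s)"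
    using s by (simp add: K_def c_def norm_scaleC norm_mult norm_divide)
  also have "\<dots> \<le> 1 * (norm k / s)"
    using l s by (intro mult_right_mono) auto
  also have "\<dots> < 1"
    using lt s by (simp add: s_def)
  finally have K1: "norm K < 1" .
  have Kc: "K \<in> compacts ract ip"
    using compacts_ops(4)[OF k(1) k(1)] by (simp add: K_def)
  have cpl: "complete (compacts ract ip)" "compacts ract ip \<noteq> {}"
    using Kc by (auto simp: compacts_def complete_eq_closed)
  have "\<exists>!z\<in>compacts ract ip. K + (K o\<^sub>L z) = z"
  proof (rule Banach_fix[OF cpl norm_ge_zero K1])
    show "(\<lambda>z. K + (K o\<^sub>L z)) ` compacts ract ip \<subseteq> compacts ract ip"
      using compacts_ops Kc by blast
    fix x y
    have "K + (K o\<^sub>L x) - (K + (K o\<^sub>L y)) = K o\<^sub>L (x - y)"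
      by (rule blinfun_eqI) (simp add: blinfun.add_left blinfun.diff_left blinfun.diff_right)
    then show "dist (K + (K o\<^sub>L x)) (K + (K o\<^sub>L y)) \<le> norm K * dist x y"
      by (simp add: dist_norm norm_blinfun_compose)
  qed
  then obtain z where z: "z \<in> compacts ract ip" "K + (K o\<^sub>L z) = z"
    by blast
  have "\<exists>!w\<in>compacts ract ip. K + (w o\<^sub>L K) = w"
  proof (rule Banach_fix[OF cpl norm_ge_zero K1])
    show "(\<lambda>w. K + (w o\<^sub>L K)) ` compacts ract ip \<subseteq> compacts ract ip"
      using compacts_ops Kc by blast
    fix x y
    have "K + (x o\<^sub>L K) - (K + (y o\<^sub>L K)) = (x - y) o\<^sub>L K"
      by (rule blinfun_eqI) (simp add: blinfun.add_left blinfun.diff_left blinfun.diff_right)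
    then show "dist (K + (x o\<^sub>L K)) (K + (y o\<^sub>L K)) \<le> norm K * dist x y"
      using norm_blinfun_compose[of "x - y" K] by (simp add: dist_norm mult.commute)
  qed
  then obtain w where w: "w \<in> compacts ract ip" "K + (w o\<^sub>L K) = w"
    by blast
  have "h K + h K * h z = h z" "h K + h w * h K = h w"
    using z w Kc compacts_ops(3) by (simp_all flip: hh)
  then have "(1 - h K) * (1 + h z) = 1" "(1 + h w) * (1 - h K) = 1"
    by (simp_all add: algebra_simps)
  then have "inv_elt (1 - h K)"
    by (rule inv_elt_leftright)
  moreover have "h K = l *\<^sub>C ((1 / s) *\<^sub>R h k)"
    using hh(3)[OF k(1) k(1)] by (simp add: K_def c_def scaleR_scaleC scaleC_scaleC)
  ultimately show False
    using l by simp
qed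

lemma compacts_hom_bound:
  fixes h :: "('m \<Rightarrow>\<^sub>L 'm) \<Rightarrow> 'b"
  assumes h: "compacts_hom ract ip h" and k: "k \<in> compacts ract ip"
  shows "norm (h k) \<le> 2 * norm k"
proof -
  obtain u where "(k, u) \<in> compact_graph"
    using compact_graph_total[OF k] by blast
  then obtain l where l: "is_adjoint ip k l" "l \<in> compacts ract ip"
    using compact_graph_adjoint compact_graph_fst by metis
  have "h (l o\<^sub>L k) = star (h k) * h k"
    using h k l unfolding compacts_hom_def by metis
  then have "(norm (h k))\<^sup>2 = norm (h (l o\<^sub>L k))"
    by (simp add: cstar_identity)
  also have "\<dots> \<le> norm (l o\<^sub>L k)"
    using is_adjoint_compose[OF is_adjoint_sym[OF l(1)] l(1)]
    by (intro compacts_hom_selfadjoint_bound[OF h] compacts_ops(3) l k) simp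
  also have "\<dots> \<le> norm l * norm k"
    by (rule norm_blinfun_compose)
  also have "\<dots> \<le> 4 * norm k * norm k"
    by (intro mult_right_mono norm_adjoint_le l) simp
  finally have "(norm (h k))\<^sup>2 \<le> (2 * norm k)\<^sup>2"
    by (simp add: power2_eq_square)
  then show ?thesis
    by (rule power2_le_imp_le) simp
qed

text \<open>Being bounded, h is determined by its values on rank-one operators; so the outcome of
  the choice in \<open>induced_hom\<close> is unique on the compact operators.\<close>

lemma compacts_hom_determined:
  fixes h :: "('m \<Rightarrow>\<^sub>L 'm) \<Rightarrow> 'b"
  assumes h: "compacts_hom ract ip h" "\<And>x y. h (rank_one ract ip x y) = \<psi> x * star (\<psi> y)"
    and k: "(k, u) \<in> compact_graph"
  shows "h k = u"
proof -
  have add: "h (x + y) = h x + h y" if "x \<in> compacts ract ip" "y \<in> compacts ract ip" for x y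
    using h(1) that by (simp add: compacts_hom_def)
  have fin: "h k = u" if "(k, u) \<in> finite_rank" for k u
    using that
  proof induction
    case zero
    have "0 \<in> compacts ract ip"
      using compact_graph_fst finite_rank.zero finite_rank_subset by blast
    then show ?case
      using add[of 0 0] by simp
  next
    case (step k u x y)
    have "rank_one ract ip x y \<in> compacts ract ip" "k \<in> compacts ract ip"
      using compact_graph_fst finite_rank_rank_one step(1) finite_rank_subset by blast+
    then show ?case
      using add step h(2) by simp
  qed
  obtain s t where s: "\<And>n. (s n, t n) \<in> finite_rank" "s \<longlonglongrightarrow> k" "t \<longlonglongrightarrow> u"
    using k unfolding compact_graph_def by (rule closure_pairE) metis
  have kc: "k \<in> compacts ract ip" "s n \<in> compacts ract ip" for n
    using compact_graph_fst k s(1) finite_rank_subset by blast+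
  have "norm (h k - t n) \<le> 2 * norm (k - s n)" for n
  proof -
    have "h k = h (k - s n) + h (s n)"
      using add[OF compacts_ops(2)[OF kc(1) kc(2)] kc(2), of n n] by simp
    then show ?thesis
      using compacts_hom_bound[OF h(1) compacts_ops(2)[OF kc]] fin[OF s(1)] by simp
  qed
  moreover have "(\<lambda>n. 2 * norm (k - s n)) \<longlonglongrightarrow> 2 * norm (k - k)"
    by (intro tendsto_intros s)
  moreover have "(\<lambda>n. norm (h k - t n)) \<longlonglongrightarrow> norm (h k - u)"
    by (intro tendsto_intros s)
  ultimately have "norm (h k - u) \<le> 2 * norm (k - k)"
    by (intro LIMSEQ_le[of "\<lambda>n. norm (h k - t n)"]) blast+
  then show ?thesis
    by simp
qed

lemma induced_hom_graph: "(k, u) \<in> compact_graph \<Longrightarrow> induced_hom ract ip \<psi> k = u"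
  using someI_ex[OF compacts_hom_exists] compacts_hom_determined
  unfolding induced_hom_def by blast

section \<open>The subalgebra B1 as a copy of the compact operators\<close>

lemma closed_csubspace_B1: "closed_csubspace (B1 \<rho> V)"
  unfolding B1_def by (rule closed_csubspace_closure_cspan)

lemma B1_base: "\<rho> a * V * star V * \<rho> b \<in> B1 \<rho> V"
  unfolding B1_def by (rule closure_cspan_base) blast

lemma psi_star_psi_B1: "\<psi> x * star (\<psi> y) \<in> B1 \<rho> V"
proof -
  have dense: "f x \<in> B1 \<rho> V" if "continuous_on UNIV f" "\<And>a. f (q a) \<in> B1 \<rho> V" for f x
  proof -
    have "closed (f -` B1 \<rho> V)"
      using closed_csubspace_B1 that(1) by (auto simp: closed_csubspace_def intro: closed_vimage)
    then have "closure (range q) \<subseteq> f -` B1 \<rho> V"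
      using that(2) by (intro closure_minimal) auto
    then show ?thesis
      using q_facts(2) by auto
  qed
  have 1: "\<psi> (q a) * star (\<psi> (q b)) \<in> B1 \<rho> V" for a b
    using B1_base[of a "star b"] by (simp add: psi_facts star_mult rho_hom mult.assoc)
  have 2: "\<psi> (q a) * star (\<psi> y) \<in> B1 \<rho> V" for a
    using continuous_on_mult[OF continuous_on_const continuous_on_star[OF continuous_psi]] 1
    by (rule dense[where f = "\<lambda>y. \<psi> (q a) * star (\<psi> y)"])
  show ?thesis
    using continuous_on_mult[OF continuous_psi continuous_on_const] 2
    by (rule dense[where f = "\<lambda>x. \<psi> x * star (\<psi> y)"])
qed

lemma compact_graph_B1:
  assumes "(k, u) \<in> compact_graph"
  shows "u \<in> B1 \<rho> V"
proof -
  have sub: "closed (B1 \<rho> V)" "csubspace (B1 \<rho> V)"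
    using closed_csubspace_B1 by (auto simp: closed_csubspace_def)
  have fin: "u \<in> B1 \<rho> V" if "(k, u) \<in> finite_rank" for k u
    using that by induction (auto intro: csubspaceD[OF sub(2)] psi_star_psi_B1)
  obtain s t where "\<And>n. (s n, t n) \<in> finite_rank" "t \<longlonglongrightarrow> u"
    using assms unfolding compact_graph_def by (rule closure_pairE) metis
  then show ?thesis
    using closed_sequentially[OF sub(1)] fin by blast
qed

lemma induced_hom_B1: "k \<in> compacts ract ip \<Longrightarrow> induced_hom ract ip \<psi> k \<in> B1 \<rho> V"
  using compact_graph_total induced_hom_graph compact_graph_B1 by blast

text \<open>An isometric \<rho> makes \<psi> isometric, so that k is bounded by u as well as u by k.
  The second components of the graph then form a closed subspace, and it contains the generators of
  B1.\<close>

lemma B1_compact_graph: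
  assumes iso: "\<And>a. norm (\<rho> a) = norm a" and b: "b \<in> B1 \<rho> V"
  shows "\<exists>k. (k, b) \<in> compact_graph"
proof -
  have lower: "norm k \<le> 1 * norm u" if "(k, u) \<in> compact_graph" for k u
  proof -
    have "norm (blinfun_apply k z) \<le> norm u * norm z" for z
    proof -
      have "norm (blinfun_apply k z) = norm (u * \<psi> z)"
        by (simp add: compact_graph_apply[OF that] norm_psi_eq[OF iso])
      also have "\<dots> \<le> norm u * norm (\<psi> z)"
        by (rule norm_mult_ineq)
      finally show ?thesis
        by (simp add: norm_psi_eq[OF iso])
    qed
    then show ?thesis
      by (simp add: norm_blinfun_bound)
  qed
  define U where "U = {b. \<exists>k. (k, b) \<in> compact_graph}"
  have "csubspace U"
  proof (rule csubspaceI)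
    show "0 \<in> U"
      using finite_rank.zero finite_rank_subset by (auto simp: U_def)
    show "x + y \<in> U" if "x \<in> U" "y \<in> U" for x y
      using that compact_graph_add unfolding U_def by blast
    show "c *\<^sub>C x \<in> U" if "x \<in> U" for c x
      using that compact_graph_scaleC unfolding U_def by blast
  qed
  moreover have "closed U"
    unfolding closed_sequential_limits
  proof (intro allI impI, elim conjE)
    fix t u
    assume "\<forall>n. t n \<in> U" and t: "t \<longlonglongrightarrow> u"
    then obtain s where s: "\<And>n. (s n, t n) \<in> compact_graph"
      unfolding U_def mem_Collect_eq by metis
    have "Cauchy s"
      using LIMSEQ_imp_Cauchy[OF t] lower[OF compact_graph_diff[OF s s]] by (rule Cauchy_of_bound)
    then obtain k where "s \<longlonglongrightarrow> k"
      by (auto simp: Cauchy_convergent_iff convergent_def)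
    then have "(k, u) \<in> closure compact_graph"
      using closure_pairI[OF s _ t] by blast
    then show "u \<in> U"
      by (auto simp: U_def compact_graph_def)
  qed
  ultimately have "closed_csubspace U"
    by (simp add: closed_csubspace_def)
  moreover have "\<rho> a * V * star V * \<rho> b \<in> U" for a b
  proof -
    have "\<rho> a * V * star V * \<rho> b = \<psi> (q a) * star (\<psi> (q (star b)))"
      by (simp add: psi_facts star_mult rho_hom star_star mult.assoc)
    moreover have "(rank_one ract ip (q a) (q (star b)), \<psi> (q a) * star (\<psi> (q (star b)))) \<in> compact_graph"
      using finite_rank_rank_one finite_rank_subset by blast
    ultimately show ?thesis
      unfolding U_def by auto
  qed
  ultimately show ?thesis
    using closure_cspan_minimal[of U "{\<rho> a * V * star V * \<rho> b | a b. True}"] b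
    by (auto simp: B1_def U_def)
qed

text \<open>Let k be the compact operator that corresponds to \<rho>(a). Multiplication by \<rho>(a)
  on the image of \<psi> is implemented both by k and by \<phi>(a); as \<psi> is injective, they
  coincide.\<close>

lemma B1_imp_ideal_J:
  assumes iso: "\<And>a. norm (\<rho> a) = norm a" and a: "\<rho> a \<in> B1 \<rho> V"
  shows "a \<in> ideal_J ract ip \<phi>" "\<rho> a = induced_hom ract ip \<psi> (\<phi> a)"
proof -
  obtain k where k: "(k, \<rho> a) \<in> compact_graph"
    using B1_compact_graph[OF assms] by blast
  have "\<phi> a = k"
  proof (rule blinfun_eqI)
    fix z
    have "\<psi> (blinfun_apply (\<phi> a) z - blinfun_apply k z) = 0"
      using compact_graph_apply[OF k, of z] by (simp add: clinear_diff[OF psi_facts(1)] psi_phi)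
    then show "blinfun_apply (\<phi> a) z = blinfun_apply k z"
      using norm_psi_eq[OF iso, of "blinfun_apply (\<phi> a) z - blinfun_apply k z"] by simp
  qed
  then show "a \<in> ideal_J ract ip \<phi>" "\<rho> a = induced_hom ract ip \<psi> (\<phi> a)"
    using compact_graph_fst[OF k] induced_hom_graph[OF k] by (simp_all add: ideal_J_def)
qed

end

section \<open>The core of a Toeplitz-covariant representation\<close>

text \<open>Since (1 + s)(1 - s) is at most 1, Bernoulli's inequality for (1 + s)^N bounds (1 + N
  s)(1 - s)^N by 1. The estimate gives the rate of the approximate unit in
  \<open>approximate_unit_single\<close>.\<close>

lemma mult_power_decay:
  fixes s :: real
  assumes "0 \<le> s" "s \<le> 1" "N > 0"
  shows "s * (1 - s) ^ N \<le> 1 / real N"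
proof -
  have "(1 + real N * s) * (1 - s) ^ N \<le> (1 + s) ^ N * (1 - s) ^ N"
    using assms Bernoulli_inequality[of s N] by (intro mult_right_mono) auto
  also have "\<dots> = (1 - s * s) ^ N"
    by (simp add: power_mult_distrib[symmetric] algebra_simps)
  also have "\<dots> \<le> 1"
    using assms by (intro power_le_one) (auto simp: mult_le_one)
  finally have "(1 - s) ^ N + real N * (s * (1 - s) ^ N) \<le> 1"
    by (simp add: algebra_simps)
  then have "real N * (s * (1 - s) ^ N) \<le> 1"
    using assms zero_le_power[of "1 - s" N] by linarith
  then show ?thesis
    using assms by (simp add: field_simps)
qed

text \<open>The element \<open>a - c\<close> is a cut-off of \<open>a\<close> at level \<open>e\<close>; modulo \<open>I\<close> its image is the same cut-off of
  \<open>h a + k\<close>, which is \<open>h a + k\<close> itself.\<close>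

lemma approx_preimage_of_ideal:
  fixes h :: "'a::cstar_algebra \<Rightarrow> 'b::cstar_algebra"
  assumes h: "star_hom h" and I: "closed_csubspace I"
    and I1: "\<And>a x. x \<in> I \<Longrightarrow> h a * x \<in> I" and I2: "\<And>a x. x \<in> I \<Longrightarrow> x * h a \<in> I"
    and I3: "\<And>x y. x \<in> I \<Longrightarrow> y \<in> I \<Longrightarrow> x * y \<in> I"
    and a: "star a = a" and k: "k \<in> I" "star k = k" and e: "norm (h a + k) \<le> e"
  obtains c where "norm (a - c) \<le> e" "h c \<in> I"
proof -
  have sub: "closed I" "csubspace I"
    using I by (auto simp: closed_csubspace_def)
  note subD = csubspaceD[OF sub(2)]
  \<comment> \<open>One interval for both a and y, so that one sequence of polynomials cuts off both
    at level e.\<close>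
  define R where "R = max (norm a) e"
  define y where "y = h a + k"
  have e0: "0 \<le> e"
    using e norm_ge_zero[of "h a + k"] by linarith
  have y: "star y = y" "norm y \<le> R" "norm y \<le> e"
    using star_homD(3)[OF h, of a] a k e by (auto simp: y_def star_add R_def)
  obtain P where P: "\<And>n. real_coeffs (P n)"
    "\<And>n t. \<bar>t\<bar> \<le> R \<Longrightarrow>
      cmod (of_real t * poly (P n) (of_real t) - of_real (clip e t)) < 1 / real (Suc n)"
    using clip_sequence[OF e0, of R] by metis
  have "norm a \<le> R"
    by (simp add: R_def)
  then obtain a1 where a1: "(\<lambda>n. a * peval (P n) a) \<longlonglongrightarrow> a1" "norm a1 \<le> e"
    using clip_limit[OF a _ e0 P] by blast
  have ylim: "(\<lambda>n. y * peval (P n) y) \<longlonglongrightarrow> y"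
    by (rule clip_limit[OF y(1,2) e0 P]) (use y(3) in auto)
  \<comment> \<open>The polynomials have no constant term and y - h(a) = k lies in I, so I has to
    absorb only itself and the image of h.\<close>
  have diff: "y * peval p y - h (a * peval p a) \<in> I" for p
  proof (induction p)
    case 0
    then show ?case
      using subD(1) clinear_0[OF star_homD(1)[OF h]] by simp
  next
    case (pCons c p)
    define d where "d = y * peval p y - h (a * peval p a)"
    have d: "d \<in> I" "y * peval p y = d + h (a * peval p a)"
      using pCons by (simp_all add: d_def)
    have "y * peval (pCons c p) y = c *\<^sub>C y + y * (y * peval p y)"
      by (simp add: distrib_left mult_scaleC_right)
    moreover have "a * peval (pCons c p) a = c *\<^sub>C a + a * (a * peval p a)"
      by (simp add: distrib_left mult_scaleC_right)
    ultimately have "y * peval (pCons c p) y - h (a * peval (pCons c p) a) =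
        c *\<^sub>C k + (k * d + k * h (a * peval p a) + h a * d)"
      unfolding d(2) by (simp only: clinear_add[OF star_homD(1)[OF h]]
          clinear_scaleC[OF star_homD(1)[OF h]] star_homD(2)[OF h])
        (simp add: y_def algebra_simps scaleC_add_right)
    then show ?case
      using d k by (simp add: subD I1 I2 I3)
  qed
  have "(\<lambda>n. h (a * peval (P n) a)) \<longlonglongrightarrow> h a1"
    by (rule bounded_linear.tendsto[OF star_hom_bounded_linear[OF h] a1(1)])
  then have lim: "(\<lambda>n. y * peval (P n) y - h (a * peval (P n) a)) \<longlonglongrightarrow> y - h a1"
    by (rule tendsto_diff[OF ylim])
  have "y - h a1 \<in> I"
    by (rule closed_sequentially[OF sub(1) diff lim])
  then have "(y - h a1) - k \<in> I"
    using k subD by blast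
  moreover have "(y - h a1) - k = h (a - a1)"
    by (simp add: y_def clinear_diff[OF star_homD(1)[OF h]])
  ultimately have "h (a - a1) \<in> I"
    by simp
  then show ?thesis
    using that[of "a - a1"] a1(2) by simp
qed

section \<open>Monomials in T, the core and approximate units of B1\<close>

locale toeplitz_rep =
  fixes \<alpha> L :: "'a::cstar_algebra \<Rightarrow> 'a" and \<pi> :: "'a \<Rightarrow> 'c::cstar_algebra" and T :: 'c
  assumes toeplitz_cov: "toeplitz_covariant \<alpha> L \<pi> T"
begin

lemma pi_facts:
  "star_hom \<pi>" "\<pi> 1 = 1" "T * \<pi> a = \<pi> (\<alpha> a) * T" "star T * \<pi> a * T = \<pi> (L a)"
  using toeplitz_cov by (auto simp: toeplitz_covariant_def)

lemmas pi_hom = star_homD[OF pi_facts(1)]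

lemma T_power: "T ^ m * \<pi> a = \<pi> ((\<alpha> ^^ m) a) * T ^ m"
proof (induction m arbitrary: a)
  case (Suc m)
  have "T ^ Suc m * \<pi> a = T ^ m * \<pi> (\<alpha> a) * T"
    by (simp add: power_Suc2 pi_facts(3) mult.assoc del: power_Suc)
  also have "\<dots> = \<pi> ((\<alpha> ^^ m) (\<alpha> a)) * T ^ Suc m"
    by (simp add: Suc power_Suc2 mult.assoc del: power_Suc)
  finally show ?case
    by (simp add: funpow_swap1)
qed simp

text \<open>The adjoint of \<open>T_power\<close>; for an endomorphism \<alpha> the argument of
  \<pi> on the right is \<open>(\<alpha> ^^ m) a\<close>.\<close>

lemma star_T_power: "\<pi> a * star T ^ m = star T ^ m * \<pi> (star ((\<alpha> ^^ m) (star a)))"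
proof -
  have "\<pi> a * star T ^ m = star (T ^ m * \<pi> (star a))"
    by (simp add: star_mult pi_hom star_power star_star)
  also have "\<dots> = star T ^ m * \<pi> (star ((\<alpha> ^^ m) (star a)))"
    by (simp only: T_power) (simp only: star_mult pi_hom(3) star_power)
  finally show ?thesis .
qed

lemma star_T_T_power: "star T ^ m * \<pi> a * T ^ m = \<pi> ((L ^^ m) a)"
proof (induction m arbitrary: a)
  case (Suc m)
  have "star T ^ Suc m * \<pi> a * T ^ Suc m = star T ^ m * (star T * \<pi> a * T) * T ^ m"
    by (simp add: power_Suc2[of "star T"] mult.assoc del: power_Suc) (simp add: mult.assoc)
  also have "\<dots> = \<pi> ((L ^^ m) (L a))"
    by (simp only: pi_facts(4) Suc)
  finally show ?case
    by (simp add: funpow_swap1)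
qed simp

definition mon :: "'a \<Rightarrow> nat \<Rightarrow> nat \<Rightarrow> 'a \<Rightarrow> 'c" where
  "mon a m n b = \<pi> a * T ^ m * star T ^ n * \<pi> b"

lemma star_mon: "star (mon a m n b) = mon (star b) n m (star a)"
  by (simp add: mon_def star_mult star_power pi_hom star_star mult.assoc)

text \<open>The inner powers of T collapse through L, and the resulting coefficient moves left past
  T ^ m through \<alpha>. So monomials are closed under multiplication, and the difference of their
  exponents is additive.\<close>

lemma mon_mult_le:
  assumes "n \<le> p"
  shows "mon a m n b * mon c p r d = mon (a * (\<alpha> ^^ m) ((L ^^ n) (b * c))) (m + (p - n)) r d"
proof -
  have "T ^ p = T ^ n * T ^ (p - n)"
    using assms by (simp flip: power_add)
  then have "mon a m n b * mon c p r d =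
      \<pi> a * T ^ m * (star T ^ n * \<pi> (b * c) * T ^ n) * T ^ (p - n) * star T ^ r * \<pi> d"
    by (simp add: mon_def pi_hom mult.assoc)
  also have "\<dots> = \<pi> a * (T ^ m * \<pi> ((L ^^ n) (b * c))) * T ^ (p - n) * star T ^ r * \<pi> d"
    by (simp only: star_T_T_power) (simp only: mult.assoc)
  also have "\<dots> = mon (a * (\<alpha> ^^ m) ((L ^^ n) (b * c))) (m + (p - n)) r d"
    by (simp only: T_power) (simp add: mon_def pi_hom mult.assoc power_add)
  finally show ?thesis .
qed

lemma mon_mult_ge:
  assumes "p \<le> n"
  shows "mon a m n b * mon c p r d =
    mon a m (r + (n - p)) (star ((\<alpha> ^^ r) (star ((L ^^ p) (b * c)))) * d)"
proof -
  have "star T ^ n = star T ^ (n - p) * star T ^ p"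
    using assms by (simp flip: power_add)
  then have "mon a m n b * mon c p r d =
      \<pi> a * T ^ m * star T ^ (n - p) * (star T ^ p * \<pi> (b * c) * T ^ p) * star T ^ r * \<pi> d"
    by (simp add: mon_def pi_hom mult.assoc)
  also have "\<dots> = \<pi> a * T ^ m * star T ^ (n - p) * (\<pi> ((L ^^ p) (b * c)) * star T ^ r) * \<pi> d"
    by (simp only: star_T_T_power) (simp only: mult.assoc)
  also have "\<dots> = \<pi> a * T ^ m * (star T ^ (n - p) * star T ^ r) *
      (\<pi> (star ((\<alpha> ^^ r) (star ((L ^^ p) (b * c))))) * \<pi> d)"
    by (simp only: star_T_power) (simp only: mult.assoc)
  also have "star T ^ (n - p) * star T ^ r = star T ^ (r + (n - p))"
    by (simp add: add.commute flip: power_add)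
  also have "\<pi> a * T ^ m * star T ^ (r + (n - p)) *
      (\<pi> (star ((\<alpha> ^^ r) (star ((L ^^ p) (b * c))))) * \<pi> d) =
      mon a m (r + (n - p)) (star ((\<alpha> ^^ r) (star ((L ^^ p) (b * c)))) * d)"
    by (simp add: mon_def pi_hom mult.assoc)
  finally show ?thesis .
qed

definition D :: "nat \<Rightarrow> 'c set" where
  "D n = closure (cspan {mon a k k b | a k b. k \<le> n})"

lemma closed_csubspace_D: "closed_csubspace (D n)"
  unfolding D_def by (rule closed_csubspace_closure_cspan)

lemma mon_in_D: "k \<le> n \<Longrightarrow> mon a k k b \<in> D n"
  unfolding D_def by (rule closure_cspan_base) blast

lemma D_mult: "x \<in> D n \<Longrightarrow> y \<in> D n \<Longrightarrow> x * y \<in> D n"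
  unfolding D_def[of n]
proof (erule (1) closure_cspan_mult)
  fix s s'
  assume "s \<in> {mon a k k b | a k b. k \<le> n}" "s' \<in> {mon a k k b | a k b. k \<le> n}"
  then obtain a b k c d l where s: "s = mon a k k b" "s' = mon c l l d" "k \<le> n" "l \<le> n"
    by blast
  have "s * s' \<in> D n"
    by (cases "k \<le> l") (simp_all add: s mon_mult_le mon_mult_ge mon_in_D)
  then show "s * s' \<in> closure (cspan {mon a k k b | a k b. k \<le> n})"
    by (simp add: D_def)
qed (rule closed_csubspace_closure_cspan)

lemma D_star: "x \<in> D n \<Longrightarrow> star x \<in> D n"
  unfolding D_def[of n]
proof (erule closure_cspan_star)
  fix s
  assume "s \<in> {mon a k k b | a k b. k \<le> n}"
  then have "star s \<in> D n"
    by (auto simp: star_mon mon_in_D)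
  then show "star s \<in> closure (cspan {mon a k k b | a k b. k \<le> n})"
    by (simp add: D_def)
qed (rule closed_csubspace_closure_cspan)

lemma D_subalgebra: "closed_star_subalgebra (D n)"
  using closed_csubspace_D[of n] D_mult D_star
  by (auto simp: closed_star_subalgebra_def closed_csubspace_def)

lemma B1_mon: "B1 \<pi> T = closure (cspan {mon a 1 1 b | a b. True})"
  by (simp add: B1_def mon_def)

lemma closed_csubspace_B1: "closed_csubspace (B1 \<pi> T)"
  unfolding B1_mon by (rule closed_csubspace_closure_cspan)

lemma mon_in_B1: "mon a 1 1 b \<in> B1 \<pi> T"
  unfolding B1_mon by (rule closure_cspan_base) blast

lemma B1_mult:
  assumes "x \<in> B1 \<pi> T" "y \<in> B1 \<pi> T"
  shows "x * y \<in> B1 \<pi> T"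
proof (rule closure_cspan_mult[OF assms[unfolded B1_mon] closed_csubspace_B1])
  fix s s'
  assume "s \<in> {mon a 1 1 b | a b. True}" "s' \<in> {mon a 1 1 b | a b. True}"
  then show "s * s' \<in> B1 \<pi> T"
    by (auto simp: mon_mult_le mon_in_B1 simp del: One_nat_def)
qed

lemma B1_star: "x \<in> B1 \<pi> T \<Longrightarrow> star x \<in> B1 \<pi> T"
  by (rule closure_cspan_star[OF _ closed_csubspace_B1])
    (auto simp: B1_mon[symmetric] star_mon mon_in_B1 simp del: One_nat_def intro: subst[OF B1_mon])

lemma B1_pi:
  assumes x: "x \<in> B1 \<pi> T"
  shows "\<pi> a * x \<in> B1 \<pi> T" "x * \<pi> a \<in> B1 \<pi> T"
proof -
  have m: "\<pi> a * mon c 1 1 d = mon (a * c) 1 1 d" "mon c 1 1 d * \<pi> a = mon c 1 1 (d * a)" for c d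
    by (simp_all add: mon_def pi_hom mult.assoc)
  show "\<pi> a * x \<in> B1 \<pi> T"
    by (rule closure_cspan_map[OF x[unfolded B1_mon] closed_csubspace_B1 clinear_mult(1,4)])
      (auto simp: m mon_in_B1 simp del: One_nat_def)
  show "x * \<pi> a \<in> B1 \<pi> T"
    by (rule closure_cspan_map[OF x[unfolded B1_mon] closed_csubspace_B1 clinear_mult(2,5)])
      (auto simp: m mon_in_B1 simp del: One_nat_def)
qed

text \<open>In terms of the bimodule, the closure of the image of M_L under \<psi>_T. Its elements
  are the left factors on which an approximate unit of B1 acts.\<close>

definition W :: "'c set" where
  "W = closure (cspan {\<pi> a * T | a. True})"

lemma W_mult_star: "w \<in> W \<Longrightarrow> w * star w \<in> B1 \<pi> T"
proof (unfold W_def, rule closure_cspan_mult[OF _ _ closed_csubspace_B1])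
  assume w: "w \<in> closure (cspan {\<pi> a * T | a. True})"
  then show "w \<in> closure (cspan {\<pi> a * T | a. True})" .
  show "star w \<in> closure (cspan {star T * \<pi> a | a. True})"
  proof (rule closure_cspan_star[OF w closed_csubspace_closure_cspan])
    fix s assume "s \<in> {\<pi> a * T | a. True}"
    then obtain a where "s = \<pi> a * T"
      by blast
    then have "star s = star T * \<pi> (star a)"
      by (simp add: star_mult pi_hom)
    then show "star s \<in> closure (cspan {star T * \<pi> a | a. True})"
      by (intro closure_cspan_base) blast
  qed
  fix s s'
  assume "s \<in> {\<pi> a * T | a. True}" "s' \<in> {star T * \<pi> a | a. True}"
  then obtain a b where "s = \<pi> a * T" "s' = star T * \<pi> b"
    by blast
  then have "s * s' = mon a 1 1 b"
    by (simp add: mon_def mult.assoc)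
  then show "s * s' \<in> B1 \<pi> T"
    using mon_in_B1 by simp
qed

lemma closed_csubspace_W: "closed_csubspace W"
  unfolding W_def by (rule closed_csubspace_closure_cspan)

lemma B1_mult_W:
  assumes "b \<in> B1 \<pi> T" "w \<in> W"
  shows "b * w \<in> W"
proof (rule closure_cspan_mult[OF assms[unfolded B1_mon W_def] closed_csubspace_W])
  fix s s'
  assume "s \<in> {mon a 1 1 b | a b. True}" "s' \<in> {\<pi> a * T | a. True}"
  then obtain a b c where s: "s = mon a 1 1 b" "s' = \<pi> c * T"
    by blast
  have "s' = mon c 1 0 1"
    by (simp add: s mon_def pi_facts)
  then have "s * s' = mon (a * \<alpha> (L (b * c))) 1 0 1"
    using mon_mult_le[of 1 1 a 1 b c 0 1] by (simp add: s)
  then have "s * s' = \<pi> (a * \<alpha> (L (b * c))) * T"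
    by (simp add: mon_def pi_facts)
  then show "s * s' \<in> W"
    unfolding W_def by (intro closure_cspan_base) blast
qed

text \<open>After normalization let h = v v* and u = 1 - g with g = (1 - h^2)^N, a polynomial in h
  without constant term. The square of the norm of g v is that of g h g, at most the norm of g h,
  whose square is at most 1/(2 N). It is h^2 that enters because polynomials are estimated on all of
  [-1, 1], where 1 - t^2 stays in [0, 1].\<close>

lemma approximate_unit_single:
  assumes w: "w \<in> W" and e: "e > 0"
  shows "\<exists>u\<in>B1 \<pi> T. norm (1 - u) \<le> 1 \<and> norm ((1 - u) * w) < e"
proof (cases "w = 0")
  case True
  then show ?thesis
    using csubspaceD(1) closed_csubspace_B1 e norm_one_le
    by (intro bexI[of _ 0]) (auto simp: closed_csubspace_def)
next
  case False
  note subD = csubspaceD[OF closed_csubspace_B1[unfolded closed_csubspace_def, THEN conjunct2]]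
  define v where "v = (1 / norm w) *\<^sub>R w"
  have v: "v \<in> W" "norm v = 1" "w = norm w *\<^sub>R v"
    using w False closed_csubspace_W csubspaceD(5)[of W w] by (auto simp: v_def closed_csubspace_def)
  define h where "h = v * star v"
  have h: "h \<in> B1 \<pi> T" "star h = h" "norm h \<le> 1"
    using W_mult_star v norm_mult_star[of v] by (auto simp: h_def star_mult star_star)
  define d where "d = e / norm w"
  have d: "d > 0"
    using e False by (simp add: d_def)
  \<comment> \<open>The C*-identity is applied twice, to g v and to g h, which accounts for the
    fourth power of d.\<close>
  obtain m where m: "1 / real (Suc m) < (d\<^sup>2)\<^sup>2"
    using nat_approx_posE[of "(d\<^sup>2)\<^sup>2"] d by auto
  define N where "N = Suc m"
  define g where "g = (1 - h * h) ^ N"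
  define p where "p = [:1, 0, -1 :: complex:]"
  have p: "real_coeffs p" "poly p (of_real t) = of_real (1 - t\<^sup>2)" "peval p h = 1 - h * h" for t
    by (auto simp: p_def power2_eq_square scaleC_one scaleC_minus_one)
  have gp: "g = peval (p ^ N) h"
    by (simp add: g_def peval_power p)
  have sg: "star g = g"
    unfolding gp by (intro star_peval real_coeffs_power p h)
  have t1: "0 \<le> t\<^sup>2 \<and> t\<^sup>2 \<le> 1" if "\<bar>t\<bar> \<le> 1" for t :: real
    using that by (simp add: abs_square_le_1)
  have ng: "norm g \<le> 1"
    unfolding gp
  proof (rule norm_peval_le[OF h(2,3) real_coeffs_power[OF p(1)]])
    fix t :: real assume "\<bar>t\<bar> \<le> 1"
    then show "cmod (poly (p ^ N) (of_real t)) \<le> 1"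
      using t1[of t] unfolding poly_power p(2) norm_power norm_of_real by (intro power_le_one) auto
  qed
  have "1 - (1 - h * h) ^ n \<in> B1 \<pi> T" for n
  proof (induction n)
    case (Suc n)
    have "1 - (1 - h * h) ^ Suc n = (1 - (1 - h * h) ^ n) + h * h - h * h * (1 - (1 - h * h) ^ n)"
      by (simp add: algebra_simps)
    then show ?case
      using Suc h subD B1_mult by metis
  qed (simp add: subD)
  then have u: "1 - g \<in> B1 \<pi> T"
    by (simp add: g_def)
  have "(norm (g * h))\<^sup>2 = norm (star (g * h) * (g * h))"
    by (rule cstar_identity[symmetric])
  also have "star (g * h) * (g * h) = peval (p ^ (2 * N) * [:0, 0, 1:]) h"
  proof -
    have c: "h * g = g * h"
      unfolding gp by (rule peval_commute)
    then have "star (g * h) * (g * h) = g * g * (h * h)"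
      by (metis star_mult sg h(2) mult.assoc)
    also have "g * g = peval (p ^ (2 * N)) h"
      by (simp add: gp peval_mult mult_2 power_add)
    also have "h * h = peval [:0, 0, 1:] h"
      by (simp add: scaleC_one)
    finally show ?thesis
      by (simp only: peval_mult)
  qed
  also have "norm \<dots> \<le> 1 / real (2 * N)"
  proof (rule norm_peval_le[OF h(2,3)])
    show "real_coeffs (p ^ (2 * N) * [:0, 0, 1:])"
      by (intro real_coeffs_mult real_coeffs_power p) simp
    fix t :: real assume t: "\<bar>t\<bar> \<le> 1"
    have "poly (p ^ (2 * N) * [:0, 0, 1:]) (of_real t) = of_real (t\<^sup>2 * (1 - t\<^sup>2) ^ (2 * N))"
      by (simp add: p(2) power2_eq_square)
    then have "cmod (poly (p ^ (2 * N) * [:0, 0, 1:]) (of_real t)) = \<bar>t\<^sup>2 * (1 - t\<^sup>2) ^ (2 * N)\<bar>"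
      by (metis norm_of_real)
    also have "\<dots> = t\<^sup>2 * (1 - t\<^sup>2) ^ (2 * N)"
      using t1[OF t] by simp
    also have "\<dots> \<le> 1 / real (2 * N)"
      using t1[OF t] by (intro mult_power_decay) (auto simp: N_def)
    finally show "cmod (poly (p ^ (2 * N) * [:0, 0, 1:]) (of_real t)) \<le> 1 / real (2 * N)" .
  qed
  also have "\<dots> \<le> 1 / real N"
    by (simp add: N_def field_simps)
  also have "\<dots> < (d\<^sup>2)\<^sup>2"
    using m by (simp add: N_def)
  finally have gh: "norm (g * h) < d\<^sup>2"
    by (rule power_less_imp_less_base) simp
  have "(norm (g * v))\<^sup>2 = norm (g * h * g)"
    by (simp add: norm_mult_star[symmetric] star_mult sg h_def mult.assoc)
  also have "\<dots> \<le> norm (g * h) * norm g"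
    by (rule norm_mult_ineq)
  also have "\<dots> \<le> norm (g * h) * 1"
    by (intro mult_left_mono ng) simp
  also have "\<dots> < d\<^sup>2"
    using gh by simp
  finally have gv: "norm (g * v) < d"
    by (rule power_less_imp_less_base) (use d in simp)
  have "norm (g * w) = norm w * norm (g * v)"
    by (subst v(3)) simp
  also have "\<dots> < e"
    using gv False by (simp add: d_def field_simps)
  finally show ?thesis
    using u ng by (intro bexI[of _ "1 - g"]) auto
qed

text \<open>The summands w v are treated one after the other by multiplying factors 1 - u. Such a
  product is again of this form with norm at most 1, so later factors do not spoil what is already
  small.\<close>

lemma approximate_unit:
  assumes "z \<in> cspan {w * v | w v. w \<in> W}" "u0 \<in> B1 \<pi> T" "norm (1 - u0) \<le> 1" "e > 0"
  shows "\<exists>u\<in>B1 \<pi> T. norm (1 - u) \<le> 1 \<and> norm ((1 - u) * z) < e"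
proof -
  note subD = csubspaceD[OF closed_csubspace_B1[unfolded closed_csubspace_def, THEN conjunct2]]
  note subW = csubspaceD[OF closed_csubspace_W[unfolded closed_csubspace_def, THEN conjunct2]]
  have join: "\<exists>u'\<in>B1 \<pi> T. 1 - u' = (1 - u) * (1 - u0)"
    if "u \<in> B1 \<pi> T" "u0 \<in> B1 \<pi> T" for u u0
  proof (rule bexI)
    show "1 - (u + u0 - u * u0) = (1 - u) * (1 - u0)"
      by (simp add: algebra_simps)
    show "u + u0 - u * u0 \<in> B1 \<pi> T"
      by (rule subD(4)[OF subD(2)[OF that] B1_mult[OF that]])
  qed
  have nm: "norm (x * y) \<le> 1" if "norm x \<le> 1" "norm y \<le> 1" for x y :: 'c
    using norm_mult_ineq[of x y] mult_le_one[of "norm x" "norm y"] that by auto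
  \<comment> \<open>The induction hypothesis must survive an earlier factor 1 - u0, because the
    factor chosen for one summand also acts on the remaining ones. The claim itself is the case u0 =
    0.\<close>
  define good where "good z \<longleftrightarrow> (\<forall>u0\<in>B1 \<pi> T. norm (1 - u0) \<le> 1 \<longrightarrow> (\<forall>e>0. \<exists>u\<in>B1 \<pi> T.
      norm (1 - u) \<le> 1 \<and> norm ((1 - u) * ((1 - u0) * z)) < e))" for z
  have "good z"
    using assms(1)
  proof (induction rule: complex_vector.span_induct_alt)
    case base
    then show ?case
      unfolding good_def using subD(1) norm_one_le by (auto intro!: bexI[of _ 0])
  next
    case (step c x y)
    then obtain w v where x: "x = w * v" "w \<in> W"
      by blast
    show ?case
      unfolding good_def
    proof (intro ballI impI allI)
      fix u0 and e :: real
      assume u0: "u0 \<in> B1 \<pi> T" "norm (1 - u0) \<le> 1" and e: "e > 0"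
      define w' where "w' = (1 - u0) * w"
      have "w' = w - u0 * w"
        by (simp add: w'_def algebra_simps)
      then have "w' \<in> W"
        using subW(4)[OF x(2) B1_mult_W[OF u0(1) x(2)]] by simp
      moreover define K where "K = cmod c * norm v + 1"
      have K: "K > 0"
        by (simp add: K_def add_nonneg_pos)
      ultimately obtain u1 where u1: "u1 \<in> B1 \<pi> T" "norm (1 - u1) \<le> 1"
          "norm ((1 - u1) * w') < e / 2 / K"
        using approximate_unit_single[of w' "e / 2 / K"] e by auto
      obtain u2 where u2: "u2 \<in> B1 \<pi> T" "1 - u2 = (1 - u1) * (1 - u0)"
        using join u1(1) u0(1) by blast
      have n2: "norm (1 - u2) \<le> 1"
        unfolding u2(2) using u1 u0 nm by blast
      obtain u3 where u3: "u3 \<in> B1 \<pi> T" "norm (1 - u3) \<le> 1"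
          "norm ((1 - u3) * ((1 - u2) * y)) < e / 2"
        using step(2) u2(1) n2 e unfolding good_def by (metis half_gt_zero)
      obtain u where u: "u \<in> B1 \<pi> T" "1 - u = (1 - u3) * (1 - u1)"
        using join u3(1) u1(1) by blast
      \<comment> \<open>The choice of u1 makes the first term small; u3 does so for the second,
        which already carries the factor 1 - u2 = (1 - u1)(1 - u0).\<close>
      have eq: "(1 - u) * ((1 - u0) * (c *\<^sub>C x + y)) =
          c *\<^sub>C ((1 - u3) * ((1 - u1) * w') * v) + (1 - u3) * ((1 - u2) * y)"
        unfolding u(2) u2(2) w'_def x(1)
        by (simp only: distrib_left mult_scaleC_right mult_scaleC_left mult.assoc)
      have "norm (c *\<^sub>C ((1 - u3) * ((1 - u1) * w') * v)) \<le> cmod c * (1 * norm ((1 - u1) * w') * norm v)"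
        unfolding norm_scaleC
        by (intro mult_left_mono order_trans[OF norm_mult_ineq] mult_right_mono u3 norm_ge_zero)
      also have "\<dots> \<le> norm ((1 - u1) * w') * K"
        by (simp add: K_def algebra_simps)
      also have "\<dots> < e / 2"
        using u1(3) K by (simp add: pos_less_divide_eq)
      finally have "norm ((1 - u) * ((1 - u0) * (c *\<^sub>C x + y))) < e / 2 + e / 2"
        unfolding eq by (intro norm_triangle_lt add_strict_mono u3)
      then show "\<exists>u\<in>B1 \<pi> T. norm (1 - u) \<le> 1 \<and> norm ((1 - u) * ((1 - u0) * (c *\<^sub>C x + y))) < e"
        using u nm[OF u3(2) u1(2)] by (intro bexI[of _ u]) auto
    qed
  qed
  then show ?thesis
    unfolding good_def using subD(1) norm_one_le assms(4) by (metis diff_zero mult_1)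
qed

end

section \<open>Injectivity on the core\<close>

text \<open>The assumption \<open>reflects_B1\<close> is the form in which condition (2') enters:
  \<tau> creates no new elements in the intersection of \<pi>(A) with B1.\<close>

locale toeplitz_rep_map = toeplitz_rep \<alpha> L \<pi> T
  for \<alpha> L :: "'a::cstar_algebra \<Rightarrow> 'a" and \<pi> :: "'a \<Rightarrow> 'c::cstar_algebra" and T :: 'c +
  fixes \<tau> :: "'c \<Rightarrow> 'b::cstar_algebra"
  assumes tau_hom: "star_hom \<tau>"
    and tau_cov: "toeplitz_covariant \<alpha> L (\<tau> \<circ> \<pi>) (\<tau> T)"
    and inj_tau_pi: "inj (\<tau> \<circ> \<pi>)"
    and reflects_B1: "\<tau> (\<pi> a) \<in> B1 (\<tau> \<circ> \<pi>) (\<tau> T) \<Longrightarrow> \<pi> a \<in> B1 \<pi> T"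
begin

interpretation image: toeplitz_rep \<alpha> L "\<tau> \<circ> \<pi>" "\<tau> T"
  using tau_cov by (rule toeplitz_rep.intro)

lemmas tau_facts = star_homD[OF tau_hom]
lemmas norm_tau_le = star_hom_contractive[OF tau_hom]

lemma norm_tau_pi: "norm (\<tau> (\<pi> a)) = norm a"
proof -
  have "norm ((\<tau> \<circ> \<pi>) a) = norm a"
  proof (rule star_hom_isometric[OF image.pi_facts(1), of UNIV])
    show "closed_star_subalgebra (UNIV :: 'a set)"
      by (simp add: closed_star_subalgebra_def complex_vector.subspace_UNIV)
    fix x assume "(\<tau> \<circ> \<pi>) x = 0"
    then show "x = 0"
      using injD[OF inj_tau_pi, of x 0] clinear_0[OF image.pi_hom(1)] by simp
  qed simp
  then show ?thesis
    by simp
qed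

lemma tau_B1:
  assumes "x \<in> B1 \<pi> T"
  shows "\<tau> x \<in> B1 (\<tau> \<circ> \<pi>) (\<tau> T)"
proof (rule closure_cspan_map[OF assms[unfolded B1_def] image.closed_csubspace_B1 tau_facts(1)
      star_hom_bounded_linear[OF tau_hom]])
  fix s
  assume "s \<in> {\<pi> a * T * star T * \<pi> b | a b. True}"
  then obtain a b where "s = \<pi> a * T * star T * \<pi> b"
    by blast
  then have "\<tau> s = (\<tau> \<circ> \<pi>) a * \<tau> T * star (\<tau> T) * (\<tau> \<circ> \<pi>) b"
    by (simp add: tau_facts)
  then show "\<tau> s \<in> B1 (\<tau> \<circ> \<pi>) (\<tau> T)"
    unfolding B1_def by (intro closure_cspan_base) blast
qed

text \<open>The cut-off takes place in A, its effect is seen in the image of \<tau>, and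
  \<open>reflects_B1\<close> brings the result back to B1.\<close>

lemma B1_approx:
  assumes a: "star a = a" and k: "k \<in> B1 \<pi> T" "star k = k" and e: "norm (\<tau> (\<pi> a) + \<tau> k) \<le> e"
  shows "\<exists>b\<in>B1 \<pi> T. norm (\<pi> a - b) \<le> e"
proof -
  have k': "\<tau> k \<in> B1 (\<tau> \<circ> \<pi>) (\<tau> T)" "star (\<tau> k) = \<tau> k"
    using tau_B1 k tau_facts(3)[of k] by auto
  have "norm ((\<tau> \<circ> \<pi>) a + \<tau> k) \<le> e"
    using e by simp
  note e' = approx_preimage_of_ideal[OF image.pi_facts(1) image.closed_csubspace_B1 _ _ _ a k' this]
  obtain c where c: "norm (a - c) \<le> e" "(\<tau> \<circ> \<pi>) c \<in> B1 (\<tau> \<circ> \<pi>) (\<tau> T)"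
  proof (rule e')
    show "(\<tau> \<circ> \<pi>) b * x \<in> B1 (\<tau> \<circ> \<pi>) (\<tau> T)" "x * (\<tau> \<circ> \<pi>) b \<in> B1 (\<tau> \<circ> \<pi>) (\<tau> T)"
      if "x \<in> B1 (\<tau> \<circ> \<pi>) (\<tau> T)" for x b
      by (rule image.B1_pi[OF that])+
    show "x * y \<in> B1 (\<tau> \<circ> \<pi>) (\<tau> T)"
      if "x \<in> B1 (\<tau> \<circ> \<pi>) (\<tau> T)" "y \<in> B1 (\<tau> \<circ> \<pi>) (\<tau> T)" for x y
      by (rule image.B1_mult[OF that])
  qed
  have "norm (\<pi> a - \<pi> c) \<le> norm (a - c)"
    using star_hom_contractive[OF pi_facts(1), of "a - c"] by (simp add: clinear_diff[OF pi_hom(1)])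
  then have "norm (\<pi> a - \<pi> c) \<le> e"
    using c(1) by linarith
  moreover have "\<pi> c \<in> B1 \<pi> T"
    using c(2) by (intro reflects_B1) simp
  ultimately show ?thesis
    by blast
qed

lemma tau_isometric_D0:
  assumes "x \<in> D 0"
  shows "norm (\<tau> x) = norm x"
proof -
  have "mon a 0 0 b \<in> range \<pi>" for a b
    by (auto simp: mon_def simp flip: pi_hom(2))
  moreover have "csubspace (range \<pi>)"
  proof (rule csubspaceI)
    show "0 \<in> range \<pi>"
      using rangeI[of \<pi> 0] by (simp add: clinear_0[OF pi_hom(1)])
    show "x + y \<in> range \<pi>" if "x \<in> range \<pi>" "y \<in> range \<pi>" for x y
      using that by (auto simp flip: clinear_add[OF pi_hom(1)])
    show "c *\<^sub>C x \<in> range \<pi>" if "x \<in> range \<pi>" for c x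
      using that by (auto simp flip: clinear_scaleC[OF pi_hom(1)])
  qed
  ultimately have "cspan {mon a k k b | a k b. k \<le> 0} \<subseteq> range \<pi>"
    by (intro complex_vector.span_minimal) auto
  then have "D 0 \<subseteq> closure (range \<pi>)"
    unfolding D_def by (rule closure_mono)
  moreover have "closure (range \<pi>) \<subseteq> {x. norm (\<tau> x) = norm x}"
  proof (rule closure_minimal)
    have "norm (\<tau> (\<pi> a)) = norm (\<pi> a)" for a
      using norm_tau_pi[of a] norm_tau_le[of "\<pi> a"] star_hom_contractive[OF pi_facts(1), of a] by linarith
    then show "range \<pi> \<subseteq> {x. norm (\<tau> x) = norm x}"
      by auto
    show "closed {x. norm (\<tau> x) = norm x}"
      by (intro closed_Collect_eq continuous_on_norm continuous_on_id linear_continuous_on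
          star_hom_bounded_linear tau_hom)
  qed
  ultimately show ?thesis
    using assms by auto
qed

text \<open>Compression between T* and T lowers a positive level by one and keeps level 0 at level 0
  by means of L. This drives the induction on n.\<close>

lemma compress_D:
  assumes "x \<in> D (Suc n)"
  shows "star T * \<pi> a * x * (\<pi> b * T) \<in> D n"
proof (rule closure_cspan_map[OF assms[unfolded D_def] closed_csubspace_D clinear_mult(3,6)])
  fix s
  assume "s \<in> {mon a k k b | a k b. k \<le> Suc n}"
  then obtain c k d where s: "s = mon c k k d" "k \<le> Suc n"
    by blast
  have e: "star T * \<pi> a * s * (\<pi> b * T) = mon 1 0 1 a * s * mon b 1 0 1"
    by (simp add: mon_def pi_facts mult.assoc)
  show "star T * \<pi> a * s * (\<pi> b * T) \<in> D n"
  proof (cases k)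
    case 0
    then have "mon 1 0 1 a * s * mon b 1 0 1 = star T * \<pi> (a * c * (d * b)) * T"
      by (simp add: s mon_def pi_facts pi_hom mult.assoc)
    also have "\<dots> = mon (L (a * c * (d * b))) 0 0 1"
      by (simp only: pi_facts(4)) (simp add: mon_def pi_facts)
    finally show ?thesis
      unfolding e by (simp add: mon_in_D)
  next
    case (Suc m)
    have "mon 1 0 1 a * s * mon b 1 0 1 = mon (L (a * c)) m k d * mon b 1 0 1"
      unfolding s Suc using mon_mult_le[of 1 "Suc m" 1 0 a c "Suc m" d] by simp
    also have "\<dots> = mon (L (a * c)) m m (L (d * b))"
      unfolding Suc using mon_mult_ge[of 1 "Suc m" "L (a * c)" m d b 0 1] by (simp add: star_star)
    finally show ?thesis
      unfolding e using s(2) Suc by (simp add: mon_in_D)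
  qed
qed

text \<open>The terms of level 0 add up to \<pi>(a); every other term begins with an element of W.
  The splitting is made on the algebraic span, where sums are finite.\<close>

lemma D_decompose:
  assumes "s \<in> cspan {mon a k k b | a k b. k \<le> n}"
  shows "\<exists>a. \<exists>z\<in>cspan {w * v | w v. w \<in> W}. s = \<pi> a + z"
  using assms
proof (induction rule: complex_vector.span_induct_alt)
  case base
  show ?case
    using complex_vector.span_zero clinear_0[OF pi_hom(1)] by (intro exI[of _ 0] bexI[of _ 0]) auto
next
  case (step c x y)
  then obtain a z where y: "y = \<pi> a + z" "z \<in> cspan {w * v | w v. w \<in> W}"
    by blast
  obtain a' k b' where x: "x = mon a' k k b'"
    using step(1) by blast
  show ?case
  proof (cases k)
    case 0
    then have "x = \<pi> (a' * b')"
      by (simp add: x mon_def pi_hom)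
    then have "c *\<^sub>C x + y = \<pi> (c *\<^sub>C (a' * b') + a) + z"
      by (simp add: y clinear_add[OF pi_hom(1)] clinear_scaleC[OF pi_hom(1)])
    then show ?thesis
      using y(2) by blast
  next
    case (Suc m)
    have "\<pi> a' * T \<in> W"
      unfolding W_def by (rule closure_cspan_base) blast
    moreover have "x = (\<pi> a' * T) * (T ^ m * star T ^ Suc m * \<pi> b')"
      unfolding x Suc by (simp add: mon_def mult.assoc)
    ultimately have "x \<in> cspan {w * v | w v. w \<in> W}"
      by (intro complex_vector.span_base) blast
    then have "c *\<^sub>C x + z \<in> cspan {w * v | w v. w \<in> W}"
      using y(2) by (intro complex_vector.span_add complex_vector.span_scale)
    moreover have "c *\<^sub>C x + y = \<pi> a + (c *\<^sub>C x + z)"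
      by (simp add: y)
    ultimately show ?thesis
      by blast
  qed
qed

text \<open>A kernel element of \<open>D (Suc n)\<close> is orthogonal to \<open>B1\<close> by the induction hypothesis. Cutting it down
  with an approximate unit of \<open>B1\<close> moves it into the closure of \<open>\<pi>(A) + B1\<close>, and there the
  hypothesis \<open>reflects_B1\<close> moves it into \<open>B1\<close>.\<close>

lemma selfadjoint_kernel_B1:
  assumes y: "y \<in> D (Suc n)" "star y = y" "\<tau> y = 0" and yB: "\<And>b. b \<in> B1 \<pi> T \<Longrightarrow> b * y = 0"
  shows "y \<in> B1 \<pi> T"
proof -
  have subB: "closed (B1 \<pi> T)" "csubspace (B1 \<pi> T)"
    using closed_csubspace_B1 by (auto simp: closed_csubspace_def)
  note subD = csubspaceD[OF subB(2)]
  have "\<exists>b\<in>B1 \<pi> T. dist b y < e" if e: "e > 0" for e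
  proof -
    obtain s where s: "s \<in> cspan {mon a k k b | a k b. k \<le> Suc n}" "norm (y - s) < e / 4"
      using y(1)[unfolded D_def closure_approachable, rule_format, of "e / 4"] e
      by (auto simp: dist_norm norm_minus_commute)
    obtain a z where z: "s = \<pi> a + z" "z \<in> cspan {w * v | w v. w \<in> W}"
      using D_decompose[OF s(1)] by blast
    obtain u where u: "u \<in> B1 \<pi> T" "norm (1 - u) \<le> 1" "norm ((1 - u) * z) < e / 4"
      using approximate_unit[OF z(2) subD(1), of "e / 4"] e norm_one_le by auto
    \<comment> \<open>As u y = 0, y equals (1 - u) y, which is close to (1 - u) \<pi>(a) = \<pi>(a)
      + k because 1 - u nearly kills z.\<close>
    define k where "k = - (u * \<pi> a)"
    have k: "k \<in> B1 \<pi> T"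
      unfolding k_def using B1_pi(2)[OF u(1)] subD(6) by blast
    define d where "d = y - (\<pi> a + k)"
    have d: "d = (1 - u) * (y - s) + (1 - u) * z"
      using yB[OF u(1)] by (simp add: d_def k_def z(1) algebra_simps)
    have "norm ((1 - u) * (y - s)) \<le> 1 * norm (y - s)"
      by (rule order_trans[OF norm_mult_ineq]) (intro mult_right_mono u norm_ge_zero)
    then have nd: "norm d < e / 2"
      unfolding d using norm_triangle_ineq[of "(1 - u) * (y - s)" "(1 - u) * z"] s(2) u(3) by linarith
    \<comment> \<open>Self-adjoint parts are taken because the cut-off requires them; y is
      self-adjoint, so the error does not grow.\<close>
    define a' where "a' = (1 / 2) *\<^sub>R (a + star a)"
    define k' where "k' = (1 / 2) *\<^sub>R (k + star k)"
    have a': "star a' = a'"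
      by (simp add: a'_def star_scaleR star_add star_star add.commute)
    have k': "star k' = k'" "k' \<in> B1 \<pi> T"
      using k B1_star subD by (auto simp: k'_def star_scaleR star_add star_star add.commute)
    have "y = (1 / 2) *\<^sub>R (y + star y)"
      unfolding y(2) by (simp flip: scaleR_2)
    then have "y - (\<pi> a' + k') = (1 / 2) *\<^sub>R (y + star y) - (\<pi> a' + k')"
      by metis
    also have "\<dots> = (1 / 2) *\<^sub>R (d + star d)"
      by (simp add: a'_def k'_def d_def clinear_scaleR[OF pi_hom(1)] clinear_add[OF pi_hom(1)]
          pi_hom(3) star_diff star_add algebra_simps)
    finally have "norm (y - (\<pi> a' + k')) \<le> norm d"
      using norm_triangle_ineq[of d "star d"] by simp
    then have n1: "norm (y - (\<pi> a' + k')) < e / 2"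
      using nd by linarith
    \<comment> \<open>Here the kernel enters: since \<tau>(y) = 0, the image of \<pi>(a') + k' is no
      larger than its distance from y.\<close>
    have "\<tau> (\<pi> a') + \<tau> k' = - \<tau> (y - (\<pi> a' + k'))"
      by (simp add: clinear_diff[OF tau_facts(1)] clinear_add[OF tau_facts(1)] y(3))
    then have "norm (\<tau> (\<pi> a') + \<tau> k') \<le> e / 2"
      using norm_tau_le[of "y - (\<pi> a' + k')"] n1 by simp
    then obtain b where b: "b \<in> B1 \<pi> T" "norm (\<pi> a' - b) \<le> e / 2"
      using B1_approx[OF a' k'(2) k'(1)] by blast
    have eq: "y - (b + k') = (y - (\<pi> a' + k')) + (\<pi> a' - b)"
      by simp
    have "norm (y - (b + k')) < e"
      unfolding eq using norm_triangle_ineq[of "y - (\<pi> a' + k')" "\<pi> a' - b"] n1 b(2) by linarith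
    then show ?thesis
      using subD(2)[OF b(1) k'(2)] by (metis dist_commute dist_norm)
  qed
  then have "y \<in> closure (B1 \<pi> T)"
    by (simp add: closure_approachable)
  then show ?thesis
    using subB(1) by simp
qed

lemma tau_injective_D: "x \<in> D n \<Longrightarrow> \<tau> x = 0 \<Longrightarrow> x = 0"
proof (induction n arbitrary: x)
  case 0
  then show ?case
    using tau_isometric_D0 by fastforce
next
  case (Suc n)
  \<comment> \<open>Passing to x* x gives a self-adjoint kernel element in the same
    \<open>D (Suc n)\<close>, as the cut-off requires; x vanishes with it by the
    C*-identity.\<close>
  define y where "y = star x * x"
  have y: "y \<in> D (Suc n)" "star y = y" "\<tau> y = 0"
    using Suc(2,3) D_mult D_star by (auto simp: y_def star_mult star_star tau_facts)
  \<comment> \<open>The norm of the compression of y y is the square of that of y \<pi>(a) T; the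
    compression lies in \<open>D n\<close> and in the kernel.\<close>
  have "y * (\<pi> a * T) = 0" for a
  proof -
    have "star T * \<pi> (star a) * (y * y) * (\<pi> a * T) \<in> D n"
      using compress_D D_mult y(1) by blast
    moreover have "\<tau> (star T * \<pi> (star a) * (y * y) * (\<pi> a * T)) = 0"
      by (simp add: tau_facts y(3))
    ultimately have "star T * \<pi> (star a) * (y * y) * (\<pi> a * T) = 0"
      by (rule Suc(1))
    moreover have "star (y * (\<pi> a * T)) * (y * (\<pi> a * T)) = star T * \<pi> (star a) * (y * y) * (\<pi> a * T)"
      by (simp add: star_mult y(2) pi_hom mult.assoc)
    ultimately show ?thesis
      using cstar_identity[of "y * (\<pi> a * T)"] by simp
  qed
  then have "y * s \<in> {0}" if "s \<in> {mon a 1 1 b | a b. True}" for s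
    using that by (auto simp: mon_def mult.assoc[symmetric])
  moreover have "closed_csubspace {0 :: 'c}"
    by (simp add: closed_csubspace_def complex_vector.subspace_def)
  ultimately have yB: "y * b = 0" if "b \<in> B1 \<pi> T" for b
    using closure_cspan_map[OF that[unfolded B1_mon] _ clinear_mult(1,4), of "{0}" y] by blast
  have "b * y = 0" if "b \<in> B1 \<pi> T" for b
    using arg_cong[OF yB[OF B1_star[OF that]], of star] by (simp add: star_mult star_star y(2))
  then have "y \<in> B1 \<pi> T"
    by (rule selfadjoint_kernel_B1[OF y])
  then have "y * y = 0"
    by (rule yB)
  then have "y = 0"
    using cstar_identity[of y] y(2) by simp
  then show ?case
    using cstar_identity[of x] by (simp add: y_def)
qed

lemma tau_isometric_D: "x \<in> D n \<Longrightarrow> norm (\<tau> x) = norm x"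
  by (rule star_hom_isometric[OF tau_hom D_subalgebra[of n] tau_injective_D[of _ n]])

end

section \<open>The gauge grading\<close>

context toeplitz_rep
begin

text \<open>Kept algebraic: every element is a finite sum of monomials, so one of degree 0 lies in a
  single \<open>D n\<close>.\<close>

definition deg :: "int \<Rightarrow> 'c set" where
  "deg k = cspan {mon a m n b | a m n b. int m - int n = k}"

lemma csubspace_deg: "csubspace (deg k)"
  unfolding deg_def by (rule complex_vector.subspace_span)

lemma mon_in_deg: "int m - int n = k \<Longrightarrow> mon a m n b \<in> deg k"
  unfolding deg_def by (rule complex_vector.span_base) blast

lemma deg_mult:
  assumes x: "x \<in> deg k" and y: "y \<in> deg l"
  shows "x * y \<in> deg (k + l)"
proof -
  have mm: "mon a m n b * mon c p r d \<in> deg (k + l)"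
    if "int m - int n = k" "int p - int r = l" for a m n b c p r d
  proof (cases "n \<le> p")
    case True
    then show ?thesis
      using that by (simp add: mon_mult_le mon_in_deg)
  next
    case False
    then show ?thesis
      using that by (simp add: mon_mult_ge mon_in_deg)
  qed
  have my: "mon a m n b * y \<in> deg (k + l)" if mn: "int m - int n = k" for a m n b
    using y unfolding deg_def[of l]
  proof (induction rule: complex_vector.span_induct_alt)
    case (step c s t)
    then show ?case
      using mm[OF mn] csubspaceD(2,3)[OF csubspace_deg] by (auto simp: distrib_left mult_scaleC_right)
  qed (use csubspaceD(1)[OF csubspace_deg] in simp)
  show ?thesis
    using x unfolding deg_def[of k]
  proof (induction rule: complex_vector.span_induct_alt)
    case (step c s t)
    then show ?case
      using my csubspaceD(2,3)[OF csubspace_deg] by (auto simp: distrib_right mult_scaleC_left)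
  qed (use csubspaceD(1)[OF csubspace_deg] in simp)
qed

lemma deg_star:
  assumes "x \<in> deg k"
  shows "star x \<in> deg (- k)"
  using assms unfolding deg_def[of k]
proof (induction rule: complex_vector.span_induct_alt)
  case (step c s t)
  then show ?case
    using csubspaceD(2,3)[OF csubspace_deg] by (auto simp: star_add star_scaleC star_mon mon_in_deg)
qed (use csubspaceD(1)[OF csubspace_deg] in simp)

lemma D_mono: "m \<le> n \<Longrightarrow> D m \<subseteq> D n"
  unfolding D_def by (intro closure_mono complex_vector.span_mono) (blast intro: le_trans)

lemma deg_zero:
  assumes "x \<in> deg 0"
  shows "\<exists>n. x \<in> D n"
  using assms unfolding deg_def
proof (induction rule: complex_vector.span_induct_alt)
  case base
  show ?case
    using csubspaceD(1) closed_csubspace_D by (auto simp: closed_csubspace_def)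
next
  case (step c s t)
  then obtain n where n: "t \<in> D n"
    by blast
  obtain a m b where "s = mon a m m b"
    using step(1) by auto
  then have "s \<in> D (max m n)" "t \<in> D (max m n)"
    using D_mono[of n "max m n"] n by (auto intro: mon_in_D)
  then show ?case
    using closed_csubspace_D[of "max m n"] csubspaceD(2,3) unfolding closed_csubspace_def by blast
qed

definition graded :: "nat \<Rightarrow> 'c set" where
  "graded K = {x. \<exists>f. (\<forall>k. f k \<in> deg k) \<and> x = (\<Sum>k=-int K..int K. f k)}"

lemma csubspace_graded: "csubspace (graded K)"
proof (rule csubspaceI)
  show "0 \<in> graded K"
    unfolding graded_def using csubspaceD(1)[OF csubspace_deg]
    by (intro CollectI exI[of _ "\<lambda>_. 0"]) simp
  fix x assume "x \<in> graded K"
  then obtain f where f: "\<And>k. f k \<in> deg k" "x = (\<Sum>k=-int K..int K. f k)"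
    unfolding graded_def by blast
  show "c *\<^sub>C x \<in> graded K" for c
    unfolding graded_def using f csubspaceD(3)[OF csubspace_deg]
    by (intro CollectI exI[of _ "\<lambda>k. c *\<^sub>C f k"]) (simp add: complex_vector.scale_sum_right)
  fix y assume "y \<in> graded K"
  then obtain g where g: "\<And>k. g k \<in> deg k" "y = (\<Sum>k=-int K..int K. g k)"
    unfolding graded_def by blast
  show "x + y \<in> graded K"
    unfolding graded_def using f g csubspaceD(2)[OF csubspace_deg]
    by (intro CollectI exI[of _ "\<lambda>k. f k + g k"]) (simp add: sum.distrib)
qed

lemma deg_subset_graded:
  assumes "x \<in> deg k" "\<bar>k\<bar> \<le> int K"
  shows "x \<in> graded K"
proof -
  define f where "f j = (if j = k then x else 0)" for j
  have "f j \<in> deg j" for j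
    using assms(1) csubspaceD(1)[OF csubspace_deg] by (simp add: f_def)
  moreover have "x = (\<Sum>j=-int K..int K. f j)"
    using assms(2) by (auto simp: f_def abs_le_iff)
  ultimately show ?thesis
    unfolding graded_def by blast
qed

lemma graded_mult:
  assumes "x \<in> graded K" "y \<in> graded M"
  shows "x * y \<in> graded (K + M)"
proof -
  obtain f where f: "\<And>k. f k \<in> deg k" "x = (\<Sum>k=-int K..int K. f k)"
    using assms(1) unfolding graded_def by blast
  obtain g where g: "\<And>k. g k \<in> deg k" "y = (\<Sum>k=-int M..int M. g k)"
    using assms(2) unfolding graded_def by blast
  have "x * y = (\<Sum>i=-int K..int K. \<Sum>j=-int M..int M. f i * g j)"
    unfolding f g by (rule sum_product)
  also have "\<dots> \<in> graded (K + M)"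
    using deg_mult[OF f(1) g(1)]
    by (intro complex_vector.subspace_sum[OF csubspace_graded]) (auto intro!: deg_subset_graded)
  finally show ?thesis .
qed

lemma graded_star:
  assumes "x \<in> graded K"
  shows "star x \<in> graded K"
proof -
  obtain f where f: "\<And>k. f k \<in> deg k" "x = (\<Sum>k=-int K..int K. f k)"
    using assms(1) unfolding graded_def by blast
  show ?thesis
    unfolding f star_sum using deg_star[OF f(1)]
    by (intro complex_vector.subspace_sum[OF csubspace_graded]) (auto intro!: deg_subset_graded)
qed

text \<open>The width grows only linearly with the exponent, which \<open>le_of_power_growth\<close>
  can absorb.\<close>

lemma graded_power: "x \<in> graded K \<Longrightarrow> x ^ n \<in> graded (K * n)"
proof (induction n)
  case 0
  have "1 = mon 1 0 0 1"
    by (simp add: mon_def pi_facts)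
  then have "1 \<in> deg 0"
    using mon_in_deg[of 0 0 0 1 1] by simp
  then show ?case
    by (auto intro: deg_subset_graded)
next
  case (Suc n)
  then show ?case
    using graded_mult[of x K "x ^ n" "K * n"] by simp
qed

lemma mon_in_graded: "mon a m n b \<in> graded (m + n)"
  by (rule deg_subset_graded[OF mon_in_deg[OF refl]]) simp

lemma graded_mono:
  assumes "x \<in> graded K" "K \<le> M"
  shows "x \<in> graded M"
proof -
  obtain f where f: "\<And>k. f k \<in> deg k" "x = (\<Sum>k=-int K..int K. f k)"
    using assms(1) unfolding graded_def by blast
  show ?thesis
    unfolding f using assms(2)
    by (intro complex_vector.subspace_sum[OF csubspace_graded] deg_subset_graded[OF f(1)]) auto
qed

lemma span_mon_graded:
  assumes "x \<in> cspan {mon a m n b | a m n b. True}"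
  shows "\<exists>K. x \<in> graded K"
  using assms
proof (induction rule: complex_vector.span_induct_alt)
  case base
  show ?case
    using csubspaceD(1)[OF csubspace_graded] by blast
next
  case (step c s t)
  then obtain K a m n b where t: "t \<in> graded K" and s: "s = mon a m n b"
    by blast
  have "s \<in> graded (m + n + K)" "t \<in> graded (m + n + K)"
    using graded_mono[OF mon_in_graded] graded_mono[OF t] s by auto
  then show ?case
    using csubspaceD(2,3)[OF csubspace_graded] by blast
qed

end

text \<open>The assumption \<open>kernel_invariant\<close> is the form in which the action on the
  range of \<tau> enters: it lets \<delta> descend to that range.\<close>

locale gauge_map = toeplitz_rep_map \<alpha> L \<pi> T \<tau>
  for \<alpha> L :: "'a::cstar_algebra \<Rightarrow> 'a" and \<pi> :: "'a \<Rightarrow> 'c::cstar_algebra" and T :: 'c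
    and \<tau> :: "'c \<Rightarrow> 'b::cstar_algebra" +
  fixes \<delta> :: "complex \<Rightarrow> 'c \<Rightarrow> 'c"
  assumes delta_hom: "cmod z = 1 \<Longrightarrow> star_hom (\<delta> z)"
    and delta_pi: "cmod z = 1 \<Longrightarrow> \<delta> z (\<pi> a) = \<pi> a"
    and delta_T: "cmod z = 1 \<Longrightarrow> \<delta> z T = z *\<^sub>C T"
    and kernel_invariant: "cmod z = 1 \<Longrightarrow> \<tau> x = 0 \<Longrightarrow> \<tau> (\<delta> z x) = 0"
begin

text \<open>A norm-controlled lift of \<tau>(x* x) can be moved by \<delta> in place of x* x,
  because their difference lies in the kernel, which \<delta> preserves.\<close>

lemma norm_tau_delta_le:
  assumes z: "cmod z = 1"
  shows "norm (\<tau> (\<delta> z x)) \<le> norm (\<tau> x)"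
proof -
  note dz = star_homD[OF delta_hom[OF z]]
  have "star (star x * x) = star x * x"
    by (simp add: star_mult star_star)
  from star_hom_lift[OF tau_hom closed_UNIV complex_vector.subspace_UNIV UNIV_I UNIV_I this]
  obtain y where y: "\<tau> y = \<tau> (star x * x)" "norm y \<le> norm (\<tau> (star x * x))"
    by blast
  have "\<tau> (\<delta> z (star x * x - y)) = 0"
    using y(1) by (intro kernel_invariant z) (simp add: clinear_diff[OF tau_facts(1)])
  then have "\<tau> (\<delta> z (star x * x)) = \<tau> (\<delta> z y)"
    by (simp add: clinear_diff[OF dz(1)] clinear_diff[OF tau_facts(1)])
  moreover have "norm (\<tau> (\<delta> z y)) \<le> norm y"
    using norm_tau_le[of "\<delta> z y"] star_hom_contractive[OF delta_hom[OF z], of y] by linarith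
  ultimately have "norm (\<tau> (\<delta> z (star x * x))) \<le> norm (\<tau> (star x * x))"
    using y(2) by simp
  then have "(norm (\<tau> (\<delta> z x)))\<^sup>2 \<le> (norm (\<tau> x))\<^sup>2"
    by (simp only: dz tau_facts cstar_identity)
  then show ?thesis
    by (rule power2_le_imp_le) simp
qed

lemma delta_deg:
  assumes z: "cmod z = 1" and x: "x \<in> deg k"
  shows "\<delta> z x = z powi k *\<^sub>C x"
proof -
  note dz = star_homD[OF delta_hom[OF z]]
  have z0: "z \<noteq> 0"
    using z by auto
  have "z * cnj z = 1"
    using complex_norm_square[of z] z by simp
  then have cz: "cnj z = inverse z"
    by (rule inverse_unique[symmetric])
  \<comment> \<open>The exponent is a successor because \<open>star_hom\<close> does not include the
    preservation of 1.\<close>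
  have d1: "\<delta> z (x ^ Suc m) = \<delta> z x ^ Suc m" for x m
    by (induction m) (simp_all add: dz(2))
  have pw: "\<delta> z (\<pi> a * T ^ m) = z ^ m *\<^sub>C (\<pi> a * T ^ m)" for a m
    by (cases m) (simp_all add: delta_pi[OF z] dz(2) d1 delta_T[OF z] power_scaleC scaleC_one
        mult_scaleC_right del: power_Suc)
  have mon: "\<delta> z (mon a m n b) = z powi (int m - int n) *\<^sub>C mon a m n b" for a m n b
  proof -
    have e: "mon a m n b = (\<pi> a * T ^ m) * star (\<pi> (star b) * T ^ n)"
      by (simp add: mon_def star_mult star_power pi_hom star_star mult.assoc)
    have "\<delta> z (mon a m n b) = \<delta> z (\<pi> a * T ^ m) * \<delta> z (star (\<pi> (star b) * T ^ n))"
      unfolding e by (rule dz(2))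
    also have "\<dots> = (z ^ m * cnj z ^ n) *\<^sub>C mon a m n b"
      unfolding e dz(3) pw
      by (simp add: star_scaleC mult_scaleC_left mult_scaleC_right scaleC_scaleC mult.commute)
    also have "z ^ m * cnj z ^ n = z powi (int m - int n)"
      using z0 by (simp add: cz power_int_diff divide_inverse power_inverse)
    finally show ?thesis .
  qed
  show ?thesis
    using x unfolding deg_def
  proof (induction rule: complex_vector.span_induct_alt)
    case base
    then show ?case
      using clinear_0[OF dz(1)] by simp
  next
    case (step c s t)
    then show ?case
      using mon by (auto simp: clinear_add[OF dz(1)] clinear_scaleC[OF dz(1)] scaleC_add_right
          scaleC_scaleC mult.commute)
  qed
qed

text \<open>A discrete Fourier coefficient: N = 2 K + 1 roots of unity suffice, because the
  occurring degrees differ by at most 2 K < N. A component f of nonzero degree is reached by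
  applying isometry on the core to f* f, which has degree 0.\<close>

lemma norm_component_le:
  assumes f: "\<And>k. f k \<in> deg k" and k: "\<bar>k\<bar> \<le> int K"
  shows "norm (f k) \<le> norm (\<tau> (\<Sum>j=-int K..int K. f j))"
proof -
  define x where "x = (\<Sum>j=-int K..int K. f j)"
  define N where "N = 2 * K + 1"
  define w where "w j = cis (2 * pi * real j / real N)" for j
  have w: "cmod (w j) = 1" "w j \<noteq> 0" for j
    by (auto simp: w_def)
  have dx: "\<delta> (w j) x = (\<Sum>i=-int K..int K. w j powi i *\<^sub>C f i)" for j
    unfolding x_def clinear_sum[OF star_homD(1)[OF delta_hom[OF w(1)]]]
    by (simp add: delta_deg[OF w(1) f])
  have pp: "w j powi (- k) * w j powi i = w j powi (i - k)" for i j
    using power_int_add[of "w j" "- k" i] w by simp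
  have "(\<Sum>j<N. w j powi (- k) *\<^sub>C \<delta> (w j) x) =
      (\<Sum>j<N. \<Sum>i=-int K..int K. (w j powi (i - k)) *\<^sub>C f i)"
    by (simp only: dx complex_vector.scale_sum_right scaleC_scaleC pp)
  also have "\<dots> = (\<Sum>i=-int K..int K. \<Sum>j<N. (w j powi (i - k)) *\<^sub>C f i)"
    by (rule sum.swap)
  also have "\<dots> = (\<Sum>i=-int K..int K. if i = k then of_nat N *\<^sub>C f i else 0)"
  proof (rule sum.cong[OF refl])
    fix i assume i: "i \<in> {-int K..int K}"
    show "(\<Sum>j<N. (w j powi (i - k)) *\<^sub>C f i) = (if i = k then of_nat N *\<^sub>C f i else 0)"
    proof -
      have "(\<Sum>j<N. w j powi (i - k)) = (if i = k then of_nat N else 0)"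
        unfolding w_def using i k sum_roots_of_unity[of "i - k" N] by (auto simp: N_def)
      then show ?thesis
        by (simp flip: complex_vector.scale_sum_left)
    qed
  qed
  also have "\<dots> = of_nat N *\<^sub>C f k"
    using k by (auto simp: abs_le_iff)
  finally have "of_nat N *\<^sub>C f k = (\<Sum>j<N. w j powi (- k) *\<^sub>C \<delta> (w j) x)"
    by simp
  from arg_cong[OF this, of \<tau>]
  have "of_nat N *\<^sub>C \<tau> (f k) = (\<Sum>j<N. w j powi (- k) *\<^sub>C \<tau> (\<delta> (w j) x))"
    by (simp only: clinear_scaleC[OF tau_facts(1)] clinear_sum[OF tau_facts(1)])
  from arg_cong[OF this, of norm]
  have "real N * norm (\<tau> (f k)) = norm (\<Sum>j<N. w j powi (- k) *\<^sub>C \<tau> (\<delta> (w j) x))"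
    by (simp only: norm_scaleC norm_of_nat)
  also have "\<dots> \<le> (\<Sum>j<N. norm (\<tau> x))"
    using norm_tau_delta_le[OF w(1)]
    by (intro sum_norm_le) (simp add: norm_scaleC norm_power_int w)
  finally have "norm (\<tau> (f k)) \<le> norm (\<tau> x)"
    by (simp add: N_def)
  moreover have "norm (\<tau> (f k)) = norm (f k)"
  proof -
    have "star (f k) * f k \<in> deg 0"
      using deg_mult[OF deg_star[OF f] f, of k k] by simp
    then have "norm (\<tau> (star (f k) * f k)) = norm (star (f k) * f k)"
      using deg_zero tau_isometric_D by blast
    then have "(norm (\<tau> (f k)))\<^sup>2 = (norm (f k))\<^sup>2"
      by (simp only: tau_facts cstar_identity)
    then show ?thesis
      by simp
  qed
  ultimately show ?thesis
    by (simp add: x_def)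
qed

lemma norm_graded_le:
  assumes "x \<in> graded K"
  shows "norm x \<le> real (2 * K + 1) * norm (\<tau> x)"
proof -
  obtain f where f: "\<And>k. f k \<in> deg k" "x = (\<Sum>k=-int K..int K. f k)"
    using assms(1) unfolding graded_def by blast
  have "norm x \<le> (\<Sum>k=-int K..int K. norm (\<tau> x))"
    unfolding f by (intro sum_norm_le norm_component_le f) auto
  then show ?thesis
    by (simp add: nat_add_distrib algebra_simps)
qed

text \<open>The linear factor is removed by applying the estimate to the powers \<open>y ^ 2 ^ n\<close>.\<close>

lemma norm_graded_le_sharp:
  assumes "x \<in> graded K"
  shows "norm x \<le> norm (\<tau> x)"
proof -
  define y where "y = star x * x"
  have y: "star y = y" "star (\<tau> y) = \<tau> y"
    by (simp_all add: y_def star_mult star_star tau_facts)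
  have t1: "\<tau> 1 = 1"
    using tau_cov pi_facts(2) by (simp add: toeplitz_covariant_def)
  have tp: "\<tau> (y ^ n) = \<tau> y ^ n" for n
    by (induction n) (simp_all add: t1 tau_facts(2))
  have yg: "y \<in> graded (K + K)"
    unfolding y_def by (intro graded_mult graded_star assms)
  \<comment> \<open>As y has width K + K, its power \<open>2 ^ n\<close> has width (K + K) 2 ^ n, so
    the factor 2 (K + K) 2 ^ n + 1 is 4 K 2 ^ n + 1.\<close>
  have main: "norm y ^ 2 ^ n \<le> (real (4 * K) * 2 ^ n + 1) * norm (\<tau> y) ^ 2 ^ n" for n
  proof -
    have "norm y ^ 2 ^ n = norm (y ^ 2 ^ n)"
      by (simp add: norm_selfadjoint_power y)
    also have "\<dots> \<le> real (2 * ((K + K) * 2 ^ n) + 1) * norm (\<tau> (y ^ 2 ^ n))"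
      by (rule norm_graded_le[OF graded_power[OF yg]])
    also have "\<dots> = (real (4 * K) * 2 ^ n + 1) * norm (\<tau> y) ^ 2 ^ n"
      by (simp add: tp norm_selfadjoint_power y algebra_simps)
    finally show ?thesis .
  qed
  \<comment> \<open>The growth argument requires a positive r; if \<tau>(y) = 0, the estimate for n
    = 0 already settles the claim.\<close>
  have "norm y \<le> norm (\<tau> y)"
  proof (cases "\<tau> y = 0")
    case True
    then show ?thesis
      using main[of 0] by simp
  next
    case False
    then show ?thesis
      using le_of_power_growth[OF norm_ge_zero _ main] by simp
  qed
  then have "(norm x)\<^sup>2 \<le> (norm (\<tau> x))\<^sup>2"
    by (simp add: y_def tau_facts cstar_identity)
  then show ?thesis
    by (rule power2_le_imp_le) simp
qed

lemma inj_tau: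
  assumes dense: "closure (cspan {mon a m n b | a m n b. True}) = UNIV"
  shows "inj \<tau>"
proof -
  have "closure (cspan {mon a m n b | a m n b. True}) \<subseteq> {x. norm x \<le> norm (\<tau> x)}"
  proof (rule closure_minimal)
    show "cspan {mon a m n b | a m n b. True} \<subseteq> {x. norm x \<le> norm (\<tau> x)}"
      using span_mon_graded norm_graded_le_sharp by blast
    show "closed {x. norm x \<le> norm (\<tau> x)}"
      by (intro closed_Collect_le continuous_on_norm continuous_on_id linear_continuous_on
          star_hom_bounded_linear tau_hom)
  qed
  then have "norm x \<le> norm (\<tau> x)" for x
    using dense by auto
  then show ?thesis
    using clinear_diff[OF tau_facts(1)]
    by (intro injI) (metis eq_iff_diff_eq_0 norm_le_zero_iff norm_zero)
qed

end

section \<open>Density of the monomials and the proof of the theorem\<close>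

context toeplitz_rep
begin

lemma closed_star_subalgebra_mon:
  "closed_star_subalgebra (closure (cspan {mon a m n b | a m n b. True}))"
proof -
  have c: "closed_csubspace (closure (cspan {mon a m n b | a m n b. True}))"
    by (rule closed_csubspace_closure_cspan)
  have base: "mon a m n b \<in> closure (cspan {mon a m n b | a m n b. True})" for a m n b
    by (rule closure_cspan_base) blast
  have "mon a m n b * mon c p r d \<in> closure (cspan {mon a m n b | a m n b. True})" for a m n b c p r d
    using base by (cases "n \<le> p") (simp_all add: mon_mult_le mon_mult_ge)
  then have "x * y \<in> closure (cspan {mon a m n b | a m n b. True})"
    if "x \<in> closure (cspan {mon a m n b | a m n b. True})"
      "y \<in> closure (cspan {mon a m n b | a m n b. True})" for x y
    using closure_cspan_mult[OF that c] by blast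
  moreover have "star x \<in> closure (cspan {mon a m n b | a m n b. True})"
    if "x \<in> closure (cspan {mon a m n b | a m n b. True})" for x
    using closure_cspan_star[OF that c] base star_mon by force
  ultimately show ?thesis
    using c by (simp add: closed_star_subalgebra_def closed_csubspace_def)
qed

end

lemma closed_star_subalgebra_vimage:
  assumes h: "star_hom h" and C: "closed_star_subalgebra C"
  shows "closed_star_subalgebra {x. h x \<in> C}"
proof -
  have "closed_csubspace {x. h x \<in> C}"
    using C by (intro closed_csubspace_vimage star_homD(1)[OF h] star_hom_bounded_linear[OF h])
      (simp add: closed_csubspace_def closed_star_subalgebra_def)
  then show ?thesis
    using C by (auto simp: closed_star_subalgebra_def closed_csubspace_def star_homD[OF h])
qed

lemma toeplitz_covariant_image:
  assumes i: "toeplitz_covariant \<alpha> L i S" and Q: "star_hom Q" "surj Q"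
  shows "toeplitz_covariant \<alpha> L (Q \<circ> i) (Q S)"
proof -
  note Qh = star_homD[OF Q(1)]
  \<comment> \<open>Surjectivity makes Q unital: Q 1 = Q 1 Q u = Q u = 1.\<close>
  obtain u where u: "Q u = 1"
    using Q(2) by (metis surjD)
  have "Q 1 = 1"
    using Qh(2)[of 1 u] u by simp
  moreover have "clinear (Q \<circ> i)" "\<And>x. i (star x) = star (i x)" "\<And>x y. i (x * y) = i x * i y"
    using i Qh(1) by (auto simp: toeplitz_covariant_def star_hom_def clinear_iff)
  moreover have "\<And>a. Q S * Q (i a) = Q (i (\<alpha> a)) * Q S" "\<And>a. star (Q S) * Q (i a) * Q S = Q (i (L a))"
    using i by (simp_all add: toeplitz_covariant_def flip: Qh(2,3))
  ultimately show ?thesis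
    using i by (simp add: toeplitz_covariant_def star_hom_def Qh(2,3))
qed

theorem corollary5p3:
  fixes \<alpha> L :: "'a::cstar_algebra \<Rightarrow> 'a"
    and ract :: "'m::complex_banach \<Rightarrow> 'a \<Rightarrow> 'm"
    and ip :: "'m \<Rightarrow> 'm \<Rightarrow> 'a"
    and q :: "'a \<Rightarrow> 'm"
    and \<phi> :: "'a \<Rightarrow> 'm \<Rightarrow>\<^sub>L 'm"
    and iA :: "'a \<Rightarrow> 't::cstar_algebra"
    and S :: 't
    and Q :: "'t \<Rightarrow> 'c::cstar_algebra"
    and jA :: "'a \<Rightarrow> 'c"
    and T :: 'c
    and \<delta> :: "complex \<Rightarrow> 'c \<Rightarrow> 'c"
    and \<rho> :: "'a \<Rightarrow> 'b::cstar_algebra"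
    and V :: 'b
    and \<tau> :: "'c \<Rightarrow> 'b"
  assumes endo: "star_hom \<alpha>"
    and transfer: "transfer_operator \<alpha> L"
    and bimodule: "exel_bimodule \<alpha> L ract ip q \<phi>"
    and toeplitz: "toeplitz_algebra \<alpha> L iA S"
    and crossed: "exel_quotient \<alpha> iA S Q"
    and jA: "jA = Q \<circ> iA" and T: "T = Q S"
    and gauge: "circle_action UNIV \<delta>"
      "\<forall>z\<in>sphere 0 1. (\<forall>a. \<delta> z (jA a) = jA a) \<and> \<delta> z T = z *\<^sub>C T"
    and almost_faithful: "almost_faithful_on L (ideal_K \<alpha> ract ip \<phi>)"
    and covariant: "covariant \<alpha> L ract ip q \<phi> \<rho> V"
    and tau: "star_hom \<tau>" "\<tau> \<circ> jA = \<rho>" "\<tau> T = V"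
    and faithful: "inj \<rho>"
    and J_condition: "\<forall>a\<in>ideal_J ract ip \<phi>.
      \<rho> a = induced_hom ract ip (psi q \<rho> V) (\<phi> a) \<longrightarrow>
      jA a = induced_hom ract ip (psi q jA T) (\<phi> a)"
    and action: "\<exists>\<beta>. circle_action (range \<tau>) \<beta> \<and> (\<forall>z\<in>sphere 0 1. \<beta> z \<circ> \<tau> = \<tau> \<circ> \<delta> z)"
  shows "inj \<tau>"
proof -
  have Q: "star_hom Q" "surj Q"
    using crossed by (auto simp: exel_quotient_def)
  have jT: "toeplitz_covariant \<alpha> L jA T"
    unfolding jA T using toeplitz Q by (intro toeplitz_covariant_image) (auto simp: toeplitz_algebra_def)
  have rV: "toeplitz_covariant \<alpha> L \<rho> V"
    using covariant by (simp add: covariant_def)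
  interpret j: exel_representation \<alpha> L ract ip q \<phi> jA T
    using bimodule jT by unfold_locales
  interpret r: exel_representation \<alpha> L ract ip q \<phi> \<rho> V
    using bimodule rV by unfold_locales
  interpret toeplitz_rep \<alpha> L jA T
    using jT by unfold_locales
  have rho_iso: "norm (\<rho> a) = norm a" for a
  proof (rule star_hom_isometric[OF r.rho_facts(1), of UNIV])
    fix x assume "\<rho> x = 0"
    then show "x = 0"
      using injD[OF faithful, of x 0] clinear_0[OF r.rho_hom(1)] by simp
  qed (simp_all add: closed_star_subalgebra_def complex_vector.subspace_UNIV)
  \<comment> \<open>Membership in the B1 of (\<rho>, V) yields the premise of condition (2'). Its
    conclusion exhibits jA a as a value of the induced homomorphism, and such values lie in the B1
    of (jA, T).\<close>
  have reflects: "jA a \<in> B1 jA T" if "\<rho> a \<in> B1 \<rho> V" for a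
  proof -
    have a: "a \<in> ideal_J ract ip \<phi>" "\<rho> a = induced_hom ract ip (psi q \<rho> V) (\<phi> a)"
      using r.B1_imp_ideal_J[OF rho_iso that] by auto
    then have "jA a = induced_hom ract ip (psi q jA T) (\<phi> a)"
      using J_condition by blast
    then show ?thesis
      using j.induced_hom_B1 a(1) by (simp add: ideal_J_def)
  qed
  interpret gauge_map \<alpha> L jA T \<tau> \<delta>
  proof
    show "star_hom \<tau>"
      by (rule tau(1))
    show "toeplitz_covariant \<alpha> L (\<tau> \<circ> jA) (\<tau> T)" "inj (\<tau> \<circ> jA)"
      using rV faithful by (simp_all add: tau)
    show "jA a \<in> B1 jA T" if "\<tau> (jA a) \<in> B1 (\<tau> \<circ> jA) (\<tau> T)" for a
      using that reflects unfolding tau(2,3) by (simp flip: tau(2))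
    fix z :: complex
    assume z: "cmod z = 1"
    then have zs: "z \<in> sphere 0 1"
      by simp
    show "star_hom (\<delta> z)"
      using gauge(1) zs unfolding circle_action_def star_hom_def clinear_iff by blast
    show "\<delta> z (jA a) = jA a" for a
      using gauge(2) zs by blast
    show "\<delta> z T = z *\<^sub>C T"
      using gauge(2) zs by blast
    obtain \<beta> where \<beta>: "circle_action (range \<tau>) \<beta>" "\<And>x. \<beta> z (\<tau> x) = \<tau> (\<delta> z x)"
      using action zs by (metis comp_apply)
    \<comment> \<open>The action is linear only on the range of \<tau>, so 0 is written as a
      multiple of \<tau>(0).\<close>
    have "\<beta> z (0 *\<^sub>C \<tau> 0) = 0 *\<^sub>C \<beta> z (\<tau> 0)"
      using \<beta>(1) zs unfolding circle_action_def by blast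
    then have "\<beta> z 0 = 0"
      by simp
    then show "\<tau> (\<delta> z x) = 0" if "\<tau> x = 0" for x
      using \<beta>(2)[of x] that by simp
  qed
  let ?P = "closure (cspan {mon a m n b | a m n b. True})"
  have "closed_star_subalgebra {x. Q x \<in> ?P}"
    by (rule closed_star_subalgebra_vimage[OF Q(1) closed_star_subalgebra_mon])
  moreover have "Q S \<in> ?P"
  proof -
    have "T = mon 1 1 0 1"
      by (simp add: mon_def pi_facts)
    then show ?thesis
      unfolding T[symmetric] by (intro closure_cspan_base) blast
  qed
  moreover have "Q (iA a) \<in> ?P" for a
  proof -
    have "jA a = mon a 0 0 1"
      by (simp add: mon_def pi_facts)
    moreover have "Q (iA a) = jA a"
      by (simp add: jA)
    ultimately show ?thesis
      by (intro closure_cspan_base) auto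
  qed
  \<comment> \<open>S and iA generate the Toeplitz algebra, so the preimage of the closed span under
    Q is everything; as Q is onto, the monomials span a dense subspace.\<close>
  ultimately have "closed_star_subalgebra hull (insert S (range iA)) \<subseteq> {x. Q x \<in> ?P}"
    by (intro hull_minimal) auto
  then have QP: "Q x \<in> ?P" for x
    using toeplitz unfolding toeplitz_algebra_def by blast
  have "y \<in> ?P" for y
  proof -
    obtain x where "y = Q x"
      using surjD[OF Q(2)] by blast
    then show ?thesis
      using QP by blast
  qed
  then have "?P = UNIV"
    by blast
  then show ?thesis
    by (rule inj_tau)
qed

end
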